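(* Consider the power network system (S) and the optimization problem OSLC described in the context, and consider equilibria of (S) with respect to which assumptions (A1)–(A5) of the context are all satisfied. If the dynamics of generation and controllable demand are chosen such that $$k_{p^M_j}(\bar u)=\big[(C_j')^{-1}(\bar u)\big]^{p^{M,max}_j}_{p^{M,min}_j}\ (j\in G),\qquad k_{d^c_j}(\bar u)=\big[(C_{dj}')^{-1}(-\bar u)\big]^{d^{c,max}_j}_{d^{c,min}_j}\ (j\in N)$$ hold for all $\bar u\in\mathbb R$, then about any such equilibrium there exists an open neighbourhood of initial conditions $(\eta(0),\omega^G(0),x^M(0),x^c(0),x^u(0))$ such that the solutions of (S) starting in it are guaranteed to converge to a global minimum of OSLC, i.e. they converge to an equilibrium of (S) whose associated values $(p^{M,*},d^{c,*},d^{u,*})$ form a global minimizer of OSLC.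
   Context: **Notation.** $[q]^b_a:=\max\{\min\{q,b\},a\}$ for $a\le b$; $f'$ is the derivative of $f$, and $f^{-1}$ its inverse function. **Input-output systems.** All subsystems are of the form $\dot x=f(x,u)$, $y=g(x,u)$ with input $u(t)\in\mathbb R$, state $x(t)\in\mathbb R^m$, output $y(t)\in\mathbb R$, $f$ locally Lipschitz and $g$ continuous. For every constant input $u\equiv\bar u\in\mathbb R$ there is a unique locally asymptotically stable equilibrium point $\bar x$ (so $f(\bar x,\bar u)=0$, and $\bar x$ is the unique equilibrium point for that input). The static input-state characteristic is $k_x(\bar u):=\bar x$ and the static input-output characteristic is $k_y(\bar u):=g(k_x(\bar u),\bar u)$. **Network.** $(N,E)$ is a finite connected directed graph with arbitrary orientation ($(i,j)\in E\Rightarrow (j,i)\notin E$); $N$ is partitioned into generation buses $G=\{1,\dots,|G|\}$ and load buses $L=\{|G|+1,\dots,|N|\}$. $i:i\to j$ and $k:j\to k$ denote predecessors and successors of $j$. Constants: $M_j>0$ ($j\in G$), $B_{ij}>0$ and $p^{nom}_{ij}\in\mathbb R$ ($(i,j)\in E$), $p^L_j\in\mathbb R$ ($j\in N$). **System (S).** $$\dot\eta_{ij}=\omega_i-\omega_j,\quad (i,j)\in E,$$ $$M_j\dot\omega_j=-p^L_j+p^M_j-(d^c_j+d^u_j)-\sum_{k:j\to k}p_{jk}+\sum_{i:i\to j}p_{ij},\quad j\in G,$$ $$0=-p^L_j-(d^c_j+d^u_j)-\sum_{k:j\to k}p_{jk}+\sum_{i:i\to j}p_{ij},\quad j\in L,$$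 $$p_{ij}=B_{ij}\sin\eta_{ij}-p^{nom}_{ij},\quad (i,j)\in E,$$ where $\eta_{ij}=\theta_i-\theta_j$ are phase differences of bus angles, and $p^M_j$ ($j\in G$, generation), $d^c_j$ ($j\in N$, controllable demand), $d^u_j$ ($j\in N$, uncontrollable frequency-dependent demand) are outputs of independent systems of the form $\dot x=f(x,u)$, $y=g(x,u)$ (with $f$ locally Lipschitz, $g$ continuous, and a unique locally asymptotically stable equilibrium point for every constant input) with input $-\omega_j$ and states $x^{M,j},x^{c,j},x^{u,j}$ respectively. Write $x^M=[x^{M,j}]_{j\in G}$, $x^c=[x^{c,j}]_{j\in N}$, $x^u=[x^{u,j}]_{j\in N}$, $\omega^G=[\omega_j]_{j\in G}$, $\omega^L=[\omega_j]_{j\in L}$. **Equilibrium.** Constants $(\eta^*,\omega^*,x^{M,*},x^{c,*},x^{u,*})$ form an equilibrium of (S) if $\omega^*_i=\omega^*_j$ for $(i,j)\in E$; $0=-p^L_j+p^{M,*}_j-(d^{c,*}_j+d^{u,*}_j)-\sum_{k:j\to k}p^*_{jk}+\sum_{i:i\to j}p^*_{ij}$ for $j\in G$; $0=-p^L_j-(d^{c,*}_j+d^{u,*}_j)-\sum_{k:j\to k}p^*_{jk}+\sum_{i:i\to j}p^*_{ij}$ for $j\in L$; $x^{M,j,*}=k_{x^{M,j}}(-\omega^*_j)$ ($j\in G$), $x^{c,j,*}=k_{x^{c,j}}(-\omega_j^* )$, $x^{u,j,*}=k_{x^{u,j}}(-\omega_j^* )$ ($j\in N$); where $p^*_{ij}=B_{ij}\sin\eta^*_{ij}-p^{nom}_{ij}$,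 $p^{M,*}_j=k_{p^M_j}(-\omega_j^* )$, $d^{c,*}_j=k_{d^c_j}(-\omega_j^* )$, $d^{u,*}_j=k_{d^u_j}(-\omega_j^* )$. **OSLC problem.** Let $h_j(z):=k_{d^u_j}(-z)$ for $z\in\mathbb R$, $j\in N$ (taken invertible with differentiable inverse $h_j^{-1}$ on $\mathbb R$, as implicit in (A5)). Given cost functions $C_j$ ($j\in G$), $C_{dj}$ ($j\in N$) from $\mathbb R$ to $\mathbb R$ and bounds $p^{M,min}_j\le p^{M,max}_j$, $d^{c,min}_j\le d^{c,max}_j$, OSLC is $$\min_{p^M,d^c,d^u}\ \sum_{j\in G}C_j(p^M_j)+\sum_{j\in N}\Big(C_{dj}(d^c_j)+\int_0^{d^u_j}h_j^{-1}(z)\,dz\Big)$$ subject to $\sum_{j\in G}p^M_j=\sum_{j\in N}(d^c_j+d^u_j+p^L_j)$, $\ p^{M,min}_j\le p^M_j\le p^{M,max}_j$ ($j\in G$), $\ d^{c,min}_j\le d^c_j\le d^{c,max}_j$ ($j\in N$). The inverses $(C_j')^{-1}$, $(C_{dj}')^{-1}$ are understood to be defined at the points where they are evaluated. **Passivity.** A system $\dot x=f(x,u)$, $y=g(x,u)$ is locally input strictly passive about constant input value $\bar u$ and constant state value $\bar x$ if there are open neighbourhoods $U$ of $\bar u$ and $X$ of $\bar x$ and a continuously differentiable function $V$, positive semidefinite about $\bar x$ ($V(\bar x)=0$, $V\ge0$ on $X$), called the storage function, such that for all $u\in U$, $x\in X$: $\dot V(x)\le (u-\bar u)(y-\bar y)-\phi(u-\bar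 u)$, where $\dot V(x)=\nabla V(x)\cdot f(x,u)$, $y=g(x,u)$, $\bar y=k_y(\bar u)$ and $\phi$ is positive definite ($\phi(0)=0$, $\phi(z)>0$ for $z\neq0$). **Assumptions (relative to an equilibrium).** (A1) $|\eta^*_{ij}|<\pi/2$ for all $(i,j)\in E$. (A2) For each $j\in G$, the combined system with input $-\omega_j$, state $(x^{M,j},x^{c,j},x^{u,j})$ and output $s^G_j=p^M_j-(d^c_j+d^u_j)$ is locally input strictly passive about $-\omega^*_j$ and $(x^{M,j,*},x^{c,j,*},x^{u,j,*})$; for each $j\in L$, the combined system with input $-\omega_j$, state $(x^{c,j},x^{u,j})$ and output $s^L_j=-(d^c_j+d^u_j)$ is locally input strictly passive about $-\omega^*_j$ and $(x^{c,j,*},x^{u,j,*})$. (A3) The storage functions in (A2) have strict local minima at $(x^{M,j,*},x^{c,j,*},x^{u,j,*})$ ($j\in G$) and $(x^{c,j,*},x^{u,j,*})$ ($j\in L$), respectively. (A4) There is an open neighbourhood $T$ of $(\eta^*,\omega^{G,*},x^{M,*},x^{c,*},x^{u,*})$ such that at any time instant $t$, $\omega^L(t)$ is uniquely determined by the system states $(\eta(t),\omega^G(t),x^M(t),x^c(t),x^u(t))\in T$ and the equations of (S). (A5) The functions $C_j$ and $C_{dj}$ are continuously differentiable and strictly convex, and the first derivative of $h_j^{-1}(z)$ is nonnegative for all $z\in\mathbb R$. *)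

theory Defs
  imports "HOL-Analysis.Analysis"
begin

section \<open>Input-output systems\<close>

text \<open>
  A system $\dot x = f(x,u)$, $y = g(x,u)$ with scalar input and output.  Different subsystems of a
  network may have state spaces $R^m$ of different dimensions $m$, so the state space is a linear
  subspace of an ambient Euclidean type (of any dimension, $0$ included).  Topological and
  differential notions are taken relative to that subspace.
\<close>

record 'x io_system =
  states :: "'x set"
  rhs :: "'x \<Rightarrow> real \<Rightarrow> 'x"
  outp :: "'x \<Rightarrow> real \<Rightarrow> real"

definition constant_input_solution ::
    "'x::euclidean_space io_system \<Rightarrow> real \<Rightarrow> real set \<Rightarrow> (real \<Rightarrow> 'x) \<Rightarrow> bool" where
  "constant_input_solution \<Sigma> u I x \<longleftrightarrow>
     (\<forall>t\<in>I. x t \<in> states \<Sigma> \<and> (x has_vector_derivative rhs \<Sigma> (x t) u) (at t within I))"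

definition is_equilibrium_point :: "'x::euclidean_space io_system \<Rightarrow> real \<Rightarrow> 'x \<Rightarrow> bool" where
  "is_equilibrium_point \<Sigma> u xb \<longleftrightarrow> xb \<in> states \<Sigma> \<and> rhs \<Sigma> xb u = 0"

definition locally_asymptotically_stable ::
    "'x::euclidean_space io_system \<Rightarrow> real \<Rightarrow> 'x \<Rightarrow> bool" where
  "locally_asymptotically_stable \<Sigma> u xb \<longleftrightarrow>
     (\<forall>\<epsilon>>0. \<exists>\<delta>>0. \<forall>\<tau>\<ge>0. \<forall>x. constant_input_solution \<Sigma> u {0..\<tau>} x \<and> dist (x 0) xb < \<delta> \<longrightarrow>
        (\<forall>t\<in>{0..\<tau>}. dist (x t) xb < \<epsilon>)) \<and>
     (\<exists>\<delta>>0. \<forall>x. constant_input_solution \<Sigma> u {0..} x \<and> dist (x 0) xb < \<delta> \<longrightarrow>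
        (x \<longlongrightarrow> xb) at_top)"

definition admissible_system :: "'x::euclidean_space io_system \<Rightarrow> bool" where
  "admissible_system \<Sigma> \<longleftrightarrow>
     subspace (states \<Sigma>) \<and>
     (\<forall>x\<in>states \<Sigma>. \<forall>u. rhs \<Sigma> x u \<in> states \<Sigma>) \<and>
     (\<forall>p\<in>states \<Sigma> \<times> UNIV. \<exists>r>0. \<exists>K.
        K-lipschitz_on (cball p r \<inter> states \<Sigma> \<times> UNIV) (\<lambda>(x, u). rhs \<Sigma> x u)) \<and>
     continuous_on (states \<Sigma> \<times> UNIV) (\<lambda>(x, u). outp \<Sigma> x u) \<and>
     (\<forall>u. (\<exists>!x. is_equilibrium_point \<Sigma> u x) \<and>
          (\<forall>x. is_equilibrium_point \<Sigma> u x \<longrightarrow> locally_asymptotically_stable \<Sigma> u x))"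

definition state_char :: "'x::euclidean_space io_system \<Rightarrow> real \<Rightarrow> 'x" where
  "state_char \<Sigma> u = (THE x. is_equilibrium_point \<Sigma> u x)"

definition output_char :: "'x::euclidean_space io_system \<Rightarrow> real \<Rightarrow> real" where
  "output_char \<Sigma> u = outp \<Sigma> (state_char \<Sigma> u) u"

text \<open>
  Local input strict passivity about \<open>ub\<close>, \<open>xb\<close>, with the storage function \<open>V\<close> as an explicit
  argument, since strict minimality is later imposed on this same \<open>V\<close>.  The field \<open>DV\<close> is the
  gradient of \<open>V\<close>; on a proper subspace its normal component is irrelevant, because \<open>rhs\<close> is
  tangent.
\<close>

definition locally_input_strictly_passive_with ::
    "'x::euclidean_space io_system \<Rightarrow> real \<Rightarrow> 'x \<Rightarrow> ('x \<Rightarrow> real) \<Rightarrow> bool" where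
  "locally_input_strictly_passive_with \<Sigma> ub xb V \<longleftrightarrow>
     (\<exists>U X DV \<phi>. open U \<and> ub \<in> U \<and> open X \<and> xb \<in> X \<and>
        (\<forall>x\<in>X \<inter> states \<Sigma>. (V has_derivative (\<lambda>v. DV x \<bullet> v)) (at x within states \<Sigma>)) \<and>
        continuous_on (X \<inter> states \<Sigma>) DV \<and>
        V xb = 0 \<and> (\<forall>x\<in>X \<inter> states \<Sigma>. V x \<ge> 0) \<and>
        \<phi> 0 = (0::real) \<and> (\<forall>z. z \<noteq> 0 \<longrightarrow> \<phi> z > 0) \<and>
        (\<forall>u\<in>U. \<forall>x\<in>X \<inter> states \<Sigma>.
           DV x \<bullet> rhs \<Sigma> x u \<le> (u - ub) * (outp \<Sigma> x u - output_char \<Sigma> ub) - \<phi> (u - ub)))"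

definition strict_local_min_on :: "'x::metric_space set \<Rightarrow> ('x \<Rightarrow> real) \<Rightarrow> 'x \<Rightarrow> bool" where
  "strict_local_min_on S V xb \<longleftrightarrow>
     (\<exists>X. open X \<and> xb \<in> X \<and> (\<forall>x\<in>X \<inter> S. x \<noteq> xb \<longrightarrow> V xb < V x))"

section \<open>The power network\<close>

text \<open>
  The buses are the elements of the finite type \<open>'n\<close>; the load buses are those outside \<open>gens\<close>.
  All subsystems attached to bus \<open>j\<close> have input $-\omega_j$.
\<close>

record ('n, 'a, 'b, 'c) power_network =
  gens :: "'n set"
  lines :: "('n \<times> 'n) set"
  inertia :: "'n \<Rightarrow> real"
  suscept :: "'n \<Rightarrow> 'n \<Rightarrow> real"
  pnom :: "'n \<Rightarrow> 'n \<Rightarrow> real"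
  pload :: "'n \<Rightarrow> real"
  gen_sys :: "'n \<Rightarrow> 'a io_system"
  ctrl_sys :: "'n \<Rightarrow> 'b io_system"
  unctrl_sys :: "'n \<Rightarrow> 'c io_system"

definition wf_network ::
    "('n::finite, 'a::euclidean_space, 'b::euclidean_space, 'c::euclidean_space) power_network \<Rightarrow> bool"
  where
  "wf_network P \<longleftrightarrow>
     (\<forall>i j. (i, j) \<in> lines P \<longrightarrow> (j, i) \<notin> lines P) \<and>
     (\<forall>i j. (i, j) \<in> (lines P \<union> (lines P)\<inverse>)\<^sup>*) \<and>
     (\<forall>j\<in>gens P. inertia P j > 0) \<and>
     (\<forall>(i, j)\<in>lines P. suscept P i j > 0) \<and>
     (\<forall>j\<in>gens P. admissible_system (gen_sys P j)) \<and>
     (\<forall>j. admissible_system (ctrl_sys P j) \<and> admissible_system (unctrl_sys P j))"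

text \<open>
  A configuration $(\eta, \omega, x^M, x^c, x^u)$ contains the frequencies of all buses.  The system
  state contains only those of the generation buses: \<open>state_of\<close> replaces the load frequencies by
  zero.  Entries without a meaning ($\eta_{ij}$ for a non-line, $x^M_j$ at a load bus) are zero
  throughout the state space, so that an open set of the ambient space, intersected with
  \<open>state_space\<close>, is an open set of states.
\<close>

type_synonym ('n, 'a, 'b, 'c) config =
  "(real^'n^'n) \<times> (real^'n) \<times> ('a^'n) \<times> ('b^'n) \<times> ('c^'n)"

definition eta :: "('n::finite, 'a, 'b, 'c) config \<Rightarrow> real^'n^'n" where "eta z = fst z"
definition omega :: "('n::finite, 'a, 'b, 'c) config \<Rightarrow> real^'n" where "omega z = fst (snd z)"
definition xM :: "('n::finite, 'a, 'b, 'c) config \<Rightarrow> 'a^'n" where "xM z = fst (snd (snd z))"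
definition xc :: "('n::finite, 'a, 'b, 'c) config \<Rightarrow> 'b^'n" where "xc z = fst (snd (snd (snd z)))"
definition xu :: "('n::finite, 'a, 'b, 'c) config \<Rightarrow> 'c^'n" where "xu z = snd (snd (snd (snd z)))"

context
  fixes P :: "('n::finite, 'a::euclidean_space, 'b::euclidean_space, 'c::euclidean_space) power_network"
begin

definition state_of :: "('n, 'a, 'b, 'c) config \<Rightarrow> ('n, 'a, 'b, 'c) config" where
  "state_of z = (eta z, (\<chi> j. if j \<in> gens P then omega z $ j else 0), xM z, xc z, xu z)"

definition state_space :: "('n, 'a, 'b, 'c) config set" where
  "state_space = {s.
     (\<exists>\<theta>. \<forall>(i, j)\<in>lines P. eta s $ i $ j = \<theta> i - \<theta> j) \<and>
     (\<forall>i j. (i, j) \<notin> lines P \<longrightarrow> eta s $ i $ j = 0) \<and>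
     (\<forall>j. j \<notin> gens P \<longrightarrow> omega s $ j = 0) \<and>
     (\<forall>j\<in>gens P. xM s $ j \<in> states (gen_sys P j)) \<and>
     (\<forall>j. j \<notin> gens P \<longrightarrow> xM s $ j = 0) \<and>
     (\<forall>j. xc s $ j \<in> states (ctrl_sys P j)) \<and>
     (\<forall>j. xu s $ j \<in> states (unctrl_sys P j))}"

definition flow :: "('n, 'a, 'b, 'c) config \<Rightarrow> 'n \<Rightarrow> 'n \<Rightarrow> real" where
  "flow z i j = suscept P i j * sin (eta z $ i $ j) - pnom P i j"

definition net_inflow :: "('n, 'a, 'b, 'c) config \<Rightarrow> 'n \<Rightarrow> real" where
  "net_inflow z j =
     - (\<Sum>k\<in>{k. (j, k) \<in> lines P}. flow z j k) + (\<Sum>i\<in>{i. (i, j) \<in> lines P}. flow z i j)"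

definition pM_out :: "('n, 'a, 'b, 'c) config \<Rightarrow> 'n \<Rightarrow> real" where
  "pM_out z j = outp (gen_sys P j) (xM z $ j) (- (omega z $ j))"

definition dc_out :: "('n, 'a, 'b, 'c) config \<Rightarrow> 'n \<Rightarrow> real" where
  "dc_out z j = outp (ctrl_sys P j) (xc z $ j) (- (omega z $ j))"

definition du_out :: "('n, 'a, 'b, 'c) config \<Rightarrow> 'n \<Rightarrow> real" where
  "du_out z j = outp (unctrl_sys P j) (xu z $ j) (- (omega z $ j))"

definition load_equations :: "('n, 'a, 'b, 'c) config \<Rightarrow> bool" where
  "load_equations z \<longleftrightarrow>
     (\<forall>j. j \<notin> gens P \<longrightarrow> 0 = - pload P j - (dc_out z j + du_out z j) + net_inflow z j)"

definition solution_on :: "real set \<Rightarrow> (real \<Rightarrow> ('n, 'a, 'b, 'c) config) \<Rightarrow> bool" where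
  "solution_on I z \<longleftrightarrow> (\<forall>t\<in>I.
     state_of (z t) \<in> state_space \<and>
     (\<forall>(i, j)\<in>lines P.
        ((\<lambda>s. eta (z s) $ i $ j) has_real_derivative omega (z t) $ i - omega (z t) $ j)
          (at t within I)) \<and>
     (\<forall>j\<in>gens P.
        ((\<lambda>s. omega (z s) $ j) has_real_derivative
           (- pload P j + pM_out (z t) j - (dc_out (z t) j + du_out (z t) j) + net_inflow (z t) j)
             / inertia P j) (at t within I)) \<and>
     load_equations (z t) \<and>
     (\<forall>j\<in>gens P. ((\<lambda>s. xM (z s) $ j) has_vector_derivative
        rhs (gen_sys P j) (xM (z t) $ j) (- (omega (z t) $ j))) (at t within I)) \<and>
     (\<forall>j. ((\<lambda>s. xc (z s) $ j) has_vector_derivative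
        rhs (ctrl_sys P j) (xc (z t) $ j) (- (omega (z t) $ j))) (at t within I)) \<and>
     (\<forall>j. ((\<lambda>s. xu (z s) $ j) has_vector_derivative
        rhs (unctrl_sys P j) (xu (z t) $ j) (- (omega (z t) $ j))) (at t within I)))"

definition time_domain :: "ereal \<Rightarrow> real set" where
  "time_domain \<tau> = {t. 0 \<le> t \<and> ereal t < \<tau>}"

definition maximal_solution :: "ereal \<Rightarrow> (real \<Rightarrow> ('n, 'a, 'b, 'c) config) \<Rightarrow> bool" where
  "maximal_solution \<tau> z \<longleftrightarrow> 0 < \<tau> \<and> solution_on (time_domain \<tau>) z \<and>
     \<not> (\<exists>\<tau>' z'. \<tau> < \<tau>' \<and> solution_on (time_domain \<tau>') z' \<and> (\<forall>t\<in>time_domain \<tau>. z' t = z t))"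

definition is_equilibrium :: "('n, 'a, 'b, 'c) config \<Rightarrow> bool" where
  "is_equilibrium z \<longleftrightarrow>
     state_of z \<in> state_space \<and>
     (\<forall>(i, j)\<in>lines P. omega z $ i = omega z $ j) \<and>
     (\<forall>j\<in>gens P. 0 = - pload P j + output_char (gen_sys P j) (- (omega z $ j))
        - (output_char (ctrl_sys P j) (- (omega z $ j)) + output_char (unctrl_sys P j) (- (omega z $ j)))
        + net_inflow z j) \<and>
     (\<forall>j. j \<notin> gens P \<longrightarrow> 0 = - pload P j
        - (output_char (ctrl_sys P j) (- (omega z $ j)) + output_char (unctrl_sys P j) (- (omega z $ j)))
        + net_inflow z j) \<and>
     (\<forall>j\<in>gens P. xM z $ j = state_char (gen_sys P j) (- (omega z $ j))) \<and>
     (\<forall>j. xc z $ j = state_char (ctrl_sys P j) (- (omega z $ j))) \<and>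
     (\<forall>j. xu z $ j = state_char (unctrl_sys P j) (- (omega z $ j)))"

definition gen_bus_system :: "'n \<Rightarrow> ('a \<times> 'b \<times> 'c) io_system" where
  "gen_bus_system j = \<lparr>
     states = states (gen_sys P j) \<times> states (ctrl_sys P j) \<times> states (unctrl_sys P j),
     rhs = (\<lambda>(x, y, w) u. (rhs (gen_sys P j) x u, rhs (ctrl_sys P j) y u, rhs (unctrl_sys P j) w u)),
     outp = (\<lambda>(x, y, w) u.
       outp (gen_sys P j) x u - (outp (ctrl_sys P j) y u + outp (unctrl_sys P j) w u))\<rparr>"

definition load_bus_system :: "'n \<Rightarrow> ('b \<times> 'c) io_system" where
  "load_bus_system j = \<lparr>
     states = states (ctrl_sys P j) \<times> states (unctrl_sys P j),
     rhs = (\<lambda>(y, w) u. (rhs (ctrl_sys P j) y u, rhs (unctrl_sys P j) w u)),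
     outp = (\<lambda>(y, w) u. - (outp (ctrl_sys P j) y u + outp (unctrl_sys P j) w u))\<rparr>"

definition angle_security :: "('n, 'a, 'b, 'c) config \<Rightarrow> bool" where
  "angle_security z \<longleftrightarrow> (\<forall>(i, j)\<in>lines P. \<bar>eta z $ i $ j\<bar> < pi / 2)"

definition passive_buses :: "('n, 'a, 'b, 'c) config \<Rightarrow> ('n \<Rightarrow> 'a \<times> 'b \<times> 'c \<Rightarrow> real) \<Rightarrow>
    ('n \<Rightarrow> 'b \<times> 'c \<Rightarrow> real) \<Rightarrow> bool" where
  "passive_buses z VG VL \<longleftrightarrow>
     (\<forall>j\<in>gens P. locally_input_strictly_passive_with (gen_bus_system j) (- (omega z $ j))
        (xM z $ j, xc z $ j, xu z $ j) (VG j)) \<and>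
     (\<forall>j. j \<notin> gens P \<longrightarrow> locally_input_strictly_passive_with (load_bus_system j) (- (omega z $ j))
        (xc z $ j, xu z $ j) (VL j))"

definition strict_storage_minima :: "('n, 'a, 'b, 'c) config \<Rightarrow> ('n \<Rightarrow> 'a \<times> 'b \<times> 'c \<Rightarrow> real) \<Rightarrow>
    ('n \<Rightarrow> 'b \<times> 'c \<Rightarrow> real) \<Rightarrow> bool" where
  "strict_storage_minima z VG VL \<longleftrightarrow>
     (\<forall>j\<in>gens P. strict_local_min_on (states (gen_bus_system j)) (VG j)
        (xM z $ j, xc z $ j, xu z $ j)) \<and>
     (\<forall>j. j \<notin> gens P \<longrightarrow> strict_local_min_on (states (load_bus_system j)) (VL j)
        (xc z $ j, xu z $ j))"

text \<open>A configuration over a given state is the same thing as a choice of load frequencies.\<close>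

definition unique_load_frequencies :: "('n, 'a, 'b, 'c) config \<Rightarrow> bool" where
  "unique_load_frequencies z \<longleftrightarrow> (\<exists>T. open T \<and> state_of z \<in> T \<and>
     (\<forall>s\<in>T \<inter> state_space. \<exists>!y. state_of y = s \<and> load_equations y))"

section \<open>Optimal supply and load control\<close>

definition du_response :: "'n \<Rightarrow> real \<Rightarrow> real" where
  "du_response j z = output_char (unctrl_sys P j) (- z)"

end

record 'n oslc =
  gcost :: "'n \<Rightarrow> real \<Rightarrow> real"
  dcost :: "'n \<Rightarrow> real \<Rightarrow> real"
  pmin :: "'n \<Rightarrow> real"
  pmax :: "'n \<Rightarrow> real"
  dmin :: "'n \<Rightarrow> real"
  dmax :: "'n \<Rightarrow> real"

definition strictly_convex :: "(real \<Rightarrow> real) \<Rightarrow> bool" where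
  "strictly_convex f \<longleftrightarrow> (\<forall>x y t. x \<noteq> y \<and> 0 < t \<and> t < 1 \<longrightarrow>
     f ((1 - t) * x + t * y) < (1 - t) * f x + t * f y)"

definition saturate :: "real \<Rightarrow> real \<Rightarrow> real \<Rightarrow> real" where
  "saturate a b q = max (min q b) a"

context
  fixes P :: "('n::finite, 'a::euclidean_space, 'b::euclidean_space, 'c::euclidean_space) power_network"
    and Q :: "'n oslc"
begin

definition oslc_cost :: "('n \<Rightarrow> real) \<Rightarrow> ('n \<Rightarrow> real) \<Rightarrow> ('n \<Rightarrow> real) \<Rightarrow> real" where
  "oslc_cost pM dc du =
     (\<Sum>j\<in>gens P. gcost Q j (pM j)) +
     (\<Sum>j\<in>UNIV. dcost Q j (dc j) + (LBINT z=0..ereal (du j). inv (du_response P j) z))"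

definition oslc_feasible :: "('n \<Rightarrow> real) \<Rightarrow> ('n \<Rightarrow> real) \<Rightarrow> ('n \<Rightarrow> real) \<Rightarrow> bool" where
  "oslc_feasible pM dc du \<longleftrightarrow>
     (\<Sum>j\<in>gens P. pM j) = (\<Sum>j\<in>UNIV. dc j + du j + pload P j) \<and>
     (\<forall>j\<in>gens P. pmin Q j \<le> pM j \<and> pM j \<le> pmax Q j) \<and>
     (\<forall>j. dmin Q j \<le> dc j \<and> dc j \<le> dmax Q j)"

definition oslc_minimizer :: "('n \<Rightarrow> real) \<Rightarrow> ('n \<Rightarrow> real) \<Rightarrow> ('n \<Rightarrow> real) \<Rightarrow> bool" where
  "oslc_minimizer pM dc du \<longleftrightarrow> oslc_feasible pM dc du \<and>
     (\<forall>pM' dc' du'. oslc_feasible pM' dc' du' \<longrightarrow> oslc_cost pM dc du \<le> oslc_cost pM' dc' du')"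

definition wf_oslc :: bool where
  "wf_oslc \<longleftrightarrow> (\<forall>j\<in>gens P. pmin Q j \<le> pmax Q j) \<and> (\<forall>j. dmin Q j \<le> dmax Q j) \<and>
     (\<forall>j. bij (du_response P j) \<and> inv (du_response P j) differentiable_on UNIV)"

definition cost_regularity :: bool where
  "cost_regularity \<longleftrightarrow>
     (\<forall>j\<in>gens P. gcost Q j C1_differentiable_on UNIV \<and> strictly_convex (gcost Q j)) \<and>
     (\<forall>j. dcost Q j C1_differentiable_on UNIV \<and> strictly_convex (dcost Q j)) \<and>
     (\<forall>j z. 0 \<le> deriv (inv (du_response P j)) z)"

text \<open>
  The inverses of the marginal costs are evaluated at every real number, hence the surjectivity
  conditions; without them \<open>inv\<close> would return arbitrary values.
\<close>

definition optimal_droop :: bool where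
  "optimal_droop \<longleftrightarrow>
     (\<forall>j\<in>gens P. surj (deriv (gcost Q j)) \<and>
        (\<forall>u. output_char (gen_sys P j) u
             = saturate (pmin Q j) (pmax Q j) (inv (deriv (gcost Q j)) u))) \<and>
     (\<forall>j. surj (deriv (dcost Q j)) \<and>
        (\<forall>u. output_char (ctrl_sys P j) u
             = saturate (dmin Q j) (dmax Q j) (inv (deriv (dcost Q j)) (- u))))"

definition optimal_equilibrium :: "('n, 'a, 'b, 'c) config \<Rightarrow> bool" where
  "optimal_equilibrium z \<longleftrightarrow> is_equilibrium P z \<and>
     oslc_minimizer (\<lambda>j. output_char (gen_sys P j) (- (omega z $ j)))
       (\<lambda>j. output_char (ctrl_sys P j) (- (omega z $ j)))
       (\<lambda>j. output_char (unctrl_sys P j) (- (omega z $ j)))"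

end

end

theory Submission
  imports Defs
begin

text \<open>
  The limit equilibrium is the given one, \<open>zs\<close>, and the proof has two independent halves.

  \<^item> Optimality.  The graph is connected, so all buses have the same frequency at \<open>zs\<close>.  The negative
    of this frequency is the Lagrange multiplier of the balance constraint: each saturated inverse
    marginal cost is the optimal response of one device to it as a price, the integral cost of the
    frequency-dependent demand has the frequency as its derivative there, and the flows cancel in the
    sum of the bus balances (\<open>equilibrium_optimal\<close>).  Convexity turns these first-order conditions into
    global optimality.

  \<^item> Convergence.  The energy, which is the sum of the kinetic energy, of the Bregman distance of the
    line potential \<open>- cos\<close> and of the storage functions, has a strict minimum at the equilibrium.
    Kinetic and line energy exchange power without loss, so strict passivity makes the energy decay
    at least by a positive definite function of the frequency deviations (\<open>energy_decay\<close>).  A trajectory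
    without decay has equilibrium frequencies at all times; then the angles are constant and the
    devices, driven by a constant input, converge to their equilibrium states, which fixes the
    injections and thereby the angles (\<open>lossless_solution_converges\<close>).  LaSalle's principle yields
    convergence.

  Two points need care.  The load frequencies are implicit.  Near the equilibrium they exist within
  prescribed bounds, because stationarity of the storage function and strict passivity make the
  power balance of a load bus change sign at the equilibrium input (\<open>bus_out_sign\<close>, \<open>frequencies_near\<close>); being
  unique roots in a compact interval, they are continuous functions of the state
  (\<open>config_of_continuous\<close>).  The outputs are merely continuous, so the resulting vector field is
  merely continuous as well, and solutions need not be unique.  Existence is therefore Peano's
  theorem (\<open>peano_existence\<close>), and LaSalle's principle is proved without a flow: limits
  of translates of a trajectory are again solutions, by a compactness argument
  (\<open>pointwise_cluster_filter\<close>, \<open>pointwise_limit_of_approximate_trajectories\<close>, \<open>solution_converges\<close>).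
  A maximal solution is global because a solution that stays in a compact region up to a finite
  time can be continued (\<open>solution_extends_globally\<close>).
\<close>

section \<open>Limits of approximate trajectories\<close>

text \<open>
  Tychonoff's theorem in place of the usual diagonal argument: the family converges at all times
  simultaneously, along a filter finer than the given one instead of along a subsequence.
\<close>

lemma pointwise_cluster_filter:
  fixes X :: "'i \<Rightarrow> 'a \<Rightarrow> 'b::topological_space"
  assumes comp: "\<And>t. compact (C t)" and mem: "\<And>i t. X i t \<in> C t" and ne: "H \<noteq> bot"
  obtains w G where "G \<noteq> bot" "G \<le> H" "\<And>t. w t \<in> C t" "\<And>t. ((\<lambda>i. X i t) \<longlongrightarrow> w t) G"
proof -
  have "compactin (product_topology (\<lambda>i. euclidean) UNIV) (PiE UNIV C)"
    using comp by (simp add: compactin_PiE)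
  then have "compact (PiE UNIV C)"
    by (simp add: euclidean_product_topology)
  moreover have "filtermap X H \<noteq> bot"
    using ne by (simp add: filtermap_bot_iff)
  moreover have "eventually (\<lambda>f. f \<in> PiE UNIV C) (filtermap X H)"
    using mem by (auto simp: eventually_filtermap PiE_iff)
  ultimately obtain w where w: "w \<in> PiE UNIV C" "inf (nhds w) (filtermap X H) \<noteq> bot"
    by (auto simp: compact_filter)
  define G where "G = inf (filtercomap X (nhds w)) H"
  have "G \<noteq> bot"
  proof
    assume "G = bot"
    then have "eventually (\<lambda>_. False) G" by simp
    then obtain A B where AB: "eventually A (filtercomap X (nhds w))" "eventually B H"
        "\<And>x. A x \<and> B x \<Longrightarrow> False"
      unfolding G_def eventually_inf by auto
    then obtain A' where A': "eventually A' (nhds w)" "\<And>x. A' (X x) \<Longrightarrow> A x"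
      unfolding eventually_filtercomap by blast
    have "eventually (\<lambda>f. \<not> A' f) (filtermap X H)"
      unfolding eventually_filtermap using AB(2) by (rule eventually_mono) (use AB(3) A'(2) in blast)
    then have "eventually (\<lambda>_. False) (inf (nhds w) (filtermap X H))"
      unfolding eventually_inf using A'(1) by blast
    with w(2) show False by (simp add: eventually_False)
  qed
  moreover have "G \<le> H" by (simp add: G_def)
  moreover have "w t \<in> C t" for t using w(1) by auto
  moreover have "((\<lambda>i. X i t) \<longlongrightarrow> w t) G" for t
  proof -
    have "filterlim X (nhds w) G"
      unfolding G_def filterlim_def by (metis filterlim_def filterlim_filtercomap filterlim_mono inf_le1 order_refl)
    show ?thesis
    proof (rule topological_tendstoI)
      fix B :: "'b set" assume B: "open B" "w t \<in> B"
      have "open ((\<lambda>f. f t) -` B \<inter> UNIV)"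
        using continuous_on_product_coordinates[of t] B(1) continuous_on_open_vimage[OF open_UNIV] by blast
      with B(2) have "\<forall>\<^sub>F f in nhds w. f t \<in> B"
        by (auto simp: eventually_nhds)
      with \<open>filterlim X (nhds w) G\<close> show "\<forall>\<^sub>F i in G. X i t \<in> B"
        by (auto simp: filterlim_iff)
    qed
  qed
  ultimately show thesis using that by blast
qed

text \<open>
  The hypothesis says that the curves satisfy the differential equation up to a first-order error
  whose rate is uniform in the curve, and up to an additive error that vanishes along the filter.
  An inequality of this form survives pointwise limits, although differentiability does not.
\<close>

lemma pointwise_limit_of_approximate_trajectories:
  fixes F :: "'x::real_normed_vector \<Rightarrow> 'x"
  assumes ne: "G \<noteq> bot" and lim: "\<And>t. t \<in> I \<Longrightarrow> ((\<lambda>i. X i t) \<longlongrightarrow> w t) G"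
    and contF: "continuous_on UNIV F"
    and approx: "\<And>\<epsilon>. \<epsilon> > 0 \<Longrightarrow> \<exists>\<delta>>0. \<forall>\<kappa>>0. \<forall>\<^sub>F i in G. \<forall>s\<in>I. \<forall>t\<in>I. \<bar>t - s\<bar> < \<delta> \<longrightarrow>
      norm (X i t - X i s - (t - s) *\<^sub>R F (X i s)) \<le> \<epsilon> * \<bar>t - s\<bar> + \<kappa>"
    and s: "s \<in> I"
  shows "(w has_vector_derivative F (w s)) (at s within I)"
  unfolding has_vector_derivative_def has_derivative_within_alt
proof (intro conjI allI impI)
  show "bounded_linear (\<lambda>x. x *\<^sub>R F (w s))" by (rule bounded_linear_scaleR_left)
  fix \<epsilon> :: real assume "\<epsilon> > 0"
  from approx[OF this] obtain \<delta> where \<delta>: "\<delta> > 0"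
    "\<And>\<kappa>. \<kappa> > 0 \<Longrightarrow> \<forall>\<^sub>F i in G. \<forall>s\<in>I. \<forall>t\<in>I. \<bar>t - s\<bar> < \<delta> \<longrightarrow>
      norm (X i t - X i s - (t - s) *\<^sub>R F (X i s)) \<le> \<epsilon> * \<bar>t - s\<bar> + \<kappa>" by blast
  have "norm (w t - w s - (t - s) *\<^sub>R F (w s)) \<le> \<epsilon> * norm (t - s)" if t: "t \<in> I" "norm (t - s) < \<delta>" for t
  proof (rule field_le_epsilon)
    fix \<kappa> :: real assume "\<kappa> > 0"
    have FX: "((\<lambda>i. F (X i s)) \<longlongrightarrow> F (w s)) G"
      using contF lim[OF s] by (auto simp: continuous_on_eq_continuous_at intro: isCont_tendsto_compose)
    have "((\<lambda>i. norm (X i t - X i s - (t - s) *\<^sub>R F (X i s))) \<longlongrightarrow> norm (w t - w s - (t - s) *\<^sub>R F (w s))) G"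
      by (intro tendsto_intros lim s t(1) FX)
    moreover have "\<forall>\<^sub>F i in G. norm (X i t - X i s - (t - s) *\<^sub>R F (X i s)) \<le> \<epsilon> * norm (t - s) + \<kappa>"
      using \<delta>(2)[OF \<open>\<kappa> > 0\<close>] by (rule eventually_mono) (use s t in auto)
    ultimately show "norm (w t - w s - (t - s) *\<^sub>R F (w s)) \<le> \<epsilon> * norm (t - s) + \<kappa>"
      using ne by (rule tendsto_upperbound)
  qed
  with \<delta>(1) show "\<exists>d>0. \<forall>y\<in>I. norm (y - s) < d \<longrightarrow>
      norm (w y - w s - (y - s) *\<^sub>R F (w s)) \<le> \<epsilon> * norm (y - s)" by blast
qed

lemma has_vector_derivative_imp_linear_bound:
  fixes x :: "real \<Rightarrow> 'x::real_normed_vector"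
  assumes conv: "convex I"
    and der: "\<And>t. t \<in> I \<Longrightarrow> (x has_vector_derivative x' t) (at t within I)"
    and close: "\<And>t. t \<in> I \<Longrightarrow> norm (x' t - v) \<le> e" and st: "s \<in> I" "t \<in> I"
  shows "norm (x t - x s - (t - s) *\<^sub>R v) \<le> e * \<bar>t - s\<bar>"
proof -
  have 1: "((\<lambda>t. x t - t *\<^sub>R v) has_derivative (\<lambda>h. h *\<^sub>R (x' t - v))) (at t within I)" if "t \<in> I" for t
    using der[OF that] unfolding has_vector_derivative_def
    by (auto intro!: derivative_eq_intros simp: algebra_simps)
  have "norm ((x t - t *\<^sub>R v) - (x s - s *\<^sub>R v)) \<le> e * norm (t - s)"
  proof (rule differentiable_bound[OF conv 1 _ st(2) st(1)])
    fix t assume "t \<in> I"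
    then have "norm (x' t - v) \<le> e" by (rule close)
    then show "onorm (\<lambda>h. h *\<^sub>R (x' t - v)) \<le> e"
      by (intro onorm_le) (metis abs_ge_zero mult.commute mult_right_mono norm_scaleR real_norm_def)
  qed
  then show ?thesis by (simp add: algebra_simps)
qed

lemma bounded_derivative_imp_lipschitz:
  fixes x :: "real \<Rightarrow> 'x::real_normed_vector"
  assumes "convex I" "\<And>t. t \<in> I \<Longrightarrow> (x has_vector_derivative x' t) (at t within I)"
    and "\<And>t. t \<in> I \<Longrightarrow> norm (x' t) \<le> M" "s \<in> I" "t \<in> I"
  shows "norm (x t - x s) \<le> M * \<bar>t - s\<bar>"
  using has_vector_derivative_imp_linear_bound[of I x x' 0 M s t] assms by simp

text \<open>
  The time scale \<open>\<delta>\<close> depends on the vector field only.  This uniformity over all solutions is what makes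
  limits of solutions accessible to the preceding lemma on approximate trajectories.
\<close>

lemma uniform_first_order_estimate:
  fixes F :: "'x::real_normed_vector \<Rightarrow> 'x"
  assumes uc: "uniformly_continuous_on UNIV F" and bound: "\<And>x. norm (F x) \<le> M" and "\<epsilon> > 0"
  obtains \<delta> where "\<delta> > 0"
    "\<And>I x s t. convex I \<Longrightarrow> (\<And>t. t \<in> I \<Longrightarrow> (x has_vector_derivative F (x t)) (at t within I)) \<Longrightarrow>
      s \<in> I \<Longrightarrow> t \<in> I \<Longrightarrow> \<bar>t - s\<bar> < \<delta> \<Longrightarrow> norm (x t - x s - (t - s) *\<^sub>R F (x s)) \<le> \<epsilon> * \<bar>t - s\<bar>"
proof -
  obtain d where d: "d > 0" "\<And>x y. dist y x < d \<Longrightarrow> dist (F y) (F x) < \<epsilon>"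
    by (rule uniformly_continuous_onE[OF uc \<open>\<epsilon> > 0\<close>]) (rule that, assumption, simp)
  have M: "M \<ge> 0" using order_trans[OF norm_ge_zero bound] .
  show thesis
  proof (rule that[of "d / (M + 1)"])
    show "d / (M + 1) > 0" using d(1) M by auto
    fix I :: "real set" and x :: "real \<Rightarrow> 'x" and s t :: real
    assume I: "convex I" and der: "\<And>t. t \<in> I \<Longrightarrow> (x has_vector_derivative F (x t)) (at t within I)"
      and st: "s \<in> I" "t \<in> I" "\<bar>t - s\<bar> < d / (M + 1)"
    let ?J = "closed_segment s t"
    have J: "?J \<subseteq> I" using I st(1,2) by (simp add: closed_segment_subset)
    show "norm (x t - x s - (t - s) *\<^sub>R F (x s)) \<le> \<epsilon> * \<bar>t - s\<bar>"
    proof (rule has_vector_derivative_imp_linear_bound[of ?J x "\<lambda>t. F (x t)"])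
      fix r assume r: "r \<in> ?J"
      show "(x has_vector_derivative F (x r)) (at r within ?J)"
        using der J r has_vector_derivative_within_subset by blast
      have "norm (x r - x s) \<le> M * \<bar>r - s\<bar>"
        using I der bound by (rule bounded_derivative_imp_lipschitz) (use J r st in auto)
      also have "\<dots> \<le> M * \<bar>t - s\<bar>"
        using r M by (intro mult_left_mono) (auto simp: closed_segment_eq_real_ivl split: if_splits)
      also have "\<dots> < d"
      proof -
        have "M * \<bar>t - s\<bar> \<le> (M + 1) * \<bar>t - s\<bar>" by (simp add: mult_right_mono)
        also have "\<dots> < d" using st(3) M by (simp add: field_simps)
        finally show ?thesis .
      qed
      finally show "norm (F (x r) - F (x s)) \<le> \<epsilon>"
        using d(2)[of "x r" "x s"] by (auto simp: dist_norm)
    qed auto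
  qed
qed

section \<open>Existence of solutions for a continuous vector field\<close>

primrec euler_node :: "('x::real_vector \<Rightarrow> 'x) \<Rightarrow> real \<Rightarrow> 'x \<Rightarrow> nat \<Rightarrow> 'x" where
  "euler_node F h x0 0 = x0"
| "euler_node F h x0 (Suc k) = euler_node F h x0 k + h *\<^sub>R F (euler_node F h x0 k)"

lemma euler_node_estimate:
  fixes F :: "'x::real_normed_vector \<Rightarrow> 'x"
  assumes h: "h \<ge> 0" and "k \<le> l"
    and "\<And>m. k \<le> m \<Longrightarrow> m < l \<Longrightarrow> norm (F (euler_node F h x0 m) - v) \<le> e"
  shows "norm (euler_node F h x0 l - euler_node F h x0 k - (h * (real l - real k)) *\<^sub>R v)
    \<le> e * (h * (real l - real k))"
  using assms(2,3)
proof (induction l rule: dec_induct)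
  case (step n)
  let ?E = "euler_node F h x0"
  have "?E (Suc n) - ?E k - (h * (real (Suc n) - real k)) *\<^sub>R v
      = (?E n - ?E k - (h * (real n - real k)) *\<^sub>R v) + h *\<^sub>R (F (?E n) - v)"
    by (simp add: algebra_simps)
  also have "norm \<dots> \<le> e * (h * (real n - real k)) + h * e"
    using step h by (intro norm_triangle_mono) (auto intro: mult_left_mono)
  finally show ?case by (simp add: algebra_simps)
qed simp

lemma euler_node_in_subspace:
  assumes "subspace S" "x0 \<in> S" "\<And>x. F x \<in> S"
  shows "euler_node F h x0 k \<in> S"
  by (induction k) (auto intro!: subspace_add subspace_scale assms)

text \<open>
  The Euler scheme is read as a step function instead of a polygon: its jumps are of the order of
  the step width and are absorbed by the additive error of an approximate trajectory.
\<close>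

definition euler_step :: "('x::real_vector \<Rightarrow> 'x) \<Rightarrow> 'x \<Rightarrow> nat \<Rightarrow> real \<Rightarrow> 'x" where
  "euler_step F x0 n t = euler_node F (1 / real (Suc n)) x0 (nat \<lfloor>t * real (Suc n)\<rfloor>)"

lemma euler_grid_distance:
  fixes N :: real
  assumes "N > 0" "0 \<le> s" "s \<le> t"
  shows "\<bar>1 / N * (real (nat \<lfloor>t * N\<rfloor>) - real (nat \<lfloor>s * N\<rfloor>)) - (t - s)\<bar> \<le> 1 / N"
    and "nat \<lfloor>s * N\<rfloor> \<le> nat \<lfloor>t * N\<rfloor>"
proof -
  show "nat \<lfloor>s * N\<rfloor> \<le> nat \<lfloor>t * N\<rfloor>"
    using assms by (intro nat_mono floor_mono mult_right_mono) auto
  have f: "real (nat \<lfloor>s * N\<rfloor>) = of_int \<lfloor>s * N\<rfloor>" "real (nat \<lfloor>t * N\<rfloor>) = of_int \<lfloor>t * N\<rfloor>"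
    using assms by auto
  have b: "of_int \<lfloor>s * N\<rfloor> \<le> s * N" "s * N < of_int \<lfloor>s * N\<rfloor> + 1"
       "of_int \<lfloor>t * N\<rfloor> \<le> t * N" "t * N < of_int \<lfloor>t * N\<rfloor> + 1" by linarith+
  have "\<bar>(of_int \<lfloor>t * N\<rfloor> - of_int \<lfloor>s * N\<rfloor>) - (t - s) * N\<bar> \<le> 1"
    unfolding left_diff_distrib using b by linarith
  then have "\<bar>(of_int \<lfloor>t * N\<rfloor> - of_int \<lfloor>s * N\<rfloor>) - (t - s) * N\<bar> / N \<le> 1 / N"
    using assms(1) by (simp add: divide_right_mono)
  moreover have "\<bar>(of_int \<lfloor>t * N\<rfloor> - of_int \<lfloor>s * N\<rfloor>) - (t - s) * N\<bar> / N
     = \<bar>1 / N * (of_int \<lfloor>t * N\<rfloor> - of_int \<lfloor>s * N\<rfloor>) - (t - s)\<bar>"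
  proof -
    have "\<bar>a - c * N\<bar> / N = \<bar>1 / N * a - c\<bar>" for a c :: real
    proof -
      have "\<bar>a - c * N\<bar> / N = \<bar>(a - c * N) / N\<bar>" using assms(1) by simp
      also have "(a - c * N) / N = 1 / N * a - c" using assms(1) by (simp add: field_simps)
      finally show ?thesis .
    qed
    then show ?thesis .
  qed
  ultimately show "\<bar>1 / N * (real (nat \<lfloor>t * N\<rfloor>) - real (nat \<lfloor>s * N\<rfloor>)) - (t - s)\<bar> \<le> 1 / N"
    unfolding f by simp
qed

lemma euler_step_approximates:
  fixes F :: "'x::real_normed_vector \<Rightarrow> 'x"
  assumes uc: "uniformly_continuous_on UNIV F" and bound: "\<And>x. norm (F x) \<le> M" and "\<epsilon> > 0"
  shows "\<exists>\<delta>>0. \<forall>\<kappa>>0. \<forall>\<^sub>F n in sequentially. \<forall>s\<in>{0..}. \<forall>t\<in>{0..}. \<bar>t - s\<bar> < \<delta> \<longrightarrow>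
    norm (euler_step F x0 n t - euler_step F x0 n s - (t - s) *\<^sub>R F (euler_step F x0 n s))
      \<le> \<epsilon> * \<bar>t - s\<bar> + \<kappa>"
proof -
  obtain d where d: "d > 0" "\<And>x y. dist y x < d \<Longrightarrow> dist (F y) (F x) < \<epsilon>"
    by (rule uniformly_continuous_onE[OF uc \<open>\<epsilon> > 0\<close>]) (rule that, assumption, simp)
  have M: "M \<ge> 0" using order_trans[OF norm_ge_zero bound] .
  \<comment> \<open>Nodes at times less than \<open>\<delta>\<close> apart differ by at most \<open>M\<close> times \<open>\<delta>\<close> plus one step width, and the
     step width is eventually below \<open>\<delta>\<close>; hence the factor 2.\<close>
  define \<delta> where "\<delta> = d / (2 * (M + 1))"
  have "\<delta> > 0" using d(1) M by (auto simp: \<delta>_def)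
  have "2 * (M * \<delta>) < d"
  proof -
    have "2 * (M * \<delta>) = d * (M / (M + 1))" using M by (simp add: \<delta>_def field_simps)
    also have "\<dots> < d * 1" using d(1) M by (intro mult_strict_left_mono) (auto simp: field_simps)
    finally show ?thesis by simp
  qed
  have "\<forall>\<^sub>F n in sequentially. \<forall>s\<in>{0..}. \<forall>t\<in>{0..}. \<bar>t - s\<bar> < \<delta> \<longrightarrow>
    norm (euler_step F x0 n t - euler_step F x0 n s - (t - s) *\<^sub>R F (euler_step F x0 n s))
      \<le> \<epsilon> * \<bar>t - s\<bar> + \<kappa>" if "\<kappa> > 0" for \<kappa>
  proof -
    have lim: "(\<lambda>n. 1 / real (Suc n)) \<longlonglongrightarrow> 0"
      using LIMSEQ_inverse_real_of_nat by (simp add: inverse_eq_divide)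
    have "\<forall>\<^sub>F n in sequentially. 1 / real (Suc n) < min \<delta> (\<kappa> / (\<epsilon> + M))"
      using \<open>\<delta> > 0\<close> \<open>\<kappa> > 0\<close> \<open>\<epsilon> > 0\<close> M by (intro order_tendstoD[OF lim]) auto
    then show ?thesis
    proof (rule eventually_mono, intro ballI impI)
      fix n and s t :: real
      assume n: "1 / real (Suc n) < min \<delta> (\<kappa> / (\<epsilon> + M))" and st: "s \<in> {0..}" "t \<in> {0..}" "\<bar>t - s\<bar> < \<delta>"
      define h where "h = 1 / real (Suc n)"
      let ?E = "euler_node F h x0"
      have h: "0 < h" "h < \<delta>" "h * (\<epsilon> + M) < \<kappa>"
        using n \<open>\<epsilon> > 0\<close> M by (auto simp: h_def field_simps)
      \<comment> \<open>The base point may be either end, so that the case \<open>t < s\<close> follows by exchanging the roles.\<close>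
      have key: "norm (euler_step F x0 n b - euler_step F x0 n a - (b - a) *\<^sub>R v) \<le> \<epsilon> * (b - a) + \<kappa>"
        if ab: "0 \<le> a" "a \<le> b" "b - a < \<delta>"
          and v: "v = F (euler_step F x0 n a) \<or> v = F (euler_step F x0 n b)" for a b v
      proof -
        define k l where "k = nat \<lfloor>a * real (Suc n)\<rfloor>" and "l = nat \<lfloor>b * real (Suc n)\<rfloor>"
        define T where "T = h * (real l - real k)"
        have kl: "k \<le> l" and T: "\<bar>T - (b - a)\<bar> \<le> h"
          using euler_grid_distance[of "real (Suc n)" a b] ab by (simp_all add: k_def l_def T_def h_def)
        have nodes: "norm (?E i - ?E j) \<le> M * T" if "k \<le> j" "j \<le> i" "i \<le> l" for i j
        proof -
          have "norm (?E i - ?E j - (h * (real i - real j)) *\<^sub>R 0) \<le> M * (h * (real i - real j))"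
            by (rule euler_node_estimate) (use h that bound in auto)
          also have "\<dots> \<le> M * T"
            unfolding T_def using that M h by (intro mult_left_mono) auto
          finally show ?thesis by simp
        qed
        have "M * T < d"
        proof -
          have "M * T \<le> M * (2 * \<delta>)" using T ab(3) h(2) M by (intro mult_left_mono) auto
          with \<open>2 * (M * \<delta>) < d\<close> show ?thesis by simp
        qed
        have "norm (?E l - ?E k - T *\<^sub>R v) \<le> \<epsilon> * T"
          unfolding T_def
        proof (rule euler_node_estimate)
          fix m assume m: "k \<le> m" "m < l"
          have "v = F (?E k) \<or> v = F (?E l)"
            using v unfolding euler_step_def k_def l_def h_def by simp
          then obtain j where j: "v = F (?E j)" "j = k \<or> j = l" by blast
          have "dist (?E m) (?E j) \<le> M * T"
            using j(2) nodes[of k m] nodes[of m l] m kl by (auto simp: dist_norm norm_minus_commute)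
          with \<open>M * T < d\<close> d(2)[of "?E m" "?E j"] show "norm (F (?E m) - v) \<le> \<epsilon>"
            by (auto simp: j(1) dist_norm)
        qed (use h kl in auto)
        moreover have "norm ((T - (b - a)) *\<^sub>R v) \<le> h * M"
          using T v bound h(1) by (auto intro!: mult_mono)
        moreover have "\<epsilon> * T \<le> \<epsilon> * (b - a) + \<epsilon> * h"
          using mult_left_mono[of T "b - a + h" \<epsilon>] T \<open>\<epsilon> > 0\<close> by (simp add: algebra_simps)
        moreover have "?E l - ?E k - (b - a) *\<^sub>R v = (?E l - ?E k - T *\<^sub>R v) + (T - (b - a)) *\<^sub>R v"
          by (simp add: algebra_simps)
        then have "norm (?E l - ?E k - (b - a) *\<^sub>R v) \<le> norm (?E l - ?E k - T *\<^sub>R v) + norm ((T - (b - a)) *\<^sub>R v)"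
          by (simp only: norm_triangle_ineq)
        ultimately have "norm (?E l - ?E k - (b - a) *\<^sub>R v) \<le> \<epsilon> * (b - a) + \<kappa>"
          using h(3) by (simp add: algebra_simps)
        then show ?thesis unfolding euler_step_def k_def l_def h_def .
      qed
      show "norm (euler_step F x0 n t - euler_step F x0 n s - (t - s) *\<^sub>R F (euler_step F x0 n s))
          \<le> \<epsilon> * \<bar>t - s\<bar> + \<kappa>"
      proof (cases "s \<le> t")
        case True
        then show ?thesis using key[of s t] st by auto
      next
        case False
        let ?w = "euler_step F x0 n s - euler_step F x0 n t - (s - t) *\<^sub>R F (euler_step F x0 n s)"
        have "norm ?w \<le> \<epsilon> * (s - t) + \<kappa>" using key[of t s] st False by auto
        moreover have "norm (- ?w) = norm ?w" by (rule norm_minus_cancel)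
        moreover have "- ?w = euler_step F x0 n t - euler_step F x0 n s - (t - s) *\<^sub>R F (euler_step F x0 n s)"
          by (simp add: algebra_simps)
        ultimately show ?thesis using False by (metis abs_minus_commute abs_of_nonneg diff_ge_0_iff_ge linear)
      qed
    qed
  qed
  with \<open>\<delta> > 0\<close> show ?thesis by blast
qed

text \<open>
  Peano's theorem; boundedness and uniform continuity of the vector field on the whole space make
  the solution global.
\<close>

lemma peano_existence:
  fixes F :: "'x::euclidean_space \<Rightarrow> 'x"
  assumes uc: "uniformly_continuous_on UNIV F" and bound: "\<And>x. norm (F x) \<le> M"
    and S: "subspace S" "\<And>x. F x \<in> S" and x0: "x0 \<in> S"
  obtains x where "x 0 = x0" "\<And>t. t \<ge> 0 \<Longrightarrow> x t \<in> S"
    "\<And>t. t \<ge> 0 \<Longrightarrow> (x has_vector_derivative F (x t)) (at t within {0..})"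
proof -
  have M: "M \<ge> 0" using order_trans[OF norm_ge_zero bound] .
  have in_ball: "euler_step F x0 n t \<in> cball x0 (M * \<bar>t\<bar>) \<inter> S" for n t
  proof -
    let ?h = "1 / real (Suc n)" and ?k = "nat \<lfloor>t * real (Suc n)\<rfloor>"
    have "norm (euler_node F ?h x0 ?k - euler_node F ?h x0 0 - (?h * (real ?k - real 0)) *\<^sub>R 0)
        \<le> M * (?h * (real ?k - real 0))"
      by (rule euler_node_estimate) (use bound in auto)
    also have "?h * (real ?k - real 0) \<le> \<bar>t\<bar>"
    proof -
      have "real ?k \<le> \<bar>t * real (Suc n)\<bar>" by linarith
      then have "real ?k \<le> \<bar>t\<bar> * real (Suc n)" by (simp add: abs_mult)
      then show ?thesis by (simp add: field_simps)
    qed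
    finally have "norm (euler_step F x0 n t - x0) \<le> M * \<bar>t\<bar>"
      using M by (simp add: euler_step_def mult_left_mono)
    moreover have "euler_step F x0 n t \<in> S"
      unfolding euler_step_def using S x0 by (intro euler_node_in_subspace)
    ultimately show ?thesis by (simp add: dist_norm norm_minus_commute)
  qed
  obtain w G where w: "G \<noteq> bot" "G \<le> sequentially" "\<And>t. w t \<in> cball x0 (M * \<bar>t\<bar>) \<inter> S"
      "\<And>t. ((\<lambda>i. euler_step F x0 i t) \<longlongrightarrow> w t) G"
  proof (rule pointwise_cluster_filter[of "\<lambda>t. cball x0 (M * \<bar>t\<bar>) \<inter> S" "euler_step F x0" sequentially])
    show "compact (cball x0 (M * \<bar>t\<bar>) \<inter> S)" for t
      using S(1) by (intro compact_Int_closed) (auto simp: closed_subspace)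
  qed (use in_ball in auto)
  show thesis
  proof (rule that[of w])
    show "w 0 = x0" using w(3)[of 0] by simp
    show "w t \<in> S" for t using w(3) by blast
    fix t :: real assume "t \<ge> 0"
    show "(w has_vector_derivative F (w t)) (at t within {0..})"
    proof (rule pointwise_limit_of_approximate_trajectories[of G "{0..}" "euler_step F x0"])
      show "continuous_on UNIV F" using uc by (rule uniformly_continuous_imp_continuous)
      show "t \<in> {0..}" using \<open>t \<ge> 0\<close> by simp
      fix \<epsilon> :: real assume "\<epsilon> > 0"
      show "\<exists>\<delta>>0. \<forall>\<kappa>>0. \<forall>\<^sub>F i in G. \<forall>s\<in>{0..}. \<forall>t\<in>{0..}. \<bar>t - s\<bar> < \<delta> \<longrightarrow>
         norm (euler_step F x0 i t - euler_step F x0 i s - (t - s) *\<^sub>R F (euler_step F x0 i s)) \<le> \<epsilon> * \<bar>t - s\<bar> + \<kappa>"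
        using euler_step_approximates[OF uc bound \<open>\<epsilon> > 0\<close>, of x0] filter_leD[OF w(2)] by blast
    qed (use w in auto)
  qed
qed

section \<open>Convergence by a weak Lyapunov function without uniqueness of solutions\<close>

text \<open>
  Extension by the nearest-point projection keeps all values in the image of \<open>K\<close>, so bounds and
  tangency to a subspace carry over to the whole space.
\<close>

lemma closest_point_extension:
  fixes F :: "'x::euclidean_space \<Rightarrow> 'y::real_normed_vector"
  assumes "compact K" "convex K" "K \<noteq> {}" and contF: "continuous_on K F"
  shows "uniformly_continuous_on UNIV (\<lambda>x. F (closest_point K x))"
    and "\<exists>M. \<forall>x. norm (F (closest_point K x)) \<le> M"
proof -
  have K: "closed K" using \<open>compact K\<close> by (rule compact_imp_closed)
  have in_K: "closest_point K x \<in> K" for x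
    using closest_point_in_set[OF K \<open>K \<noteq> {}\<close>] .
  have uc: "uniformly_continuous_on K F"
    using contF \<open>compact K\<close> by (rule compact_uniformly_continuous)
  show "uniformly_continuous_on UNIV (\<lambda>x. F (closest_point K x))"
    unfolding uniformly_continuous_on_def
  proof (intro allI impI)
    fix e :: real assume "e > 0"
    then obtain d where "d > 0" "\<And>x y. x \<in> K \<Longrightarrow> y \<in> K \<Longrightarrow> dist y x < d \<Longrightarrow> dist (F y) (F x) < e"
      using uc unfolding uniformly_continuous_on_def by blast
    then show "\<exists>d>0. \<forall>x\<in>UNIV. \<forall>y\<in>UNIV. dist y x < d \<longrightarrow>
        dist (F (closest_point K y)) (F (closest_point K x)) < e"
      using in_K order_le_less_trans[OF closest_point_lipschitz[OF \<open>convex K\<close> K \<open>K \<noteq> {}\<close>]]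
      by (intro exI[of _ d]) blast
  qed
  have "bounded (F ` K)"
    using contF \<open>compact K\<close> by (intro compact_imp_bounded compact_continuous_image)
  then obtain M where "\<And>y. y \<in> F ` K \<Longrightarrow> norm y \<le> M" by (auto simp: bounded_iff)
  then show "\<exists>M. \<forall>x. norm (F (closest_point K x)) \<le> M"
    using in_K by blast
qed

text \<open>
  A solution on a half-open interval has a limit at the end point because it is Lipschitz there,
  and the first-order estimate passes to that limit, so the extended curve is differentiable at the end point as well.
\<close>

lemma solution_extends_to_closed_interval:
  fixes F :: "'x::euclidean_space \<Rightarrow> 'x"
  assumes "\<tau> > 0" and contF: "continuous_on UNIV F" and bound: "\<And>x. norm (F x) \<le> M"
    and der: "\<And>t. t \<in> {0..<\<tau>} \<Longrightarrow> (x has_vector_derivative F (x t)) (at t within {0..<\<tau>})"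
  obtains y where "\<And>t. t \<in> {0..<\<tau>} \<Longrightarrow> y t = x t"
    "\<And>t. t \<in> {0..\<tau>} \<Longrightarrow> (y has_vector_derivative F (y t)) (at t within {0..\<tau>})"
proof -
  have M: "M \<ge> 0" using order_trans[OF norm_ge_zero bound] .
  have "M-lipschitz_on {0..<\<tau>} x"
  proof (rule lipschitz_onI[OF _ M])
    fix s t assume "s \<in> {0..<\<tau>}" "t \<in> {0..<\<tau>}"
    with bounded_derivative_imp_lipschitz[of "{0..<\<tau>}" x "\<lambda>t. F (x t)" M t s] der bound
    show "dist (x s) (x t) \<le> M * dist s t"
      by (simp add: dist_norm)
  qed
  then obtain y where y: "M-lipschitz_on (closure {0..<\<tau>}) y" "\<forall>t\<in>{0..<\<tau>}. y t = x t"
    using lipschitz_extend_closure by blast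
  have cl: "closure {0..<\<tau>} = {0..\<tau>}" using \<open>\<tau> > 0\<close> by simp
  have conty: "continuous_on {0..\<tau>} y"
    using y(1) unfolding cl by (rule lipschitz_on_continuous_on)
  have contFy: "continuous_on {0..\<tau>} (\<lambda>t. F (y t))"
    using continuous_on_compose2[OF contF conty] by simp
  show thesis
  proof (rule that[of y])
    show "y t = x t" if "t \<in> {0..<\<tau>}" for t using y(2) that by blast
    fix t assume t: "t \<in> {0..\<tau>}"
    show "(y has_vector_derivative F (y t)) (at t within {0..\<tau>})"
    proof (cases "t < \<tau>")
      case True
      have "(x has_vector_derivative F (y t)) (at t within {0..\<tau>})"
      proof -
        have "at t within {0..<\<tau>} = at t within {0..\<tau>}"
          by (rule at_within_nhd[of t "{..<\<tau>}"]) (use True in auto)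
        then show ?thesis using der[of t] y(2) t True by auto
      qed
      then show ?thesis
      proof (rule has_vector_derivative_transform_within[of _ _ _ _ "\<tau> - t"])
        fix s assume "s \<in> {0..\<tau>}" "dist s t < \<tau> - t"
        then show "x s = y s" using y(2) by (auto simp: dist_real_def)
      qed (use t True in auto)
    next
      case False
      with t have [simp]: "t = \<tau>" by auto
      show ?thesis
        unfolding has_vector_derivative_def has_derivative_within_alt
      proof (intro conjI allI impI)
        show "bounded_linear (\<lambda>h. h *\<^sub>R F (y t))" by (rule bounded_linear_scaleR_left)
        fix e :: real assume "e > 0"
        then obtain d where d: "d > 0" "\<And>s. s \<in> {0..\<tau>} \<Longrightarrow> dist s \<tau> < d \<Longrightarrow> dist (F (y s)) (F (y \<tau>)) < e"
        proof -
          have "\<tau> \<in> {0..\<tau>}" using \<open>\<tau> > 0\<close> by simp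
          then show thesis using contFy \<open>e > 0\<close> that unfolding continuous_on_iff by blast
        qed
        have left: "norm (y \<tau> - y s - (\<tau> - s) *\<^sub>R F (y \<tau>)) \<le> e * \<bar>\<tau> - s\<bar>" if s: "s \<in> {0..<\<tau>}" "\<tau> - s < d" for s
        proof -
          have bnd: "norm (y r - y s - (r - s) *\<^sub>R F (y \<tau>)) \<le> e * \<bar>r - s\<bar>" if "r \<in> {s..<\<tau>}" for r
          proof -
            have "norm (x r - x s - (r - s) *\<^sub>R F (y \<tau>)) \<le> e * \<bar>r - s\<bar>"
            proof (rule has_vector_derivative_imp_linear_bound[of "{s..<\<tau>}" x "\<lambda>t. F (x t)"])
              fix q assume q: "q \<in> {s..<\<tau>}"
              show "(x has_vector_derivative F (x q)) (at q within {s..<\<tau>})"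
                using der[of q] q s by (auto intro: has_vector_derivative_within_subset)
              show "norm (F (x q) - F (y \<tau>)) \<le> e"
                using d(2)[of q] q s y(2) by (auto simp: dist_norm abs_real_def)
            qed (use that s in auto)
            then show ?thesis using y(2) that s by auto
          qed
          have lim: "(y \<longlongrightarrow> y \<tau>) (at \<tau> within {s..<\<tau>})"
          proof (rule tendsto_within_subset)
            show "(y \<longlongrightarrow> y \<tau>) (at \<tau> within {0..\<tau>})"
              using conty \<open>\<tau> > 0\<close> by (simp add: continuous_on_def)
          qed (use s in auto)
          have nb: "at \<tau> within {s..<\<tau>} \<noteq> bot"
          proof -
            have "{s..<\<tau>} - {\<tau>} = {s..\<tau>} - {\<tau>}" by auto
            then have "at \<tau> within {s..<\<tau>} = at \<tau> within {s..\<tau>}" by (simp add: at_within_def)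
            then show ?thesis using s by (simp add: at_within_Icc_at_left)
          qed
          have l1: "((\<lambda>r. norm (y r - y s - (r - s) *\<^sub>R F (y \<tau>))) \<longlongrightarrow> norm (y \<tau> - y s - (\<tau> - s) *\<^sub>R F (y \<tau>)))
              (at \<tau> within {s..<\<tau>})"
            by (intro tendsto_intros lim)
          have l2: "((\<lambda>r. e * \<bar>r - s\<bar>) \<longlongrightarrow> e * \<bar>\<tau> - s\<bar>) (at \<tau> within {s..<\<tau>})"
            by (intro tendsto_intros)
          have ev: "\<forall>\<^sub>F r in at \<tau> within {s..<\<tau>}. norm (y r - y s - (r - s) *\<^sub>R F (y \<tau>)) \<le> e * \<bar>r - s\<bar>"
            unfolding eventually_at by (intro exI[of _ 1]) (use bnd in auto)
          show ?thesis
            by (rule tendsto_le[OF nb l2 l1 ev])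
        qed
        have "norm (y s - y t - (s - t) *\<^sub>R F (y t)) \<le> e * norm (s - t)"
          if "s \<in> {0..\<tau>}" "norm (s - t) < d" for s
        proof (cases "s = \<tau>")
          case False
          then have "norm (y \<tau> - y s - (\<tau> - s) *\<^sub>R F (y \<tau>)) \<le> e * \<bar>\<tau> - s\<bar>"
            using that by (intro left) auto
          moreover have "y s - y t - (s - t) *\<^sub>R F (y t) = - (y \<tau> - y s - (\<tau> - s) *\<^sub>R F (y \<tau>))"
            by (simp add: algebra_simps)
          ultimately show ?thesis by (simp only: norm_minus_cancel real_norm_def abs_minus_commute[of s] \<open>t = \<tau>\<close>)
        qed auto
        with d(1) show "\<exists>d>0. \<forall>s\<in>{0..\<tau>}. norm (s - t) < d \<longrightarrow>
            norm (y s - y t - (s - t) *\<^sub>R F (y t)) \<le> e * norm (s - t)" by blast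
      qed
    qed
  qed
qed

text \<open>The solution that Peano's theorem starts at the end point is appended.\<close>

lemma solution_extends_globally:
  fixes F :: "'x::euclidean_space \<Rightarrow> 'x"
  assumes "\<tau> > 0" and uc: "uniformly_continuous_on UNIV F" and bound: "\<And>x. norm (F x) \<le> M"
    and S: "subspace S" "\<And>x. F x \<in> S"
    and der: "\<And>t. t \<in> {0..<\<tau>} \<Longrightarrow> (x has_vector_derivative F (x t)) (at t within {0..<\<tau>})"
    and mem: "\<And>t. t \<in> {0..<\<tau>} \<Longrightarrow> x t \<in> S"
  obtains y where "\<And>t. t \<in> {0..<\<tau>} \<Longrightarrow> y t = x t" "\<And>t. t \<ge> 0 \<Longrightarrow> y t \<in> S"
    "\<And>t. t \<ge> 0 \<Longrightarrow> (y has_vector_derivative F (y t)) (at t within {0..})"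
proof -
  have contF: "continuous_on UNIV F" using uc by (rule uniformly_continuous_imp_continuous)
  obtain l where l: "\<And>t. t \<in> {0..<\<tau>} \<Longrightarrow> l t = x t"
    "\<And>t. t \<in> {0..\<tau>} \<Longrightarrow> (l has_vector_derivative F (l t)) (at t within {0..\<tau>})"
    using solution_extends_to_closed_interval[OF \<open>\<tau> > 0\<close> contF bound der] by blast
  have lS: "l t \<in> S" if "t \<in> {0..\<tau>}" for t
  proof -
    have "continuous_on {0..\<tau>} l"
      using l(2) has_vector_derivative_continuous continuous_on_eq_continuous_within by blast
    then have "l ` closure {0..<\<tau>} \<subseteq> closure (l ` {0..<\<tau>})"
      using \<open>\<tau> > 0\<close> by (intro image_closure_subset) (auto intro: closure_subset[THEN subsetD])
    moreover have "closure (l ` {0..<\<tau>}) \<subseteq> S"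
      using S(1) l(1) mem by (intro closure_minimal) (auto simp: closed_subspace)
    ultimately have "l ` {0..\<tau>} \<subseteq> S" using \<open>\<tau> > 0\<close> by (simp add: subset_trans)
    then show ?thesis using that by blast
  qed
  obtain g where g: "g 0 = l \<tau>" "\<And>t. t \<ge> 0 \<Longrightarrow> g t \<in> S"
      "\<And>t. t \<ge> 0 \<Longrightarrow> (g has_vector_derivative F (g t)) (at t within {0..})"
    using peano_existence[OF uc bound S lS[of \<tau>]] \<open>\<tau> > 0\<close> by auto
  define y where "y = (\<lambda>t. if t \<in> {0..\<tau>} then l t else g (t - \<tau>))"
  show thesis
  proof (rule that[of y])
    show "y t = x t" if "t \<in> {0..<\<tau>}" for t using that l(1) by (simp add: y_def)
    show "y t \<in> S" if "t \<ge> 0" for t using that lS g(2) by (simp add: y_def)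
    fix t :: real assume t: "t \<ge> 0"
    have "(y has_vector_derivative (if t \<in> {0..\<tau>} then F (l t) else F (g (t - \<tau>)))) (at t within {0..})"
      unfolding y_def
    proof (rule has_vector_derivative_If_within_closures)
      show "t \<in> {0..\<tau>} \<union> {\<tau>..}" using t by auto
      show "{0..} = {0..\<tau>} \<union> {\<tau>..}" using \<open>\<tau> > 0\<close> by auto
      have c: "{0..\<tau>} \<union> (closure {0..\<tau>} \<inter> closure {\<tau>..}) = {0..\<tau>}"
        "{\<tau>..} \<union> (closure {0..\<tau>} \<inter> closure {\<tau>..}) = {\<tau>..}" using \<open>\<tau> > 0\<close> by auto
      show "(l has_vector_derivative F (l t)) (at t within {0..\<tau>} \<union> (closure {0..\<tau>} \<inter> closure {\<tau>..}))"
        if "t \<in> {0..\<tau>} \<union> (closure {0..\<tau>} \<inter> closure {\<tau>..})"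
        using l(2) that unfolding c by blast
      show "((\<lambda>t. g (t - \<tau>)) has_vector_derivative F (g (t - \<tau>)))
          (at t within {\<tau>..} \<union> (closure {0..\<tau>} \<inter> closure {\<tau>..}))"
        if "t \<in> {\<tau>..} \<union> (closure {0..\<tau>} \<inter> closure {\<tau>..})"
      proof -
        have t': "t \<ge> \<tau>" using that unfolding c by simp
        have im: "(\<lambda>s. s - \<tau>) ` {\<tau>..} = {0..}"
        proof (intro equalityI subsetI)
          fix r :: real assume "r \<in> {0..}"
          then show "r \<in> (\<lambda>s. s - \<tau>) ` {\<tau>..}" by (intro image_eqI[of _ _ "r + \<tau>"]) auto
        qed auto
        have "((\<lambda>s. s - \<tau>) has_vector_derivative 1) (at t within {\<tau>..})"
          by (auto intro!: derivative_eq_intros)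
        then have "(g \<circ> (\<lambda>s. s - \<tau>) has_vector_derivative 1 *\<^sub>R F (g (t - \<tau>))) (at t within {\<tau>..})"
          by (rule vector_diff_chain_within) (use g(3)[of "t - \<tau>"] t' im in auto)
        then show ?thesis unfolding c by (simp add: o_def)
      qed
      show "l t = g (t - \<tau>)" "F (l t) = F (g (t - \<tau>))"
        if "t \<in> closure {0..\<tau>}" "t \<in> closure {\<tau>..}"
        using that g(1) \<open>\<tau> > 0\<close> by (auto simp: order_antisym)
    qed
    moreover have "(if t \<in> {0..\<tau>} then F (l t) else F (g (t - \<tau>))) = F (y t)"
      by (simp add: y_def)
    ultimately show "(y has_vector_derivative F (y t)) (at t within {0..})" by simp
  qed
qed

text \<open>
  The state space is a subspace, and all hypotheses are local: on the compact convex region \<open>K\<close>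
  the vector field is merely continuous, so solutions need not be unique.  The function \<open>W\<close> bounds the
  decay of the Lyapunov function \<open>V\<close> from below and may vanish away from \<open>p\<close>; the last
  hypothesis is the invariance condition of LaSalle's principle.
\<close>

locale weak_lyapunov_region =
  fixes S :: "'x::euclidean_space set" and p :: 'x and r :: real and F :: "'x \<Rightarrow> 'x"
    and V :: "'x \<Rightarrow> real" and DV :: "'x \<Rightarrow> 'x \<Rightarrow> real" and W :: "'x \<Rightarrow> real" and K :: "'x set"
  defines "K \<equiv> cball p r \<inter> S"
  assumes S: "subspace S" and p_in: "p \<in> S" and r_pos: "r > 0"
    and cont: "continuous_on K F" and tangent: "\<And>x. x \<in> K \<Longrightarrow> F x \<in> S"
    and V_deriv: "\<And>x. x \<in> K \<Longrightarrow> (V has_derivative DV x) (at x within S)"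
    and decay: "\<And>x. x \<in> K \<Longrightarrow> DV x (F x) \<le> - W x" and W_nonneg: "\<And>x. x \<in> K \<Longrightarrow> 0 \<le> W x"
    and V_p: "V p = 0" and V_pos: "\<And>x. x \<in> K \<Longrightarrow> x \<noteq> p \<Longrightarrow> V x > 0"
    and invariance: "\<And>y. (\<And>t. t \<ge> 0 \<Longrightarrow> y t \<in> K) \<Longrightarrow> (\<And>t. t \<ge> 0 \<Longrightarrow> W (y t) = 0) \<Longrightarrow>
      (\<And>t. t \<ge> 0 \<Longrightarrow> (y has_vector_derivative F (y t)) (at t within {0..})) \<Longrightarrow> (y \<longlongrightarrow> p) at_top"
begin

lemma compact_K: "compact K" and convex_K: "convex K" and p_in_K: "p \<in> K"
  and K_subset: "K \<subseteq> S"
  using S p_in r_pos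
  by (auto simp: K_def closed_subspace subspace_imp_convex intro!: compact_Int_closed convex_Int)

text \<open>The vector field off \<open>K\<close> only serves to have global solutions.\<close>

definition G where "G x = F (closest_point K x)"

lemma G_eq: "x \<in> K \<Longrightarrow> G x = F x"
  by (simp add: G_def closest_point_self)

lemma G_in_S: "G x \<in> S"
  unfolding G_def
  using closest_point_in_set[of K x] compact_K p_in_K by (auto intro!: tangent dest: compact_imp_closed)

lemma G_uniformly_continuous: "uniformly_continuous_on UNIV G"
  and G_bounded: "\<exists>M. \<forall>x. norm (G x) \<le> M"
  unfolding G_def using closest_point_extension[OF compact_K convex_K _ cont] p_in_K by auto

lemma V_continuous: "continuous_on K V"
  unfolding continuous_on_eq_continuous_within
  using V_deriv K_subset by (meson continuous_within_subset has_derivative_continuous)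

lemma V_along_solution:
  assumes J: "J \<subseteq> I" "t \<in> J" and mem: "\<And>t. t \<in> J \<Longrightarrow> x t \<in> S" "x t \<in> K"
    and der: "(x has_vector_derivative F (x t)) (at t within I)"
  shows "((\<lambda>t. V (x t)) has_real_derivative DV (x t) (F (x t))) (at t within J)"
proof -
  have 1: "(x has_derivative (\<lambda>h. h *\<^sub>R F (x t))) (at t within J)"
    using has_vector_derivative_within_subset[OF der J(1)] by (simp add: has_vector_derivative_def)
  have lin: "linear (DV (x t))"
    using V_deriv[OF mem(2)] by (rule has_derivative_linear)
  have "(V has_derivative DV (x t)) (at (x t) within x ` J)"
    using V_deriv[OF mem(2)] by (rule has_derivative_subset) (use mem(1) in auto)
  from has_derivative_in_compose[OF 1 this]
  have "((\<lambda>t. V (x t)) has_derivative (\<lambda>h. DV (x t) (h *\<^sub>R F (x t)))) (at t within J)" .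
  then show ?thesis
    by (simp add: has_field_derivative_def linear_cmul[OF lin] mult.commute[of _ "DV (x t) (F (x t))"])
qed

lemma V_decreasing:
  assumes "a \<le> b" "{a..b} \<subseteq> I" and mem: "\<And>t. t \<in> {a..b} \<Longrightarrow> x t \<in> K"
    and der: "\<And>t. t \<in> {a..b} \<Longrightarrow> (x has_vector_derivative F (x t)) (at t within I)"
  shows "V (x b) \<le> V (x a)"
proof -
  have D: "((\<lambda>t. V (x t)) has_real_derivative DV (x t) (F (x t))) (at t within {a..b})" if "t \<in> {a..b}" for t
    using assms(2) that _ _ der[OF that] by (rule V_along_solution) (use mem K_subset that in auto)
  show ?thesis
  proof (rule DERIV_nonpos_imp_decreasing_open[OF \<open>a \<le> b\<close>, of "\<lambda>t. V (x t)"])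
    show "continuous_on {a..b} (\<lambda>t. V (x t))"
      using D by (rule DERIV_continuous_on)
    fix t assume t: "a < t" "t < b"
    then have "at t within {a..b} = at t"
      by (intro at_within_interior) auto
    with D[of t] t have "((\<lambda>t. V (x t)) has_real_derivative DV (x t) (F (x t))) (at t)" by auto
    moreover have "DV (x t) (F (x t)) \<le> 0"
      using decay[of "x t"] W_nonneg[of "x t"] mem[of t] t by auto
    ultimately show "\<exists>y. ((\<lambda>t. V (x t)) has_real_derivative y) (at t) \<and> y \<le> 0" by blast
  qed
qed

lemma V_bound_outside:
  assumes "e > 0"
  obtains c where "c > 0" "\<And>x. x \<in> K \<Longrightarrow> V x < c \<Longrightarrow> dist p x < e"
proof (cases "K - ball p e = {}")
  case True
  show ?thesis
  proof (rule that[of 1])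
    fix x assume "x \<in> K"
    with True show "dist p x < e" by auto
  qed simp
next
  case False
  have "compact (K - ball p e)"
    using compact_K by (intro compact_diff) auto
  then obtain y where y: "y \<in> K - ball p e" "\<And>z. z \<in> K - ball p e \<Longrightarrow> V y \<le> V z"
    using continuous_attains_inf[of "K - ball p e" V] False V_continuous
    by (metis Diff_subset continuous_on_subset)
  show ?thesis
  proof (rule that[of "V y"])
    show "V y > 0" using y(1) \<open>e > 0\<close> by (intro V_pos) auto
    show "dist p x < e" if "x \<in> K" "V x < V y" for x
      using y(2)[of x] that by force
  qed
qed

text \<open>
  Only the first exit time matters: up to it the curve solves the equation in \<open>K\<close>, so \<open>V\<close> has
  not grown, but \<open>V\<close> is too large on the sphere.
\<close>

lemma trapped:
  assumes bnd: "\<And>x. x \<in> K \<Longrightarrow> V x < c \<Longrightarrow> dist p x < r"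
    and J: "is_interval J" "0 \<in> J" "J \<subseteq> {0..}"
    and mem: "\<And>t. t \<in> J \<Longrightarrow> x t \<in> S"
    and der: "\<And>t. t \<in> J \<Longrightarrow> (x has_vector_derivative x' t) (at t within J)"
    and sol: "\<And>t. t \<in> J \<Longrightarrow> x t \<in> K \<Longrightarrow> x' t = F (x t)"
    and start: "x 0 \<in> K" "V (x 0) < c"
    and t: "t \<in> J"
  shows "dist p (x t) < r"
proof (rule ccontr)
  assume out: "\<not> dist p (x t) < r"
  have J_ivl: "{0..t} \<subseteq> J"
    using J t by (meson atLeastAtMost_iff is_interval_1 subsetI)
  have "t \<ge> 0" using t J by auto
  have contx: "continuous_on {0..t} x"
    using der J_ivl
    by (meson continuous_on_eq_continuous_within continuous_on_subset has_vector_derivative_continuous)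
  let ?A = "{s \<in> {0..t}. r \<le> dist p (x s)}"
  have "compact ?A"
  proof -
    have "closed ({0..t} \<inter> (\<lambda>s. dist p (x s)) -` {r..})"
      by (intro continuous_closed_preimage continuous_intros contx)
    moreover have "?A = {0..t} \<inter> (\<lambda>s. dist p (x s)) -` {r..}" by auto
    ultimately have "closed ?A" by simp
    then have "compact ({0..t} \<inter> ?A)" by (intro compact_Int_closed) auto
    moreover have "{0..t} \<inter> ?A = ?A" by auto
    ultimately show ?thesis by simp
  qed
  moreover have "?A \<noteq> {}" using out \<open>t \<ge> 0\<close> by force
  \<comment> \<open>the first exit time\<close>
  ultimately obtain q where q: "q \<in> ?A" "\<And>s. s \<in> ?A \<Longrightarrow> q \<le> s"
    by (meson compact_attains_inf)
  have before: "dist p (x s) < r" if "0 \<le> s" "s < q" for s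
    using q(2)[of s] q(1) that by force
  have "q > 0"
  proof (rule ccontr)
    assume "\<not> q > 0"
    with q(1) have "q = 0" by simp
    with q(1) bnd[OF start] show False by simp
  qed
  have "dist p (x q) \<le> r"
  proof (rule tendsto_upperbound)
    show "at q within {0..<q} \<noteq> bot"
    proof -
      have "{0..<q} - {q} = {0..q} - {q}" by auto
      then have "at q within {0..<q} = at q within {0..q}" by (simp add: at_within_def)
      then show ?thesis using \<open>q > 0\<close> by (simp add: at_within_Icc_at_left)
    qed
    have "(x \<longlongrightarrow> x q) (at q within {0..t})"
      using contx q(1) by (simp add: continuous_on_def)
    then have "(x \<longlongrightarrow> x q) (at q within {0..<q})"
      by (rule tendsto_within_subset) (use q(1) in auto)
    then show "((\<lambda>s. dist p (x s)) \<longlongrightarrow> dist p (x q)) (at q within {0..<q})"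
      by (intro tendsto_intros)
    show "\<forall>\<^sub>F s in at q within {0..<q}. dist p (x s) \<le> r"
      unfolding eventually_at by (intro exI[of _ 1]) (use before in \<open>auto intro: less_imp_le\<close>)
  qed
  have sJ: "s \<in> J" if "s \<in> {0..q}" for s
    using J_ivl that q(1) by force
  have inK: "x s \<in> K" if "s \<in> {0..q}" for s
  proof -
    have "dist p (x s) \<le> r" using before[of s] \<open>dist p (x q) \<le> r\<close> that by (cases "s = q") auto
    then show ?thesis using mem[OF sJ[OF that]] by (simp add: K_def)
  qed
  have "V (x q) \<le> V (x 0)"
  proof (rule V_decreasing[of 0 q J])
    fix s assume "s \<in> {0..q}"
    then show "(x has_vector_derivative F (x s)) (at s within J)"
      using der[OF sJ] sol[OF sJ inK] by simp
  qed (use \<open>q > 0\<close> sJ inK in auto)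
  then have "dist p (x q) < r" using bnd[of "x q"] inK[of q] \<open>q > 0\<close> start(2) by auto
  with q(1) show False by simp
qed

text \<open>
  LaSalle's argument: the translates of the trajectory cluster at a solution along which \<open>V\<close> keeps
  the limiting value.  The invariance condition identifies this value as \<open>V p = 0\<close>, so that
  positive definiteness gives convergence of the trajectory itself.
\<close>

lemma solution_converges:
  assumes mem: "\<And>t. t \<ge> 0 \<Longrightarrow> x t \<in> K"
    and der: "\<And>t. t \<ge> 0 \<Longrightarrow> (x has_vector_derivative F (x t)) (at t within {0..})"
  shows "(x \<longlongrightarrow> p) at_top"
proof -
  have V_nonneg: "V z \<ge> 0" if "z \<in> K" for z
    using V_pos[OF that] V_p by (cases "z = p") auto
  have anti: "V (x b) \<le> V (x a)" if "0 \<le> a" "a \<le> b" for a b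
    by (rule V_decreasing[of a b "{0..}"]) (use that mem der in auto)
  define c where "c = Inf ((\<lambda>t. V (x t)) ` {0..})"
  have bdd: "bdd_below ((\<lambda>t. V (x t)) ` {0..})"
    using V_nonneg mem by (intro bdd_belowI[of _ 0]) auto
  have V_lim: "((\<lambda>t. V (x t)) \<longlongrightarrow> c) at_top"
  proof (rule tendstoI)
    fix e :: real assume "e > 0"
    then obtain t0 where t0: "t0 \<ge> 0" "V (x t0) < c + e"
      using cInf_lessD[of "(\<lambda>t. V (x t)) ` {0..}" "c + e"] by (auto simp: c_def)
    have "dist (V (x t)) c < e" if "t \<ge> t0" for t
    proof -
      have "c \<le> V (x t)" unfolding c_def using bdd that t0 by (intro cInf_lower) auto
      moreover have "V (x t) \<le> V (x t0)" using anti that t0 by auto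
      ultimately show ?thesis using t0 by (simp add: dist_real_def)
    qed
    then show "\<forall>\<^sub>F t in at_top. dist (V (x t)) c < e"
      by (auto simp: eventually_at_top_linorder)
  qed
  \<comment> \<open>Absolute values make the translates functions on the whole line with values in \<open>K\<close>.\<close>
  define X where "X = (\<lambda>i t. x (\<bar>i\<bar> + \<bar>t\<bar>))"
  obtain w H where w: "H \<noteq> bot" "H \<le> at_top" "\<And>t. w t \<in> K" "\<And>t. ((\<lambda>i. X i t) \<longlongrightarrow> w t) H"
  proof (rule pointwise_cluster_filter[of "\<lambda>_::real. K" X "at_top :: real filter"])
    show "X i t \<in> K" for i t using mem by (simp add: X_def)
  qed (use compact_K in auto)
  obtain M where M: "\<And>z. norm (G z) \<le> M" using G_bounded by blast
  have w_sol: "(w has_vector_derivative F (w t)) (at t within {0..})" if "t \<ge> 0" for t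
  proof -
    have "(w has_vector_derivative G (w t)) (at t within {0..})"
    proof (rule pointwise_limit_of_approximate_trajectories[OF w(1), of "{0..}" X])
      show "continuous_on UNIV G"
        using G_uniformly_continuous by (rule uniformly_continuous_imp_continuous)
      fix \<epsilon> :: real assume "\<epsilon> > 0"
      obtain \<delta> where \<delta>: "\<delta> > 0"
        "\<And>I x s t. convex I \<Longrightarrow> (\<And>t. t \<in> I \<Longrightarrow> (x has_vector_derivative G (x t)) (at t within I)) \<Longrightarrow>
          s \<in> I \<Longrightarrow> t \<in> I \<Longrightarrow> \<bar>t - s\<bar> < \<delta> \<Longrightarrow> norm (x t - x s - (t - s) *\<^sub>R G (x s)) \<le> \<epsilon> * \<bar>t - s\<bar>"
        using uniform_first_order_estimate[OF G_uniformly_continuous M \<open>\<epsilon> > 0\<close>] by blast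
      have "norm (X i t - X i s - (t - s) *\<^sub>R G (X i s)) \<le> \<epsilon> * \<bar>t - s\<bar> + \<kappa>"
        if st: "s \<ge> 0" "t \<ge> 0" "\<bar>t - s\<bar> < \<delta>" and "\<kappa> > 0" for i s t \<kappa>
      proof -
        have "norm (x (\<bar>i\<bar> + t) - x (\<bar>i\<bar> + s) - ((\<bar>i\<bar> + t) - (\<bar>i\<bar> + s)) *\<^sub>R G (x (\<bar>i\<bar> + s)))
            \<le> \<epsilon> * \<bar>(\<bar>i\<bar> + t) - (\<bar>i\<bar> + s)\<bar>"
          by (rule \<delta>(2)[of "{0..}"]) (use st der mem G_eq in auto)
        with st \<open>\<kappa> > 0\<close> show ?thesis by (simp add: X_def)
      qed
      with \<delta>(1) show "\<exists>\<delta>>0. \<forall>\<kappa>>0. \<forall>\<^sub>F i in H. \<forall>s\<in>{0..}. \<forall>t\<in>{0..}. \<bar>t - s\<bar> < \<delta> \<longrightarrow>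
          norm (X i t - X i s - (t - s) *\<^sub>R G (X i s)) \<le> \<epsilon> * \<bar>t - s\<bar> + \<kappa>"
        by (intro exI[of _ \<delta>]) auto
    qed (use w(4) that in auto)
    then show ?thesis using G_eq w(3) by simp
  qed
  have Vw: "V (w t) = c" for t
  proof -
    have "((\<lambda>i. V (X i t)) \<longlongrightarrow> V (w t)) H"
      by (rule continuous_on_tendsto_compose[OF V_continuous w(4) w(3)]) (use mem in \<open>auto simp: X_def\<close>)
    moreover have "((\<lambda>i. V (X i t)) \<longlongrightarrow> c) H"
    proof -
      have "filterlim (\<lambda>i. \<bar>i\<bar> + \<bar>t\<bar>) at_top H"
      proof (rule filterlim_mono[OF _ order_refl w(2)])
        show "filterlim (\<lambda>i. \<bar>i\<bar> + \<bar>t\<bar>) at_top (at_top :: real filter)"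
          by (rule filterlim_at_top_mono[OF filterlim_ident]) (intro always_eventually, auto)
      qed
      then show ?thesis unfolding X_def by (rule filterlim_compose[OF V_lim])
    qed
    ultimately show ?thesis using w(1) tendsto_unique by blast
  qed
  have "W (w t) = 0" if "t \<ge> 0" for t
  proof -
    have "((\<lambda>t. V (w t)) has_real_derivative DV (w t) (F (w t))) (at t within {0..})"
      by (rule V_along_solution[OF order_refl]) (use that w_sol w(3) K_subset in auto)
    then have "((\<lambda>t. c) has_vector_derivative DV (w t) (F (w t))) (at t within {0..})"
      by (simp add: Vw has_real_derivative_iff_has_vector_derivative)
    moreover have "((\<lambda>t. c) has_vector_derivative 0) (at t within {0..})" by simp
    moreover have "at t within {0..} \<noteq> bot"
    proof
      assume "at t within {0..} = bot"
      moreover have "at_right t \<le> at t within {0..}" by (rule at_le) (use that in auto)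
      ultimately show False using trivial_limit_at_right_real[of t] by (simp add: bot_unique)
    qed
    ultimately have "DV (w t) (F (w t)) = 0" using vector_derivative_unique_within by blast
    with decay[OF w(3)] W_nonneg[OF w(3)] show ?thesis by (metis neg_0_le_iff_le order_antisym)
  qed
  then have "(w \<longlongrightarrow> p) at_top" using w_sol w(3) by (intro invariance) auto
  then have "((\<lambda>t. V (w t)) \<longlongrightarrow> V p) at_top"
    by (rule continuous_on_tendsto_compose[OF V_continuous _ p_in_K]) (use w(3) in auto)
  then have "c = 0" by (simp add: Vw V_p tendsto_const_iff)
  show ?thesis
  proof (rule tendstoI)
    fix e :: real assume "e > 0"
    then obtain d where d: "d > 0" "\<And>z. z \<in> K \<Longrightarrow> V z < d \<Longrightarrow> dist p z < e"
      using V_bound_outside by blast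
    have "\<forall>\<^sub>F t in at_top. V (x t) < d"
      using V_lim d(1) \<open>c = 0\<close> by (auto dest: order_tendstoD)
    with eventually_ge_at_top[of 0] show "\<forall>\<^sub>F t in at_top. dist (x t) p < e"
      by eventually_elim (use d(2) mem in \<open>auto simp: dist_commute[of _ p]\<close>)
  qed
qed

text \<open>
  In the second property the curve is assumed to solve the equation only while it is in \<open>K\<close>.  For the
  network this is all that is known: outside of \<open>K\<close> the load frequencies, and so the rates, need not
  be functions of the state.
\<close>

theorem local_convergence:
  obtains \<delta> where "\<delta> > 0"
    "\<And>s. s \<in> ball p \<delta> \<inter> S \<Longrightarrow> \<exists>x. x 0 = s \<and>
       (\<forall>t\<ge>0. x t \<in> K \<and> (x has_vector_derivative F (x t)) (at t within {0..}))"
    "\<And>J x x' t. is_interval J \<Longrightarrow> 0 \<in> J \<Longrightarrow> J \<subseteq> {0..} \<Longrightarrow> (\<And>t. t \<in> J \<Longrightarrow> x t \<in> S) \<Longrightarrow>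
       (\<And>t. t \<in> J \<Longrightarrow> (x has_vector_derivative x' t) (at t within J)) \<Longrightarrow>
       (\<And>t. t \<in> J \<Longrightarrow> x t \<in> K \<Longrightarrow> x' t = F (x t)) \<Longrightarrow> x 0 \<in> ball p \<delta> \<Longrightarrow> t \<in> J \<Longrightarrow> x t \<in> K"
    "\<And>\<tau> x. \<tau> > 0 \<Longrightarrow> x 0 \<in> ball p \<delta> \<Longrightarrow> (\<And>t. t \<in> {0..<\<tau>} \<Longrightarrow> x t \<in> K) \<Longrightarrow>
       (\<And>t. t \<in> {0..<\<tau>} \<Longrightarrow> (x has_vector_derivative F (x t)) (at t within {0..<\<tau>})) \<Longrightarrow>
       \<exists>y. (\<forall>t\<in>{0..<\<tau>}. y t = x t) \<and>
         (\<forall>t\<ge>0. y t \<in> K \<and> (y has_vector_derivative F (y t)) (at t within {0..}))"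
proof -
  obtain c where c: "c > 0" "\<And>x. x \<in> K \<Longrightarrow> V x < c \<Longrightarrow> dist p x < r"
    using V_bound_outside[OF r_pos] by blast
  obtain d where d: "d > 0" "\<And>x. x \<in> K \<Longrightarrow> dist x p < d \<Longrightarrow> dist (V x) (V p) < c"
    using V_continuous p_in_K c(1) unfolding continuous_on_iff by blast
  define \<delta> where "\<delta> = min r d"
  have start: "x \<in> K" "V x < c" if "x \<in> S" "x \<in> ball p \<delta>" for x
  proof -
    show "x \<in> K" using that by (auto simp: K_def \<delta>_def)
    then have "dist (V x) (V p) < c"
      by (rule d(2)) (use that in \<open>auto simp: \<delta>_def dist_commute\<close>)
    then show "V x < c" by (simp add: V_p dist_real_def)
  qed
  obtain M where M: "\<And>z. norm (G z) \<le> M" using G_bounded by blast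
  have G_sol: "x t \<in> K" if "x 0 \<in> ball p \<delta>" "\<And>t. t \<ge> 0 \<Longrightarrow> x t \<in> S" "t \<ge> 0"
    "\<And>t. t \<ge> 0 \<Longrightarrow> (x has_vector_derivative G (x t)) (at t within {0..})" for x t
  proof -
    have "dist p (x t) < r"
      by (rule trapped[of c "{0..}" x "\<lambda>t. G (x t)"])
        (use that start[of "x 0"] G_eq c(2) in \<open>auto simp: is_interval_1\<close>)
    then show ?thesis using that by (auto simp: K_def)
  qed
  show thesis
  proof (rule that[of \<delta>])
    show "\<delta> > 0" using r_pos d(1) by (simp add: \<delta>_def)
    show "\<exists>x. x 0 = s \<and> (\<forall>t\<ge>0. x t \<in> K \<and> (x has_vector_derivative F (x t)) (at t within {0..}))"
      if s: "s \<in> ball p \<delta> \<inter> S" for s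
    proof -
      obtain x where x: "x 0 = s" "\<And>t. t \<ge> 0 \<Longrightarrow> x t \<in> S"
        "\<And>t. t \<ge> 0 \<Longrightarrow> (x has_vector_derivative G (x t)) (at t within {0..})"
        using peano_existence[OF G_uniformly_continuous M S G_in_S, of s] s by blast
      have "x t \<in> K" if "t \<ge> 0" for t by (rule G_sol) (use x s that in auto)
      with x show ?thesis using G_eq by (intro exI[of _ x]) auto
    qed
    show "x t \<in> K"
      if "is_interval J" "0 \<in> J" "J \<subseteq> {0..}" "\<And>t. t \<in> J \<Longrightarrow> x t \<in> S"
        "\<And>t. t \<in> J \<Longrightarrow> (x has_vector_derivative x' t) (at t within J)"
        "\<And>t. t \<in> J \<Longrightarrow> x t \<in> K \<Longrightarrow> x' t = F (x t)" "x 0 \<in> ball p \<delta>" "t \<in> J" for J x x' t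
    proof -
      have "dist p (x t) < r"
        by (rule trapped[of c J x x']) (use that start[of "x 0"] c(2) in auto)
      then show ?thesis using that by (auto simp: K_def)
    qed
    show "\<exists>y. (\<forall>t\<in>{0..<\<tau>}. y t = x t) \<and>
         (\<forall>t\<ge>0. y t \<in> K \<and> (y has_vector_derivative F (y t)) (at t within {0..}))"
      if "\<tau> > 0" and x0: "x 0 \<in> ball p \<delta>" and xK: "\<And>t. t \<in> {0..<\<tau>} \<Longrightarrow> x t \<in> K"
        and der: "\<And>t. t \<in> {0..<\<tau>} \<Longrightarrow> (x has_vector_derivative F (x t)) (at t within {0..<\<tau>})" for \<tau> x
    proof -
      obtain y where y: "\<And>t. t \<in> {0..<\<tau>} \<Longrightarrow> y t = x t" "\<And>t. t \<ge> 0 \<Longrightarrow> y t \<in> S"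
          "\<And>t. t \<ge> 0 \<Longrightarrow> (y has_vector_derivative G (y t)) (at t within {0..})"
      proof (rule solution_extends_globally[OF \<open>\<tau> > 0\<close> G_uniformly_continuous M S G_in_S, of x])
        fix t assume "t \<in> {0..<\<tau>}"
        then show "(x has_vector_derivative G (x t)) (at t within {0..<\<tau>})" "x t \<in> S"
          using der xK G_eq K_subset by auto
      qed blast
      have "y t \<in> K" if "t \<ge> 0" for t by (rule G_sol) (use y x0 \<open>\<tau> > 0\<close> that in auto)
      with y show ?thesis using G_eq by (intro exI[of _ y]) auto
    qed
  qed
qed

end

section \<open>Optimality of equilibria\<close>

lemma edge_sum_eq:
  fixes g :: "'n::finite \<Rightarrow> 'n \<Rightarrow> 'a::comm_monoid_add"
  shows "(\<Sum>(i, j)\<in>E. g i j) = (\<Sum>i\<in>UNIV. \<Sum>j\<in>UNIV. if (i, j) \<in> E then g i j else 0)"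
proof -
  have "(\<Sum>i\<in>UNIV. \<Sum>j\<in>UNIV. if (i, j) \<in> E then g i j else 0)
      = (\<Sum>x\<in>UNIV \<times> UNIV. if x \<in> E then (case x of (i, j) \<Rightarrow> g i j) else 0)"
    by (subst sum.cartesian_product) (auto intro!: sum.cong)
  also have "\<dots> = (\<Sum>(i, j)\<in>E. g i j)"
    by (subst sum.inter_restrict[symmetric]) (auto simp: UNIV_Times_UNIV)
  finally show ?thesis by simp
qed

text \<open>Each line exports at one end what it imports at the other (summation by parts).\<close>

lemma weighted_inflow_sum:
  fixes f :: "'n::finite \<Rightarrow> 'n \<Rightarrow> real"
  shows "(\<Sum>j\<in>UNIV. c j * (- (\<Sum>k\<in>{k. (j, k) \<in> E}. f j k) + (\<Sum>i\<in>{i. (i, j) \<in> E}. f i j)))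
    = - (\<Sum>(i, j)\<in>E. f i j * (c i - c j))"
proof -
  have restrict: "sum g {k. Q k} = (\<Sum>k\<in>UNIV. if Q k then g k else 0)" for g :: "'n \<Rightarrow> real" and Q
    using sum.inter_restrict[of UNIV g "{k. Q k}"] by simp
  have "(\<Sum>j\<in>UNIV. c j * (- (\<Sum>k\<in>{k. (j, k) \<in> E}. f j k) + (\<Sum>i\<in>{i. (i, j) \<in> E}. f i j)))
    = - (\<Sum>j\<in>UNIV. \<Sum>k\<in>UNIV. if (j, k) \<in> E then c j * f j k else 0)
      + (\<Sum>j\<in>UNIV. \<Sum>i\<in>UNIV. if (i, j) \<in> E then c j * f i j else 0)"
    by (simp add: restrict sum_distrib_left sum.distrib sum_negf[symmetric] algebra_simps
        if_distrib[of "(*) _"] sum_subtractf cong: if_cong)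
  also have "(\<Sum>j\<in>UNIV. \<Sum>i\<in>UNIV. if (i, j) \<in> E then c j * f i j else 0)
      = (\<Sum>i\<in>UNIV. \<Sum>j\<in>UNIV. if (i, j) \<in> E then c j * f i j else 0)"
    by (rule sum.swap)
  also have "- (\<Sum>j\<in>UNIV. \<Sum>k\<in>UNIV. if (j, k) \<in> E then c j * f j k else 0) + \<dots>
      = - (\<Sum>(i, j)\<in>E. f i j * (c i - c j))"
    by (simp add: edge_sum_eq[symmetric] sum_negf[symmetric] sum.distrib[symmetric] algebra_simps split_beta)
  finally show ?thesis .
qed

lemma net_inflow_weighted_sum:
  "(\<Sum>j\<in>UNIV. c j * net_inflow P z j) = - (\<Sum>(i, j)\<in>lines P. flow P z i j * (c i - c j))"
  unfolding net_inflow_def by (rule weighted_inflow_sum)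

lemma strictly_convex_above_tangent:
  assumes "strictly_convex f" "f C1_differentiable_on UNIV"
  shows "deriv f p * (x - p) \<le> f x - f p"
proof -
  have "convex_on UNIV f"
  proof (rule convex_onI)
    fix t x y :: real assume t: "0 < t" "t < 1"
    show "f ((1 - t) *\<^sub>R x + t *\<^sub>R y) \<le> (1 - t) * f x + t * f y"
    proof (cases "x = y")
      case False
      then show ?thesis using assms(1) t unfolding strictly_convex_def by (auto intro: less_imp_le)
    qed (simp add: algebra_simps)
  qed simp
  moreover obtain d where d: "(f has_real_derivative d) (at p)"
    using assms(2) unfolding C1_differentiable_on_def has_real_derivative_iff_has_vector_derivative by auto
  ultimately have "d * (x - p) \<le> f x - f p"
    by (intro convex_on_imp_above_tangent[of UNIV]) auto
  then show ?thesis using DERIV_imp_deriv[OF d] by simp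
qed

text \<open>
  The Karush-Kuhn-Tucker conditions of a box constraint: where the saturation is active, the
  marginal cost differs from the price \<open>u\<close> in the direction that points out of the box.
\<close>

lemma saturated_response_optimal:
  assumes f: "strictly_convex f" "f C1_differentiable_on UNIV" and "surj (deriv f)"
    and "a \<le> b" and p: "p = saturate a b (inv (deriv f) u)" and x: "a \<le> x" "x \<le> b"
  shows "u * (x - p) \<le> f x - f p"
proof -
  define q where "q = inv (deriv f) u"
  have q: "deriv f q = u" unfolding q_def using \<open>surj (deriv f)\<close> by (rule surj_f_inv_f)
  have tangent: "deriv f s * (t - s) \<le> f t - f s" for s t
    using f by (rule strictly_convex_above_tangent)
  have mono: "0 \<le> (u - deriv f p) * (q - p)"
    using tangent[of p q] tangent[of q p] q by (simp add: algebra_simps)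
  have "u * (x - p) \<le> deriv f p * (x - p)"
  proof -
    have "p = q \<or> (q > b \<and> p = b) \<or> (q < a \<and> p = a)"
      using p \<open>a \<le> b\<close> unfolding saturate_def q_def[symmetric] by (simp add: min_def max_def) linarith
    then consider "p = q" | "q > b" "p = b" | "q < a" "p = a" by blast
    then show ?thesis
    proof cases
      case 1 with q show ?thesis by simp
    next
      case 2
      with mono have "u - deriv f p \<ge> 0" by (simp add: zero_le_mult_iff)
      with 2 x show ?thesis by (auto intro: mult_right_mono_neg)
    next
      case 3
      with mono have "u - deriv f p \<le> 0" by (simp add: zero_le_mult_iff)
      with 3 x show ?thesis by (auto intro: mult_right_mono)
    qed
  qed
  with tangent[of p x] show ?thesis by simp
qed

lemma integral_of_mono_above_tangent:
  fixes g :: "real \<Rightarrow> real"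
  assumes contg: "continuous_on UNIV g" and "mono g"
  shows "g p * (x - p) \<le> (LBINT z=0..ereal x. g z) - (LBINT z=0..ereal p. g z)"
proof -
  have D: "((\<lambda>x. LBINT z=0..ereal x. g z) has_real_derivative g y) (at y)" for y
  proof -
    let ?a = "- \<bar>y\<bar> - 1" and ?b = "\<bar>y\<bar> + 1"
    have "((\<lambda>u. LBINT z=ereal 0..ereal u. g z) has_vector_derivative g y) (at y within {?a..?b})"
      by (rule interval_integral_FTC2) (use continuous_on_subset[OF contg] in auto)
    moreover have "at y within {?a..?b} = at y"
      by (intro at_within_interior) auto
    ultimately show ?thesis
      by (simp add: has_real_derivative_iff_has_vector_derivative zero_ereal_def)
  qed
  let ?I = "\<lambda>x. LBINT z=0..ereal x. g z"
  consider "x = p" | "p < x" | "x < p" by linarith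
  then show ?thesis
  proof cases
    case 2
    then obtain y where "p < y" "?I x - ?I p = (x - p) * g y" using MVT2[of p x ?I g] D by auto
    moreover have "g p * (x - p) \<le> g y * (x - p)"
      using 2 \<open>p < y\<close> monoD[OF \<open>mono g\<close>, of p y] by (intro mult_right_mono) auto
    ultimately show ?thesis by (simp add: mult.commute)
  next
    case 3
    then obtain y where "y < p" "?I p - ?I x = (p - x) * g y" using MVT2[of x p ?I g] D by auto
    moreover have "g y * (p - x) \<le> g p * (p - x)"
      using 3 \<open>y < p\<close> monoD[OF \<open>mono g\<close>, of y p] by (intro mult_right_mono) auto
    ultimately show ?thesis by (simp add: algebra_simps)
  qed simp
qed

lemma equilibrium_frequency_uniform:
  assumes "wf_network P" "is_equilibrium P z"
  shows "omega z $ i = omega z $ j"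
proof -
  have "(i, j) \<in> (lines P \<union> (lines P)\<inverse>)\<^sup>*"
    using assms(1) by (simp add: wf_network_def)
  then show ?thesis
  proof (induction rule: rtrancl_induct)
    case (step j k)
    then show ?case using assms(2) unfolding is_equilibrium_def by fastforce
  qed simp
qed

text \<open>
  The common value of the negated frequency is the multiplier of the balance constraint: every
  device responds optimally to it as a price, and the balance makes the price term vanish.
\<close>

lemma equilibrium_optimal:
  assumes wf: "wf_network P" "wf_oslc P Q" and eq: "is_equilibrium P z"
    and reg: "cost_regularity P Q" and droop: "optimal_droop P Q"
  shows "optimal_equilibrium P Q z"
proof -
  obtain w where w: "\<And>j. omega z $ j = w"
    using equilibrium_frequency_uniform[OF wf(1) eq] by blast
  define pM where "pM j = output_char (gen_sys P j) (- w)" for j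
  define dc where "dc j = output_char (ctrl_sys P j) (- w)" for j
  define du where "du j = output_char (unctrl_sys P j) (- w)" for j
  have sat: "a \<le> saturate a b q" "saturate a b q \<le> b" if "a \<le> b" for a b q
    using that by (auto simp: saturate_def)
  have box: "\<And>j. j \<in> gens P \<Longrightarrow> pmin Q j \<le> pmax Q j" "\<And>j. dmin Q j \<le> dmax Q j"
    using wf(2) by (auto simp: wf_oslc_def)
  have pM_eq: "pM j = saturate (pmin Q j) (pmax Q j) (inv (deriv (gcost Q j)) (- w))" if "j \<in> gens P" for j
    using droop that by (simp add: optimal_droop_def pM_def)
  have dc_eq: "dc j = saturate (dmin Q j) (dmax Q j) (inv (deriv (dcost Q j)) w)" for j
    using droop by (simp add: optimal_droop_def dc_def)
  have balance: "(\<Sum>j\<in>gens P. pM j) = (\<Sum>j\<in>UNIV. dc j + du j + pload P j)"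
  proof -
    have "net_inflow P z j = dc j + du j + pload P j - (if j \<in> gens P then pM j else 0)" for j
      using eq unfolding is_equilibrium_def w pM_def dc_def du_def by (cases "j \<in> gens P") force+
    moreover have "(\<Sum>j\<in>UNIV. net_inflow P z j) = 0"
      using net_inflow_weighted_sum[of "\<lambda>_. 1" P z] by (simp add: split_beta)
    ultimately have "(\<Sum>j\<in>UNIV. dc j + du j + pload P j) = (\<Sum>j\<in>UNIV. if j \<in> gens P then pM j else 0)"
      by (simp add: sum_subtractf)
    also have "\<dots> = (\<Sum>j\<in>gens P. pM j)"
      using sum.inter_restrict[of UNIV pM "gens P"] by simp
    finally show ?thesis by simp
  qed
  have feasible: "oslc_feasible P Q pM dc du"
    unfolding oslc_feasible_def using balance pM_eq dc_eq sat box by auto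
  have "oslc_cost P Q pM dc du \<le> oslc_cost P Q pM' dc' du'"
    if feas': "oslc_feasible P Q pM' dc' du'" for pM' dc' du'
  proof -
    have 1: "- w * (pM' j - pM j) \<le> gcost Q j (pM' j) - gcost Q j (pM j)" if "j \<in> gens P" for j
      by (rule saturated_response_optimal[OF _ _ _ box(1)[OF that] pM_eq[OF that]])
        (use reg droop feas' that in \<open>auto simp: cost_regularity_def optimal_droop_def oslc_feasible_def\<close>)
    have 2: "w * (dc' j - dc j) \<le> dcost Q j (dc' j) - dcost Q j (dc j)" for j
      by (rule saturated_response_optimal[OF _ _ _ box(2) dc_eq])
        (use reg droop feas' in \<open>auto simp: cost_regularity_def optimal_droop_def oslc_feasible_def\<close>)
    have 3: "w * (du' j - du j) \<le> (LBINT z=0..ereal (du' j). inv (du_response P j) z)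
        - (LBINT z=0..ereal (du j). inv (du_response P j) z)" for j
    proof -
      let ?g = "inv (du_response P j)"
      have bij: "bij (du_response P j)" and diff: "?g differentiable_on UNIV"
        using wf(2) by (auto simp: wf_oslc_def)
      have D: "(?g has_real_derivative deriv ?g y) (at y)" for y
        using diff by (simp add: differentiable_on_def DERIV_deriv_iff_real_differentiable)
      have nonneg: "0 \<le> deriv ?g y" for y
        using reg by (simp add: cost_regularity_def)
      have "mono ?g"
      proof (rule monoI)
        fix a b :: real assume "a \<le> b"
        then show "?g a \<le> ?g b"
        proof (rule DERIV_nonneg_imp_nondecreasing)
          show "\<exists>d. (?g has_real_derivative d) (at y) \<and> 0 \<le> d" for y
            using D[of y] nonneg[of y] by blast
        qed
      qed
      moreover have "continuous_on UNIV ?g"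
        using diff by (rule differentiable_imp_continuous_on)
      moreover have "?g (du j) = w"
        using bij by (simp add: du_def du_response_def[symmetric] bij_is_inj inv_f_f)
      ultimately show ?thesis using integral_of_mono_above_tangent[of ?g "du j" "du' j"] by simp
    qed
    have "(\<Sum>j\<in>gens P. - w * (pM' j - pM j)) + (\<Sum>j\<in>UNIV. w * (dc' j - dc j) + w * (du' j - du j))
       \<le> (\<Sum>j\<in>gens P. gcost Q j (pM' j) - gcost Q j (pM j))
         + (\<Sum>j\<in>UNIV. (dcost Q j (dc' j) - dcost Q j (dc j))
             + ((LBINT z=0..ereal (du' j). inv (du_response P j) z)
              - (LBINT z=0..ereal (du j). inv (du_response P j) z)))"
      by (intro add_mono sum_mono 1 2 3)
    also have "\<dots> = oslc_cost P Q pM' dc' du' - oslc_cost P Q pM dc du"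
      unfolding oslc_cost_def by (simp add: sum.distrib sum_subtractf)
    finally have "(\<Sum>j\<in>gens P. - w * (pM' j - pM j)) + (\<Sum>j\<in>UNIV. w * (dc' j - dc j) + w * (du' j - du j))
       \<le> oslc_cost P Q pM' dc' du' - oslc_cost P Q pM dc du" .
    moreover have "(\<Sum>j\<in>gens P. - w * (pM' j - pM j)) + (\<Sum>j\<in>UNIV. w * (dc' j - dc j) + w * (du' j - du j))
       = 0"
    proof -
      have "(\<Sum>j\<in>gens P. pM' j - pM j) = (\<Sum>j\<in>UNIV. (dc' j - dc j) + (du' j - du j))"
        using balance feas' by (simp add: oslc_feasible_def sum.distrib sum_subtractf)
      moreover have "(\<Sum>j\<in>gens P. - w * (pM' j - pM j)) = - w * (\<Sum>j\<in>gens P. pM' j - pM j)"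
        by (rule sum_distrib_left[symmetric])
      moreover have "(\<Sum>j\<in>UNIV. w * (dc' j - dc j) + w * (du' j - du j))
          = w * (\<Sum>j\<in>UNIV. (dc' j - dc j) + (du' j - du j))"
        unfolding sum_distrib_left by (simp only: distrib_left)
      ultimately show ?thesis by simp
    qed
    ultimately show ?thesis by simp
  qed
  with feasible have "oslc_minimizer P Q pM dc du" unfolding oslc_minimizer_def by blast
  then show ?thesis using eq unfolding optimal_equilibrium_def pM_def dc_def du_def w by simp
qed

section \<open>The network as a vector field on its state space\<close>

lemma has_vector_derivative_vecI:
  fixes f :: "real \<Rightarrow> 'v::real_normed_vector ^ 'n::finite"
  assumes "\<And>i. ((\<lambda>t. f t $ i) has_vector_derivative f' $ i) F"
  shows "(f has_vector_derivative f') F"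
  unfolding has_vector_derivative_def has_derivative_def
proof (intro conjI vec_tendstoI)
  show "bounded_linear (\<lambda>x. x *\<^sub>R f')" by (rule bounded_linear_scaleR_left)
  show "((\<lambda>y. ((f y - f (Lim F (\<lambda>x. x)) - (y - Lim F (\<lambda>x. x)) *\<^sub>R f') /\<^sub>R norm (y - Lim F (\<lambda>x. x))) $ i)
      \<longlongrightarrow> 0 $ i) F" for i
    using assms[of i] unfolding has_vector_derivative_def has_derivative_def by simp
qed

lemma bounded_linear_config:
  fixes i j :: "'n::finite"
  shows "bounded_linear (\<lambda>s :: ('n, 'a::real_normed_vector, 'b::real_normed_vector, 'c::real_normed_vector) config. eta s $ i $ j)"
    and "bounded_linear (\<lambda>s :: ('n, 'a, 'b, 'c) config. omega s $ j)"
    and "bounded_linear (\<lambda>s :: ('n, 'a, 'b, 'c) config. xM s $ j)"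
    and "bounded_linear (\<lambda>s :: ('n, 'a, 'b, 'c) config. xc s $ j)"
    and "bounded_linear (\<lambda>s :: ('n, 'a, 'b, 'c) config. xu s $ j)"
  unfolding eta_def omega_def xM_def xc_def xu_def
  by (intro bounded_linear_compose[OF bounded_linear_vec_nth] bounded_linear_compose[OF bounded_linear_fst]
      bounded_linear_compose[OF bounded_linear_snd] bounded_linear_fst bounded_linear_snd bounded_linear_ident)+

lemmas continuous_on_config =
  bounded_linear_config[THEN bounded_linear.continuous_on]
lemmas has_vector_derivative_config =
  bounded_linear_config[THEN bounded_linear.has_vector_derivative]
lemmas has_derivative_config = bounded_linear_config[THEN bounded_linear_imp_has_derivative]

lemma config_eqI:
  assumes "\<And>i j. eta y $ i $ j = eta z $ i $ j" "\<And>j. omega y $ j = omega z $ j"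
    "\<And>j. xM y $ j = xM z $ j" "\<And>j. xc y $ j = xc z $ j" "\<And>j. xu y $ j = xu z $ j"
  shows "y = z"
proof -
  have "eta y = eta z" "omega y = omega z" "xM y = xM z" "xc y = xc z" "xu y = xu z"
    using assms by (simp_all add: vec_eq_iff)
  then show ?thesis
    by (simp add: eta_def omega_def xM_def xc_def xu_def prod_eq_iff)
qed

lemma config_tendstoI:
  assumes "\<And>i j. ((\<lambda>t. eta (f t) $ i $ j) \<longlongrightarrow> eta z $ i $ j) F" "\<And>j. ((\<lambda>t. omega (f t) $ j) \<longlongrightarrow> omega z $ j) F"
    "\<And>j. ((\<lambda>t. xM (f t) $ j) \<longlongrightarrow> xM z $ j) F" "\<And>j. ((\<lambda>t. xc (f t) $ j) \<longlongrightarrow> xc z $ j) F"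
    "\<And>j. ((\<lambda>t. xu (f t) $ j) \<longlongrightarrow> xu z $ j) F"
  shows "(f \<longlongrightarrow> z) F"
proof -
  have "((\<lambda>t. (eta (f t), omega (f t), xM (f t), xc (f t), xu (f t))) \<longlongrightarrow>
      (eta z, omega z, xM z, xc z, xu z)) F"
    by (intro tendsto_Pair vec_tendstoI assms)
  then show ?thesis by (simp add: eta_def omega_def xM_def xc_def xu_def)
qed

lemma config_continuous_onI:
  assumes "\<And>i j. continuous_on A (\<lambda>t. eta (f t) $ i $ j)" "\<And>j. continuous_on A (\<lambda>t. omega (f t) $ j)"
    "\<And>j. continuous_on A (\<lambda>t. xM (f t) $ j)" "\<And>j. continuous_on A (\<lambda>t. xc (f t) $ j)"
    "\<And>j. continuous_on A (\<lambda>t. xu (f t) $ j)"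
  shows "continuous_on A f"
  using assms unfolding continuous_on_def by (auto intro!: config_tendstoI)

lemma config_has_vector_derivativeI:
  fixes f :: "real \<Rightarrow> ('n::finite, 'a::euclidean_space, 'b::euclidean_space, 'c::euclidean_space) config"
  assumes "\<And>i j. ((\<lambda>t. eta (f t) $ i $ j) has_vector_derivative eta f' $ i $ j) (at t within I)"
    "\<And>j. ((\<lambda>t. omega (f t) $ j) has_vector_derivative omega f' $ j) (at t within I)"
    "\<And>j. ((\<lambda>t. xM (f t) $ j) has_vector_derivative xM f' $ j) (at t within I)"
    "\<And>j. ((\<lambda>t. xc (f t) $ j) has_vector_derivative xc f' $ j) (at t within I)"
    "\<And>j. ((\<lambda>t. xu (f t) $ j) has_vector_derivative xu f' $ j) (at t within I)"
  shows "(f has_vector_derivative f') (at t within I)"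

proof -
  have "((\<lambda>t. (eta (f t), omega (f t), xM (f t), xc (f t), xu (f t))) has_vector_derivative
      (eta f', omega f', xM f', xc f', xu f')) (at t within I)"
    by (intro has_vector_derivative_Pair has_vector_derivative_vecI assms)
  then show ?thesis by (simp add: eta_def omega_def xM_def xc_def xu_def)
qed

lemma config_simps [simp]:
  "eta (e, w, a, b, c) = e" "omega (e, w, a, b, c) = w" "xM (e, w, a, b, c) = a"
  "xc (e, w, a, b, c) = b" "xu (e, w, a, b, c) = c"
  by (simp_all add: eta_def omega_def xM_def xc_def xu_def)

lemma state_of_simps [simp]:
  "eta (state_of P z) = eta z" "omega (state_of P z) $ j = (if j \<in> gens P then omega z $ j else 0)"
  "xM (state_of P z) = xM z" "xc (state_of P z) = xc z" "xu (state_of P z) = xu z"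
  by (simp_all add: state_of_def)

lemma config_arith [simp]:
  "eta (y + z) = eta y + eta z" "omega (y + z) = omega y + omega z" "xM (y + z) = xM y + xM z"
  "xc (y + z) = xc y + xc z" "xu (y + z) = xu y + xu z"
  "eta (r *\<^sub>R z) = r *\<^sub>R eta z" "omega (r *\<^sub>R z) = r *\<^sub>R omega z" "xM (r *\<^sub>R z) = r *\<^sub>R xM z"
  "xc (r *\<^sub>R z) = r *\<^sub>R xc z" "xu (r *\<^sub>R z) = r *\<^sub>R xu z"
  "eta 0 = 0" "omega 0 = 0" "xM 0 = 0" "xc 0 = 0" "xu 0 = 0"
  by (simp_all add: eta_def omega_def xM_def xc_def xu_def)

lemma state_space_components:
  assumes "s \<in> state_space P"
  shows "(i, j) \<notin> lines P \<Longrightarrow> eta s $ i $ j = 0" "j \<notin> gens P \<Longrightarrow> omega s $ j = 0"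
    "j \<in> gens P \<Longrightarrow> xM s $ j \<in> states (gen_sys P j)" "j \<notin> gens P \<Longrightarrow> xM s $ j = 0"
    "xc s $ j \<in> states (ctrl_sys P j)" "xu s $ j \<in> states (unctrl_sys P j)"
  using assms by (auto simp: state_space_def)

lemma subspace_state_space:
  assumes "wf_network P"
  shows "subspace (state_space P)"
proof -
  have sub: "j \<in> gens P \<Longrightarrow> subspace (states (gen_sys P j))" "subspace (states (ctrl_sys P j))"
     "subspace (states (unctrl_sys P j))" for j
    using assms by (auto simp: wf_network_def admissible_system_def)
  show ?thesis
  proof (rule subspaceI)
    show "0 \<in> state_space P"
      using sub by (auto simp: state_space_def subspace_0 intro!: exI[of _ "\<lambda>_. 0"])
  next
    fix y z assume yz: "y \<in> state_space P" "z \<in> state_space P"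
    then obtain \<theta> \<theta>' where "\<forall>(i, j)\<in>lines P. eta y $ i $ j = \<theta> i - \<theta> j" "\<forall>(i, j)\<in>lines P. eta z $ i $ j = \<theta>' i - \<theta>' j"
      unfolding state_space_def by blast
    then have "\<forall>(i, j)\<in>lines P. eta (y + z) $ i $ j = (\<theta> i + \<theta>' i) - (\<theta> j + \<theta>' j)" by fastforce
    then have "\<exists>\<theta>. \<forall>(i, j)\<in>lines P. eta (y + z) $ i $ j = \<theta> i - \<theta> j"
      by (intro exI[of _ "\<lambda>i. \<theta> i + \<theta>' i"])
    then show "y + z \<in> state_space P"
      using yz sub unfolding state_space_def by (auto simp: subspace_add)
  next
    fix r :: real and z assume z: "z \<in> state_space P"
    then obtain \<theta> where "\<forall>(i, j)\<in>lines P. eta z $ i $ j = \<theta> i - \<theta> j"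
      unfolding state_space_def by blast
    then have "\<forall>(i, j)\<in>lines P. eta (r *\<^sub>R z) $ i $ j = r * \<theta> i - r * \<theta> j"
      by (fastforce simp: right_diff_distrib)
    then have "\<exists>\<theta>. \<forall>(i, j)\<in>lines P. eta (r *\<^sub>R z) $ i $ j = \<theta> i - \<theta> j"
      by (intro exI[of _ "\<lambda>i. r * \<theta> i"])
    then show "r *\<^sub>R z \<in> state_space P"
      using z sub unfolding state_space_def by (auto simp: subspace_scale)
  qed
qed

text \<open>
  The net device output of a bus and its power balance, as functions of the state \<open>s\<close> and of the
  input \<open>u\<close> of the devices, which stands for the negated frequency.
\<close>

definition bus_out ::
  "('n::finite, 'a::euclidean_space, 'b::euclidean_space, 'c::euclidean_space) power_network
    \<Rightarrow> ('n, 'a, 'b, 'c) config \<Rightarrow> 'n \<Rightarrow> real \<Rightarrow> real" where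
  "bus_out P s j u = (if j \<in> gens P then outp (gen_sys P j) (xM s $ j) u else 0)
     - (outp (ctrl_sys P j) (xc s $ j) u + outp (unctrl_sys P j) (xu s $ j) u)"

definition bus_balance ::
  "('n::finite, 'a::euclidean_space, 'b::euclidean_space, 'c::euclidean_space) power_network
    \<Rightarrow> ('n, 'a, 'b, 'c) config \<Rightarrow> 'n \<Rightarrow> real \<Rightarrow> real" where
  "bus_balance P s j u = - pload P j + bus_out P s j u + net_inflow P s j"

lemma net_inflow_state_of [simp]: "net_inflow P (state_of P z) j = net_inflow P z j"
  by (simp add: net_inflow_def flow_def)

lemma bus_balance_state_of [simp]: "bus_balance P (state_of P z) j u = bus_balance P z j u"
  by (simp add: bus_balance_def bus_out_def)

lemma load_equations_iff:
  "load_equations P z \<longleftrightarrow> (\<forall>j. j \<notin> gens P \<longrightarrow> bus_balance P z j (- (omega z $ j)) = 0)"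
  by (auto simp: load_equations_def bus_balance_def bus_out_def dc_out_def du_out_def)

definition net_rate ::
  "('n::finite, 'a::euclidean_space, 'b::euclidean_space, 'c::euclidean_space) power_network
    \<Rightarrow> ('n, 'a, 'b, 'c) config \<Rightarrow> ('n, 'a, 'b, 'c) config" where
  "net_rate P z =
    ((\<chi> i j. if (i, j) \<in> lines P then omega z $ i - omega z $ j else 0),
     (\<chi> j. if j \<in> gens P then bus_balance P z j (- (omega z $ j)) / inertia P j else 0),
     (\<chi> j. if j \<in> gens P then rhs (gen_sys P j) (xM z $ j) (- (omega z $ j)) else 0),
     (\<chi> j. rhs (ctrl_sys P j) (xc z $ j) (- (omega z $ j))),
     (\<chi> j. rhs (unctrl_sys P j) (xu z $ j) (- (omega z $ j))))"

lemma net_rate_in_state_space: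
  assumes wf: "wf_network P" and z: "state_of P z \<in> state_space P"
  shows "net_rate P z \<in> state_space P"
proof -
  have "\<exists>\<theta>. \<forall>(i, j)\<in>lines P. eta (net_rate P z) $ i $ j = \<theta> i - \<theta> j"
    by (intro exI[of _ "\<lambda>i. omega z $ i"]) (auto simp: net_rate_def)
  moreover have "j \<in> gens P \<Longrightarrow> rhs (gen_sys P j) (xM z $ j) u \<in> states (gen_sys P j)"
    "rhs (ctrl_sys P j) (xc z $ j) u \<in> states (ctrl_sys P j)"
    "rhs (unctrl_sys P j) (xu z $ j) u \<in> states (unctrl_sys P j)" for j u
    using wf state_space_components[OF z] by (auto simp: wf_network_def admissible_system_def)
  ultimately show ?thesis unfolding state_space_def by (auto simp: net_rate_def)
qed

lemma solution_on_iff: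
  "solution_on P I z \<longleftrightarrow> (\<forall>t\<in>I. state_of P (z t) \<in> state_space P \<and> load_equations P (z t) \<and>
     ((\<lambda>s. state_of P (z s)) has_vector_derivative net_rate P (z t)) (at t within I))"
proof
  assume sol: "solution_on P I z"
  have "((\<lambda>s. state_of P (z s)) has_vector_derivative net_rate P (z t)) (at t within I)" if t: "t \<in> I" for t
  proof (rule config_has_vector_derivativeI)
    have mem: "state_of P (z s) \<in> state_space P" if "s \<in> I" for s
      using sol that by (simp add: solution_on_def)
    have zero: "(f has_vector_derivative 0) (at t within I)" if "\<And>s. s \<in> I \<Longrightarrow> f s = 0"
      for f :: "real \<Rightarrow> 'v::real_normed_vector"
      by (rule has_vector_derivative_transform[OF t _ has_vector_derivative_const[of 0]]) (use that in auto)
    show "((\<lambda>s. eta (state_of P (z s)) $ i $ j) has_vector_derivative eta (net_rate P (z t)) $ i $ j) (at t within I)" for i j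
    proof (cases "(i, j) \<in> lines P")
      case True
      then show ?thesis using sol t
        by (auto simp: solution_on_def net_rate_def has_real_derivative_iff_has_vector_derivative)
    next
      case False
      then show ?thesis using zero[of "\<lambda>s. eta (z s) $ i $ j"] state_space_components(1)[OF mem False]
        by (simp add: net_rate_def)
    qed
    show "((\<lambda>s. omega (state_of P (z s)) $ j) has_vector_derivative omega (net_rate P (z t)) $ j) (at t within I)" for j
    proof (cases "j \<in> gens P")
      case True
      then have "((\<lambda>s. omega (z s) $ j) has_real_derivative
          (- pload P j + pM_out P (z t) j - (dc_out P (z t) j + du_out P (z t) j) + net_inflow P (z t) j)
             / inertia P j) (at t within I)"
        using sol t by (simp add: solution_on_def)
      with True show ?thesis
        by (simp add: net_rate_def has_real_derivative_iff_has_vector_derivative bus_balance_def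
            bus_out_def pM_out_def dc_out_def du_out_def algebra_simps)
    qed (simp add: net_rate_def)
    show "((\<lambda>s. xM (state_of P (z s)) $ j) has_vector_derivative xM (net_rate P (z t)) $ j) (at t within I)" for j
    proof (cases "j \<in> gens P")
      case True
      then show ?thesis using sol t by (simp add: solution_on_def net_rate_def)
    next
      case False
      then show ?thesis using zero[of "\<lambda>s. xM (z s) $ j"] state_space_components(4)[OF mem False]
        by (simp add: net_rate_def)
    qed
    show "((\<lambda>s. xc (state_of P (z s)) $ j) has_vector_derivative xc (net_rate P (z t)) $ j) (at t within I)"
      "((\<lambda>s. xu (state_of P (z s)) $ j) has_vector_derivative xu (net_rate P (z t)) $ j) (at t within I)" for j
      using sol t by (simp_all add: solution_on_def net_rate_def)
  qed
  with sol show "\<forall>t\<in>I. state_of P (z t) \<in> state_space P \<and> load_equations P (z t) \<and>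
     ((\<lambda>s. state_of P (z s)) has_vector_derivative net_rate P (z t)) (at t within I)"
    by (simp add: solution_on_def)
next
  assume H: "\<forall>t\<in>I. state_of P (z t) \<in> state_space P \<and> load_equations P (z t) \<and>
     ((\<lambda>s. state_of P (z s)) has_vector_derivative net_rate P (z t)) (at t within I)"
  show "solution_on P I z"
    unfolding solution_on_def
  proof (intro ballI conjI allI)
    fix t assume "t \<in> I"
    with H have mem: "state_of P (z t) \<in> state_space P" and load: "load_equations P (z t)"
      and D: "((\<lambda>s. state_of P (z s)) has_vector_derivative net_rate P (z t)) (at t within I)" by auto
    show "state_of P (z t) \<in> state_space P" "load_equations P (z t)" by fact+
    show "case e of (i, j) \<Rightarrow> ((\<lambda>s. eta (z s) $ i $ j) has_real_derivative omega (z t) $ i - omega (z t) $ j) (at t within I)"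
      if "e \<in> lines P" for e
    proof -
      obtain i j where e: "e = (i, j)" by fastforce
      show ?thesis
        using has_vector_derivative_config(1)[OF D, of i j] that
        by (simp add: e net_rate_def has_real_derivative_iff_has_vector_derivative)
    qed
    show "((\<lambda>s. omega (z s) $ j) has_real_derivative
          (- pload P j + pM_out P (z t) j - (dc_out P (z t) j + du_out P (z t) j) + net_inflow P (z t) j)
             / inertia P j) (at t within I)" if "j \<in> gens P" for j
      using has_vector_derivative_config(2)[OF D, of j] that
      by (simp add: net_rate_def has_real_derivative_iff_has_vector_derivative bus_balance_def
            bus_out_def pM_out_def dc_out_def du_out_def algebra_simps)
    show "((\<lambda>s. xM (z s) $ j) has_vector_derivative rhs (gen_sys P j) (xM (z t) $ j) (- (omega (z t) $ j))) (at t within I)"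
      if "j \<in> gens P" for j
      using has_vector_derivative_config(3)[OF D, of j] that by (simp add: net_rate_def)
    show "((\<lambda>s. xc (z s) $ j) has_vector_derivative rhs (ctrl_sys P j) (xc (z t) $ j) (- (omega (z t) $ j))) (at t within I)"
      "((\<lambda>s. xu (z s) $ j) has_vector_derivative rhs (unctrl_sys P j) (xu (z t) $ j) (- (omega (z t) $ j))) (at t within I)" for j
      using has_vector_derivative_config(4)[OF D, of j] has_vector_derivative_config(5)[OF D, of j]
      by (simp_all add: net_rate_def)
  qed
qed

lemma admissible_rhs_continuous:
  assumes "admissible_system \<Sigma>"
  shows "continuous_on (states \<Sigma> \<times> UNIV) (\<lambda>(x, u). rhs \<Sigma> x u)"
  unfolding continuous_on_eq_continuous_within
proof
  fix q assume q: "q \<in> states \<Sigma> \<times> (UNIV :: real set)"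
  then obtain r L where r: "r > 0"
    "L-lipschitz_on (cball q r \<inter> states \<Sigma> \<times> UNIV) (\<lambda>(x, u). rhs \<Sigma> x u)"
    using assms unfolding admissible_system_def by blast
  have "continuous_on (cball q r \<inter> states \<Sigma> \<times> UNIV) (\<lambda>(x, u). rhs \<Sigma> x u)"
    using r(2) by (rule lipschitz_on_continuous_on)
  then have "continuous (at q within cball q r \<inter> states \<Sigma> \<times> UNIV) (\<lambda>(x, u). rhs \<Sigma> x u)"
    using q r(1) by (auto simp: continuous_on_eq_continuous_within)
  moreover have "at q within cball q r \<inter> states \<Sigma> \<times> UNIV = at q within states \<Sigma> \<times> UNIV"
    by (rule at_within_nhd[of q "ball q r"]) (use r(1) in auto)
  ultimately show "continuous (at q within states \<Sigma> \<times> UNIV) (\<lambda>(x, u). rhs \<Sigma> x u)"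
    by (simp add: continuous_within)
qed

lemma admissible_outp_continuous:
  assumes "admissible_system \<Sigma>"
  shows "continuous_on (states \<Sigma> \<times> UNIV) (\<lambda>(x, u). outp \<Sigma> x u)"
  using assms by (simp add: admissible_system_def)

lemma continuous_on_case_prod_compose:
  assumes "continuous_on (B \<times> UNIV) (\<lambda>(x, u). f x u)" "continuous_on A g" "continuous_on A h"
    and "\<And>a. a \<in> A \<Longrightarrow> g a \<in> B"
  shows "continuous_on A (\<lambda>a. f (g a) (h a))"
  using continuous_on_compose2[OF assms(1), of A "\<lambda>a. (g a, h a)"] assms(2-4)
  by (auto intro: continuous_on_Pair)

lemma bus_balance_continuous_on:
  fixes g :: "'d::metric_space \<Rightarrow> _"
  assumes wf: "wf_network P" and g: "continuous_on A g" "\<And>a. a \<in> A \<Longrightarrow> state_of P (g a) \<in> state_space P"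
    and h: "continuous_on A h"
  shows "continuous_on A (\<lambda>a. bus_balance P (g a) j (h a))"
proof -
  have adm: "j \<in> gens P \<Longrightarrow> admissible_system (gen_sys P j)" "admissible_system (ctrl_sys P j)"
     "admissible_system (unctrl_sys P j)"
    using wf by (auto simp: wf_network_def)
  have 1: "continuous_on A (\<lambda>a. if j \<in> gens P then outp (gen_sys P j) (xM (g a) $ j) (h a) else 0)"
  proof (cases "j \<in> gens P")
    case True
    then show ?thesis
      using continuous_on_case_prod_compose[OF admissible_outp_continuous[OF adm(1)], of A "\<lambda>a. xM (g a) $ j" h]
        continuous_on_config(3)[OF g(1)] h state_space_components(3)[OF g(2)]
      by simp
  qed simp
  have 2: "continuous_on A (\<lambda>a. outp (ctrl_sys P j) (xc (g a) $ j) (h a))"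
      "continuous_on A (\<lambda>a. outp (unctrl_sys P j) (xu (g a) $ j) (h a))"
    using continuous_on_case_prod_compose[OF admissible_outp_continuous[OF adm(2)], of A "\<lambda>a. xc (g a) $ j" h]
      continuous_on_case_prod_compose[OF admissible_outp_continuous[OF adm(3)], of A "\<lambda>a. xu (g a) $ j" h]
      continuous_on_config(4,5)[OF g(1)] h state_space_components(5,6)[OF g(2)] by simp_all
  show ?thesis
    unfolding bus_balance_def bus_out_def net_inflow_def flow_def
    by (intro continuous_on_add continuous_on_diff continuous_on_minus continuous_on_sum continuous_on_mult
        continuous_on_const 1 2 continuous_on_sin[OF continuous_on_config(1)[OF g(1)]])
qed

lemma net_rate_continuous_on:
  fixes g :: "'d::metric_space \<Rightarrow> _"
  assumes wf: "wf_network P" and g: "continuous_on A g" "\<And>a. a \<in> A \<Longrightarrow> state_of P (g a) \<in> state_space P"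
  shows "continuous_on A (\<lambda>a. net_rate P (g a))"
proof (rule config_continuous_onI)
  have adm: "j \<in> gens P \<Longrightarrow> admissible_system (gen_sys P j)" "admissible_system (ctrl_sys P j)"
     "admissible_system (unctrl_sys P j)" for j
    using wf by (auto simp: wf_network_def)
  have u: "continuous_on A (\<lambda>a. - (omega (g a) $ j))" for j
    by (intro continuous_intros continuous_on_config g)
  show "continuous_on A (\<lambda>a. eta (net_rate P (g a)) $ i $ j)" for i j
    by (cases "(i, j) \<in> lines P") (auto simp: net_rate_def intro!: continuous_intros continuous_on_config g)
  show "continuous_on A (\<lambda>a. omega (net_rate P (g a)) $ j)" for j
  proof (cases "j \<in> gens P")
    case True
    then have "inertia P j \<noteq> 0" using wf by (auto simp: wf_network_def)
    then show ?thesis using True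
      by (auto simp: net_rate_def intro!: continuous_on_divide continuous_on_const bus_balance_continuous_on wf g u)
  qed (simp add: net_rate_def)
  show "continuous_on A (\<lambda>a. xM (net_rate P (g a)) $ j)" for j
  proof (cases "j \<in> gens P")
    case True
    then show ?thesis
      using continuous_on_case_prod_compose[OF admissible_rhs_continuous[OF adm(1)[OF True]]
          continuous_on_config(3)[OF g(1)] u, of j j] state_space_components(3)[OF g(2)]
      by (simp add: net_rate_def)
  qed (simp add: net_rate_def)
  show "continuous_on A (\<lambda>a. xc (net_rate P (g a)) $ j)" "continuous_on A (\<lambda>a. xu (net_rate P (g a)) $ j)" for j
    using continuous_on_case_prod_compose[OF admissible_rhs_continuous[OF adm(2)]
        continuous_on_config(4)[OF g(1)] u, of j j j]
      continuous_on_case_prod_compose[OF admissible_rhs_continuous[OF adm(3)]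
        continuous_on_config(5)[OF g(1)] u, of j j j] state_space_components(5,6)[OF g(2)]
    by (simp_all add: net_rate_def)
qed

text \<open>
  On a compact range of values, the graph of a unique root is the zero set of a continuous
  function and hence closed.
\<close>

lemma unique_root_continuous_on:
  fixes g :: "'a::euclidean_space \<Rightarrow> real \<Rightarrow> real"
  assumes cont: "continuous_on (A \<times> {a..b}) (\<lambda>(x, u). g x u)"
    and root: "\<And>x. x \<in> A \<Longrightarrow> \<rho> x \<in> {a..b} \<and> g x (\<rho> x) = 0"
    and uniq: "\<And>x u. x \<in> A \<Longrightarrow> g x u = 0 \<Longrightarrow> u = \<rho> x"
  shows "continuous_on A \<rho>"
proof -
  have "closedin (top_of_set (A \<times> {a..b})) {q \<in> A \<times> {a..b}. (\<lambda>(x, u). g x u) q = 0}"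
    using cont by (rule continuous_closedin_preimage_constant)
  moreover have "{q \<in> A \<times> {a..b}. (\<lambda>(x, u). g x u) q = 0} = (\<lambda>x. (x, \<rho> x)) ` A"
    using root uniq by force
  ultimately show ?thesis
    using continuous_closed_graph_eq[of "{a..b}" \<rho> A] root by (auto simp: Pi_iff)
qed

section \<open>Passive equilibria: load frequencies and storage near the equilibrium\<close>

lemma state_char_is_equilibrium_point:
  assumes "admissible_system \<Sigma>"
  shows "is_equilibrium_point \<Sigma> u (state_char \<Sigma> u)"
    and "is_equilibrium_point \<Sigma> u x \<Longrightarrow> x = state_char \<Sigma> u"
proof -
  have ex1: "\<exists>!x. is_equilibrium_point \<Sigma> u x" using assms by (simp add: admissible_system_def)
  show "is_equilibrium_point \<Sigma> u (state_char \<Sigma> u)"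
    unfolding state_char_def by (rule theI'[OF ex1])
  with ex1 show "is_equilibrium_point \<Sigma> u x \<Longrightarrow> x = state_char \<Sigma> u" by blast
qed

lemma output_char_gen_bus_system:
  assumes "wf_network P" "j \<in> gens P"
  shows "output_char (gen_bus_system P j) u = output_char (gen_sys P j) u
    - (output_char (ctrl_sys P j) u + output_char (unctrl_sys P j) u)"
proof -
  have adm: "admissible_system (gen_sys P j)" "admissible_system (ctrl_sys P j)" "admissible_system (unctrl_sys P j)"
    using assms by (auto simp: wf_network_def)
  have "is_equilibrium_point (gen_bus_system P j) u q \<longleftrightarrow> is_equilibrium_point (gen_sys P j) u (fst q)
      \<and> is_equilibrium_point (ctrl_sys P j) u (fst (snd q)) \<and> is_equilibrium_point (unctrl_sys P j) u (snd (snd q))" for q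
    by (cases q) (auto simp: is_equilibrium_point_def gen_bus_system_def zero_prod_def)
  then have "is_equilibrium_point (gen_bus_system P j) u q \<longleftrightarrow>
      q = (state_char (gen_sys P j) u, state_char (ctrl_sys P j) u, state_char (unctrl_sys P j) u)" for q
    using adm[THEN state_char_is_equilibrium_point(1)] adm[THEN state_char_is_equilibrium_point(2)]
    by (metis prod.collapse fst_conv snd_conv)
  then have "state_char (gen_bus_system P j) u =
      (state_char (gen_sys P j) u, state_char (ctrl_sys P j) u, state_char (unctrl_sys P j) u)"
    by (simp add: state_char_def[of "gen_bus_system P j"])
  then show ?thesis
    by (simp add: output_char_def gen_bus_system_def)
qed

lemma output_char_load_bus_system:
  assumes "wf_network P"
  shows "output_char (load_bus_system P j) u
    = - (output_char (ctrl_sys P j) u + output_char (unctrl_sys P j) u)"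
proof -
  have adm: "admissible_system (ctrl_sys P j)" "admissible_system (unctrl_sys P j)"
    using assms by (auto simp: wf_network_def)
  have "is_equilibrium_point (load_bus_system P j) u q \<longleftrightarrow>
      is_equilibrium_point (ctrl_sys P j) u (fst q) \<and> is_equilibrium_point (unctrl_sys P j) u (snd q)" for q
    by (cases q) (auto simp: is_equilibrium_point_def load_bus_system_def zero_prod_def)
  then have "is_equilibrium_point (load_bus_system P j) u q \<longleftrightarrow>
      q = (state_char (ctrl_sys P j) u, state_char (unctrl_sys P j) u)" for q
    using adm[THEN state_char_is_equilibrium_point(1)] adm[THEN state_char_is_equilibrium_point(2)]
    by (metis prod.collapse fst_conv snd_conv)
  then have "state_char (load_bus_system P j) u = (state_char (ctrl_sys P j) u, state_char (unctrl_sys P j) u)"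
    by (simp add: state_char_def[of "load_bus_system P j"])
  then show ?thesis
    by (simp add: output_char_def load_bus_system_def)
qed

lemma eventually_vimage_open:
  fixes \<pi> :: "'s::real_normed_vector \<Rightarrow> 'x::real_normed_vector"
  assumes "bounded_linear \<pi>" "open X" "\<pi> p \<in> X"
  shows "\<forall>\<^sub>F s in nhds p. \<pi> s \<in> X"
proof -
  have "open (\<pi> -` X)"
    using assms(1,2) by (intro open_vimage) (auto intro: linear_continuous_on)
  then show ?thesis using eventually_nhds_in_open[of "\<pi> -` X" p] assms(3) by simp
qed

text \<open>
  A storage function of a subsystem becomes a function of the whole state by composition with a
  linear projection; this puts generation and load buses on the same footing.
\<close>

lemma passivity_along_projection:
  fixes \<pi> :: "'s::euclidean_space \<Rightarrow> 'x::euclidean_space"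
  assumes lin: "bounded_linear \<pi>" and im: "\<pi> ` S \<subseteq> states \<Sigma>"
    and passivity: "locally_input_strictly_passive_with \<Sigma> ub (\<pi> p) V"
  obtains U D \<phi> where "open U" "ub \<in> U" "\<And>z. z \<noteq> 0 \<Longrightarrow> \<phi> z > (0::real)" "\<phi> 0 = 0"
    "\<forall>\<^sub>F s in nhds p. s \<in> S \<longrightarrow> ((\<lambda>s. V (\<pi> s)) has_derivative D s) (at s within S) \<and>
       (\<forall>u\<in>U. \<forall>v. \<pi> v = rhs \<Sigma> (\<pi> s) u \<longrightarrow>
          D s v \<le> (u - ub) * (outp \<Sigma> (\<pi> s) u - output_char \<Sigma> ub) - \<phi> (u - ub))"
proof -
  obtain U X DV \<phi> where H: "open U \<and> ub \<in> U \<and> open X \<and> \<pi> p \<in> X \<and>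
        (\<forall>x\<in>X \<inter> states \<Sigma>. (V has_derivative (\<lambda>v. DV x \<bullet> v)) (at x within states \<Sigma>)) \<and>
        continuous_on (X \<inter> states \<Sigma>) DV \<and>
        V (\<pi> p) = 0 \<and> (\<forall>x\<in>X \<inter> states \<Sigma>. V x \<ge> 0) \<and>
        \<phi> 0 = (0::real) \<and> (\<forall>z. z \<noteq> 0 \<longrightarrow> \<phi> z > 0) \<and>
        (\<forall>u\<in>U. \<forall>x\<in>X \<inter> states \<Sigma>.
           DV x \<bullet> rhs \<Sigma> x u \<le> (u - ub) * (outp \<Sigma> x u - output_char \<Sigma> ub) - \<phi> (u - ub))"
    using passivity unfolding locally_input_strictly_passive_with_def by (elim exE) (rule that)
  have *: "open U" "ub \<in> U" "open X" "\<pi> p \<in> X" "\<phi> 0 = 0" "\<And>z. z \<noteq> 0 \<Longrightarrow> \<phi> z > 0"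
    using H by simp_all
  have D: "(V has_derivative (\<lambda>v. DV x \<bullet> v)) (at x within states \<Sigma>)" if "x \<in> X \<inter> states \<Sigma>" for x
    using H that by simp
  have diss: "DV x \<bullet> rhs \<Sigma> x u \<le> (u - ub) * (outp \<Sigma> x u - output_char \<Sigma> ub) - \<phi> (u - ub)"
    if "u \<in> U" "x \<in> X \<inter> states \<Sigma>" for u x
    using H that by simp
  have "\<forall>\<^sub>F s in nhds p. \<pi> s \<in> X" using lin *(3,4) by (rule eventually_vimage_open)
  then have "\<forall>\<^sub>F s in nhds p. s \<in> S \<longrightarrow>
      ((\<lambda>s. V (\<pi> s)) has_derivative (\<lambda>v. DV (\<pi> s) \<bullet> \<pi> v)) (at s within S) \<and>
       (\<forall>u\<in>U. \<forall>v. \<pi> v = rhs \<Sigma> (\<pi> s) u \<longrightarrow>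
          DV (\<pi> s) \<bullet> \<pi> v \<le> (u - ub) * (outp \<Sigma> (\<pi> s) u - output_char \<Sigma> ub) - \<phi> (u - ub))"
  proof eventually_elim
    case (elim s)
    have "((\<lambda>s. V (\<pi> s)) has_derivative (\<lambda>v. DV (\<pi> s) \<bullet> \<pi> v)) (at s within S)" if "s \<in> S"
    proof -
      have x: "\<pi> s \<in> X \<inter> states \<Sigma>" using elim that im by auto
      have "(V has_derivative (\<lambda>v. DV (\<pi> s) \<bullet> v)) (at (\<pi> s) within \<pi> ` S)"
        using D[OF x] im by (rule has_derivative_subset)
      then show ?thesis
        using has_derivative_in_compose[OF bounded_linear_imp_has_derivative[OF lin]] by blast
    qed
    then show ?case using elim im diss by auto
  qed
  note ev = this
  show thesis by (rule that[of U \<phi> "\<lambda>s v. DV (\<pi> s) \<bullet> \<pi> v", OF *(1,2) *(6) *(5) ev])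
qed

text \<open>Restriction to a line reduces this to one variable; only directions in the subspace count.\<close>

lemma derivative_zero_at_minimum_on_subspace:
  fixes S :: "'s::real_normed_vector set"
  assumes "subspace S" "p \<in> S" "v \<in> S" and D: "(V has_derivative D) (at p within S)"
    and min: "\<forall>\<^sub>F s in nhds p. s \<in> S \<longrightarrow> (V p :: real) \<le> V s"
  shows "D v = 0"
proof -
  let ?l = "\<lambda>t::real. p + t *\<^sub>R v"
  have lS: "range ?l \<subseteq> S" using assms(1-3) by (auto intro: subspace_add subspace_scale)
  have "(?l has_derivative (\<lambda>t. t *\<^sub>R v)) (at 0 within UNIV)"
    by (auto intro!: derivative_eq_intros)
  moreover have "(V has_derivative D) (at (?l 0) within range ?l)"
    using D lS by (auto intro: has_derivative_subset)
  ultimately have "((\<lambda>t. V (?l t)) has_derivative (\<lambda>t. D (t *\<^sub>R v))) (at 0 within UNIV)"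
    by (rule has_derivative_in_compose)
  then have d: "((\<lambda>t. V (?l t)) has_real_derivative D v) (at 0)"
    using has_derivative_linear[OF D]
    by (simp add: has_field_derivative_def linear_cmul mult.commute[of _ "D v"])
  obtain e where e: "e > 0" "\<And>s. dist s p < e \<Longrightarrow> s \<in> S \<Longrightarrow> V p \<le> V s"
    using min unfolding eventually_nhds_metric by blast
  show ?thesis
  proof (rule DERIV_local_min[OF d])
    show "e / (norm v + 1) > 0" using e(1) by (simp add: add_nonneg_pos)
    show "\<forall>y. \<bar>0 - y\<bar> < e / (norm v + 1) \<longrightarrow> V (?l 0) \<le> V (?l y)"
    proof (intro allI impI)
      fix y :: real assume y: "\<bar>0 - y\<bar> < e / (norm v + 1)"
      have "\<bar>y\<bar> * norm v \<le> \<bar>y\<bar> * (norm v + 1)" by (simp add: mult_left_mono)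
      also have "\<dots> < e" using y by (simp add: pos_less_divide_eq add_nonneg_pos)
      finally show "V (?l 0) \<le> V (?l y)" using e(2)[of "?l y"] lS by (auto simp: dist_norm)
    qed
  qed
qed

lemma eventually_pos_within:
  fixes f :: "'s::topological_space \<Rightarrow> real"
  assumes "continuous_on S f" "p \<in> S" "f p > 0"
  shows "\<forall>\<^sub>F s in nhds p. s \<in> S \<longrightarrow> f s > 0"
proof -
  have "(f \<longlongrightarrow> f p) (at p within S)" using assms by (simp add: continuous_on_def)
  then have "\<forall>\<^sub>F s in at p within S. f s > 0" using assms(3) by (rule order_tendstoD)
  then show ?thesis unfolding eventually_at_filter by eventually_elim (use assms(3) in auto)
qed

locale passive_network_equilibrium =
  fixes P :: "('n::finite, 'a::euclidean_space, 'b::euclidean_space, 'c::euclidean_space) power_network"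
    and zs :: "('n, 'a, 'b, 'c) config"
    and VG :: "'n \<Rightarrow> 'a \<times> 'b \<times> 'c \<Rightarrow> real"
    and VL :: "'n \<Rightarrow> 'b \<times> 'c \<Rightarrow> real"
    and S :: "('n, 'a, 'b, 'c) config set" and p :: "('n, 'a, 'b, 'c) config" and us :: "'n \<Rightarrow> real"
  defines "S \<equiv> state_space P" and "p \<equiv> state_of P zs" and "us \<equiv> \<lambda>j. - (omega zs $ j)"
  assumes wf: "wf_network P" and equilibrium: "is_equilibrium P zs" and secure: "angle_security P zs"
    and passivity: "passive_buses P zs VG VL" and minima: "strict_storage_minima P zs VG VL"
    and unique: "unique_load_frequencies P zs"
begin

lemma subspace_S: "subspace S"
  unfolding S_def using wf by (rule subspace_state_space)

lemma p_in_S: "p \<in> S"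
  using equilibrium by (simp add: is_equilibrium_def S_def p_def)

lemma admissible:
  "j \<in> gens P \<Longrightarrow> admissible_system (gen_sys P j)" "admissible_system (ctrl_sys P j)"
  "admissible_system (unctrl_sys P j)"
  using wf by (auto simp: wf_network_def)

lemma p_components:
  "j \<in> gens P \<Longrightarrow> xM p $ j = state_char (gen_sys P j) (us j)"
  "xc p $ j = state_char (ctrl_sys P j) (us j)" "xu p $ j = state_char (unctrl_sys P j) (us j)"
  "eta p = eta zs" "j \<in> gens P \<Longrightarrow> omega p $ j = omega zs $ j"
  using equilibrium by (auto simp: is_equilibrium_def p_def us_def)

lemma bus_out_p:
  "bus_out P p j (us j) = (if j \<in> gens P then output_char (gen_bus_system P j) (us j)
     else output_char (load_bus_system P j) (us j))"
  using wf by (auto simp: bus_out_def p_components output_char_gen_bus_system output_char_load_bus_system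
      output_char_def[of "gen_sys P j"] output_char_def[of "ctrl_sys P j"] output_char_def[of "unctrl_sys P j"])

lemma bus_balance_p: "bus_balance P p j (us j) = 0"
proof -
  have "net_inflow P p j = net_inflow P zs j" by (simp add: p_def)
  then show ?thesis
    using equilibrium wf unfolding us_def
    by (cases "j \<in> gens P") (auto simp: bus_balance_def bus_out_p[unfolded us_def] is_equilibrium_def
      output_char_gen_bus_system output_char_load_bus_system)
qed

definition storage :: "'n \<Rightarrow> ('n, 'a, 'b, 'c) config \<Rightarrow> real" where
  "storage j s = (if j \<in> gens P then VG j (xM s $ j, xc s $ j, xu s $ j) else VL j (xc s $ j, xu s $ j))"

definition device_rates :: "'n \<Rightarrow> ('n, 'a, 'b, 'c) config \<Rightarrow> real \<Rightarrow> ('n, 'a, 'b, 'c) config \<Rightarrow> bool" where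
  "device_rates j s u v \<longleftrightarrow> (j \<in> gens P \<longrightarrow> xM v $ j = rhs (gen_sys P j) (xM s $ j) u) \<and>
     xc v $ j = rhs (ctrl_sys P j) (xc s $ j) u \<and> xu v $ j = rhs (unctrl_sys P j) (xu s $ j) u"

definition devices_at_rest :: "'n \<Rightarrow> ('n, 'a, 'b, 'c) config \<Rightarrow> bool" where
  "devices_at_rest j s \<longleftrightarrow> (j \<in> gens P \<longrightarrow> xM s $ j = xM p $ j) \<and> xc s $ j = xc p $ j \<and> xu s $ j = xu p $ j"

lemma bus_passivity:
  obtains U D \<phi> where "open U" "us j \<in> U" "\<And>z. z \<noteq> 0 \<Longrightarrow> \<phi> z > (0::real)" "\<phi> 0 = 0"
    "\<forall>\<^sub>F s in nhds p. s \<in> S \<longrightarrow> (storage j has_derivative D s) (at s within S) \<and>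
       (\<forall>u\<in>U. \<forall>v. device_rates j s u v \<longrightarrow>
          D s v \<le> (u - us j) * (bus_out P s j u - bus_out P p j (us j)) - \<phi> (u - us j))"
proof (cases "j \<in> gens P")
  case True
  let ?\<pi> = "\<lambda>s :: ('n, 'a, 'b, 'c) config. (xM s $ j, xc s $ j, xu s $ j)"
  have lin: "bounded_linear ?\<pi>" by (intro bounded_linear_Pair bounded_linear_config)
  have im: "?\<pi> ` S \<subseteq> states (gen_bus_system P j)"
  proof (rule image_subsetI)
    fix s assume "s \<in> S"
    then show "?\<pi> s \<in> states (gen_bus_system P j)"
      using state_space_components[of s P] True by (simp add: S_def gen_bus_system_def)
  qed
  have pas: "locally_input_strictly_passive_with (gen_bus_system P j) (us j) (?\<pi> p) (VG j)"
    using passivity True by (auto simp: passive_buses_def us_def p_def)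
  obtain U D \<phi> where
    *: "open U" "us j \<in> U" "\<And>z. z \<noteq> 0 \<Longrightarrow> \<phi> z > (0::real)" "\<phi> 0 = 0"
    "\<forall>\<^sub>F s in nhds p. s \<in> S \<longrightarrow> ((\<lambda>s. VG j (?\<pi> s)) has_derivative D s) (at s within S) \<and>
       (\<forall>u\<in>U. \<forall>v. ?\<pi> v = rhs (gen_bus_system P j) (?\<pi> s) u \<longrightarrow>
          D s v \<le> (u - us j) * (outp (gen_bus_system P j) (?\<pi> s) u - output_char (gen_bus_system P j) (us j)) - \<phi> (u - us j))"
    by (rule passivity_along_projection[OF lin im pas]) (rule that)
  moreover have "storage j = (\<lambda>s. VG j (?\<pi> s))" using True by (simp add: storage_def fun_eq_iff)
  ultimately show ?thesis
    using that[of U \<phi> D] True bus_out_p[of j]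
    by (simp add: device_rates_def gen_bus_system_def bus_out_def)
next
  case False
  let ?\<pi> = "\<lambda>s :: ('n, 'a, 'b, 'c) config. (xc s $ j, xu s $ j)"
  have lin: "bounded_linear ?\<pi>" by (intro bounded_linear_Pair bounded_linear_config)
  have im: "?\<pi> ` S \<subseteq> states (load_bus_system P j)"
  proof (rule image_subsetI)
    fix s assume "s \<in> S"
    then show "?\<pi> s \<in> states (load_bus_system P j)"
      using state_space_components[of s P] by (simp add: S_def load_bus_system_def)
  qed
  have pas: "locally_input_strictly_passive_with (load_bus_system P j) (us j) (?\<pi> p) (VL j)"
    using passivity False by (auto simp: passive_buses_def us_def p_def)
  obtain U D \<phi> where
    *: "open U" "us j \<in> U" "\<And>z. z \<noteq> 0 \<Longrightarrow> \<phi> z > (0::real)" "\<phi> 0 = 0"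
    "\<forall>\<^sub>F s in nhds p. s \<in> S \<longrightarrow> ((\<lambda>s. VL j (?\<pi> s)) has_derivative D s) (at s within S) \<and>
       (\<forall>u\<in>U. \<forall>v. ?\<pi> v = rhs (load_bus_system P j) (?\<pi> s) u \<longrightarrow>
          D s v \<le> (u - us j) * (outp (load_bus_system P j) (?\<pi> s) u - output_char (load_bus_system P j) (us j)) - \<phi> (u - us j))"
    by (rule passivity_along_projection[OF lin im pas]) (rule that)
  moreover have "storage j = (\<lambda>s. VL j (?\<pi> s))" using False by (simp add: storage_def fun_eq_iff)
  ultimately show ?thesis
    using that[of U \<phi> D] False bus_out_p[of j]
    by (simp add: device_rates_def load_bus_system_def bus_out_def)
qed

lemma storage_p: "storage j p = 0"
  using passivity by (auto simp: storage_def p_def passive_buses_def locally_input_strictly_passive_with_def)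

lemma storage_positive:
  "\<forall>\<^sub>F s in nhds p. s \<in> S \<longrightarrow> 0 \<le> storage j s \<and> (storage j s = 0 \<longrightarrow> devices_at_rest j s)"
proof (cases "j \<in> gens P")
  case True
  let ?\<pi> = "\<lambda>s :: ('n, 'a, 'b, 'c) config. (xM s $ j, xc s $ j, xu s $ j)"
  have "strict_local_min_on (states (gen_bus_system P j)) (VG j) (?\<pi> p)"
    using minima True by (simp add: strict_storage_minima_def p_def)
  then obtain X where X: "open X" "?\<pi> p \<in> X" "\<And>x. x \<in> X \<inter> states (gen_bus_system P j) \<Longrightarrow> x \<noteq> ?\<pi> p \<Longrightarrow> VG j (?\<pi> p) < VG j x"
    unfolding strict_local_min_on_def by blast
  have "\<forall>\<^sub>F s in nhds p. ?\<pi> s \<in> X"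
    by (rule eventually_vimage_open) (intro bounded_linear_Pair bounded_linear_config X(1,2))+
  then show ?thesis
  proof eventually_elim
    case (elim s)
    have pos: "VG j (?\<pi> s) > 0" if "s \<in> S" "?\<pi> s \<noteq> ?\<pi> p"
      using X(3)[of "?\<pi> s"] elim that True storage_p[of j] 
      by (auto simp: storage_def S_def gen_bus_system_def state_space_components)
    show ?case
    proof (cases "?\<pi> s = ?\<pi> p")
      case eq: True
      then show ?thesis using \<open>j \<in> gens P\<close> storage_p[of j] by (auto simp: storage_def devices_at_rest_def)
    next
      case neq: False
      have "storage j s > 0" if "s \<in> S"
        using pos[OF that neq] \<open>j \<in> gens P\<close> by (simp add: storage_def)
      then show ?thesis by auto
    qed
  qed
next
  case False
  let ?\<pi> = "\<lambda>s :: ('n, 'a, 'b, 'c) config. (xc s $ j, xu s $ j)"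
  have "strict_local_min_on (states (load_bus_system P j)) (VL j) (?\<pi> p)"
    using minima False by (simp add: strict_storage_minima_def p_def)
  then obtain X where X: "open X" "?\<pi> p \<in> X" "\<And>x. x \<in> X \<inter> states (load_bus_system P j) \<Longrightarrow> x \<noteq> ?\<pi> p \<Longrightarrow> VL j (?\<pi> p) < VL j x"
    unfolding strict_local_min_on_def by blast
  have "\<forall>\<^sub>F s in nhds p. ?\<pi> s \<in> X"
    by (rule eventually_vimage_open) (intro bounded_linear_Pair bounded_linear_config X(1,2))+
  then show ?thesis
  proof eventually_elim
    case (elim s)
    have pos: "VL j (?\<pi> s) > 0" if "s \<in> S" "?\<pi> s \<noteq> ?\<pi> p"
      using X(3)[of "?\<pi> s"] elim that False storage_p[of j] 
      by (auto simp: storage_def S_def load_bus_system_def state_space_components)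
    show ?case
    proof (cases "?\<pi> s = ?\<pi> p")
      case eq: True
      then show ?thesis using \<open>j \<notin> gens P\<close> storage_p[of j] by (auto simp: storage_def devices_at_rest_def)
    next
      case neq: False
      have "storage j s > 0" if "s \<in> S"
        using pos[OF that neq] \<open>j \<notin> gens P\<close> by (simp add: storage_def)
      then show ?thesis by auto
    qed
  qed
qed

text \<open>
  At the equilibrium state the storage function is stationary, so the left-hand side of the
  passivity inequality vanishes there.  Hence the output, with the state held fixed, deviates from
  its equilibrium value in the same direction as the input.
\<close>

lemma bus_out_sign:
  obtains \<epsilon> where "\<epsilon> > 0" "\<And>u. u \<noteq> us j \<Longrightarrow> \<bar>u - us j\<bar> \<le> \<epsilon> \<Longrightarrow>
    (u - us j) * (bus_out P p j u - bus_out P p j (us j)) > 0"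
proof -
  obtain U D \<phi> where *: "open U" "us j \<in> U" "\<And>z. z \<noteq> 0 \<Longrightarrow> \<phi> z > (0::real)" "\<phi> 0 = 0"
    "\<forall>\<^sub>F s in nhds p. s \<in> S \<longrightarrow> (storage j has_derivative D s) (at s within S) \<and>
       (\<forall>u\<in>U. \<forall>v. device_rates j s u v \<longrightarrow>
          D s v \<le> (u - us j) * (bus_out P s j u - bus_out P p j (us j)) - \<phi> (u - us j))"
    by (rule bus_passivity[of j]) (rule that)
  have at_p: "(storage j has_derivative D p) (at p within S)"
       "\<And>u v. u \<in> U \<Longrightarrow> device_rates j p u v \<Longrightarrow>
          D p v \<le> (u - us j) * (bus_out P p j u - bus_out P p j (us j)) - \<phi> (u - us j)"
    using eventually_nhds_x_imp_x[OF *(5)] p_in_S by auto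
  have min: "\<forall>\<^sub>F s in nhds p. s \<in> S \<longrightarrow> storage j p \<le> storage j s"
    using storage_positive[of j] by eventually_elim (simp add: storage_p)
  obtain \<epsilon> where \<epsilon>: "\<epsilon> > 0" "cball (us j) \<epsilon> \<subseteq> U"
    using *(1,2) open_contains_cball by blast
  have "(u - us j) * (bus_out P p j u - bus_out P p j (us j)) > 0" if "u \<noteq> us j" "\<bar>u - us j\<bar> \<le> \<epsilon>" for u
  proof -
    have u: "u \<in> U" using that \<epsilon>(2) by (auto simp: dist_real_def)
    \<comment> \<open>the device rates for the input \<open>u\<close>, as a tangent vector with angles and frequencies frozen\<close>
    define v :: "('n, 'a, 'b, 'c) config" where "v = (0, 0,
       (\<chi> i. if i \<in> gens P then rhs (gen_sys P i) (xM p $ i) u else 0),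
       (\<chi> i. rhs (ctrl_sys P i) (xc p $ i) u), (\<chi> i. rhs (unctrl_sys P i) (xu p $ i) u))"
    have "v \<in> S"
      using admissible state_space_components[OF p_in_S[unfolded S_def]]
      by (auto simp: v_def S_def state_space_def admissible_system_def intro!: exI[of _ "\<lambda>_. 0"])
    then have "D p v = 0"
      using subspace_S p_in_S at_p(1) min by (intro derivative_zero_at_minimum_on_subspace)
    moreover have "device_rates j p u v" by (simp add: device_rates_def v_def)
    ultimately have "\<phi> (u - us j) \<le> (u - us j) * (bus_out P p j u - bus_out P p j (us j))"
      using at_p(2)[OF u] by fastforce
    with *(3)[of "u - us j"] that(1) show ?thesis by simp
  qed
  with \<epsilon>(1) show thesis using that by blast
qed

text \<open>
  The load buses decouple: changing one load frequency of a solution of the load equations to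
  another root of its bus gives a second solution.
\<close>

lemma load_root_unique:
  assumes "\<exists>!y. state_of P y = s \<and> load_equations P y" "state_of P y = s" "load_equations P y"
    and j: "j \<notin> gens P" and "bus_balance P s j u = 0"
  shows "u = - (omega y $ j)"
proof -
  define y' where "y' = (eta y, (\<chi> i. if i = j then - u else omega y $ i), xM y, xc y, xu y)"
  have s': "state_of P y' = s"
    unfolding assms(2)[symmetric] by (rule config_eqI) (use j in \<open>auto simp: y'_def\<close>)
  have "bus_balance P y' i w = bus_balance P s i w" "bus_balance P y i w = bus_balance P s i w" for i w
    unfolding s'[symmetric] using assms(2) s' bus_balance_state_of by metis+
  then have "load_equations P y'"
    using assms(3,5) unfolding load_equations_iff by (auto simp: y'_def)
  with s' assms(1-3) have "y' = y" by blast
  then have "omega y' $ j = omega y $ j" by simp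
  then show ?thesis by (simp add: y'_def)
qed

lemma load_frequencies_exist:
  "\<forall>\<^sub>F s in nhds p. s \<in> S \<longrightarrow> (\<exists>!y. state_of P y = s \<and> load_equations P y)"
proof -
  obtain T where T: "open T" "p \<in> T" "\<forall>s\<in>T \<inter> S. \<exists>!y. state_of P y = s \<and> load_equations P y"
    using unique unfolding unique_load_frequencies_def S_def[symmetric] p_def[symmetric] by (elim exE conjE) (rule that)
  show ?thesis
  proof (rule eventually_mono[OF eventually_nhds_in_open[OF T(1,2)]], rule impI)
    fix s assume "s \<in> T" "s \<in> S"
    then show "\<exists>!y. state_of P y = s \<and> load_equations P y" by (intro bspec[OF T(3)]) simp
  qed
qed

text \<open>
  The balance of a load bus changes sign across the equilibrium input, at \<open>p\<close> and hence at all
  nearby states.  The intermediate value theorem gives a root near the equilibrium input, and by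
  uniqueness this root is the load frequency.
\<close>

lemma frequencies_near:
  assumes "\<epsilon> > 0"
  shows "\<forall>\<^sub>F s in nhds p. s \<in> S \<longrightarrow>
    (\<forall>y. state_of P y = s \<and> load_equations P y \<longrightarrow> \<bar>- (omega y $ j) - us j\<bar> \<le> \<epsilon>)"
proof (cases "j \<in> gens P")
  case True
  have "\<forall>\<^sub>F s in nhds p. omega s $ j \<in> ball (omega p $ j) \<epsilon>"
    by (rule eventually_vimage_open) (use assms in \<open>auto intro: bounded_linear_config\<close>)
  then show ?thesis
  proof eventually_elim
    case (elim s)
    show ?case
    proof (intro impI allI)
      fix y assume "state_of P y = s \<and> load_equations P y"
      then have "omega s $ j = omega y $ j" using True by auto
      with elim show "\<bar>- (omega y $ j) - us j\<bar> \<le> \<epsilon>"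
        using True by (simp add: p_components us_def dist_real_def)
    qed
  qed
next
  case False
  obtain \<epsilon>' where \<epsilon>': "\<epsilon>' > 0" "\<And>u. u \<noteq> us j \<Longrightarrow> \<bar>u - us j\<bar> \<le> \<epsilon>' \<Longrightarrow>
    (u - us j) * (bus_out P p j u - bus_out P p j (us j)) > 0"
    using bus_out_sign by blast
  define e where "e = min \<epsilon> \<epsilon>'"
  have e: "e > 0" "e \<le> \<epsilon>" "e \<le> \<epsilon>'" using assms \<epsilon>'(1) by (auto simp: e_def)
  have bal: "bus_balance P p j u = bus_out P p j u - bus_out P p j (us j)" for u
    using bus_balance_p[of j] by (simp add: bus_balance_def)
  have state: "state_of P s = s" if "s \<in> S" for s
    by (rule config_eqI) (use that state_space_components(2)[of s P] in \<open>auto simp: S_def\<close>)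
  have cont: "continuous_on S (\<lambda>s. bus_balance P s j u)" for u
    by (rule bus_balance_continuous_on[OF wf continuous_on_id]) (use state in \<open>auto simp: S_def\<close>)
  have hi: "bus_balance P p j (us j + e) > 0"
    unfolding bal using \<epsilon>'(2)[of "us j + e"] e by (simp add: zero_less_mult_iff)
  have lo: "- bus_balance P p j (us j - e) > 0"
    unfolding bal using \<epsilon>'(2)[of "us j - e"] e by (simp add: mult_less_0_iff)
  have "\<forall>\<^sub>F s in nhds p. s \<in> S \<longrightarrow> bus_balance P s j (us j + e) > 0"
    using cont p_in_S hi by (rule eventually_pos_within)
  moreover have "\<forall>\<^sub>F s in nhds p. s \<in> S \<longrightarrow> - bus_balance P s j (us j - e) > 0"
    using continuous_on_minus[OF cont] p_in_S lo by (rule eventually_pos_within)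
  ultimately show ?thesis using load_frequencies_exist
  proof eventually_elim
    case (elim s)
    show ?case
    proof (intro impI allI)
      fix y assume s: "s \<in> S" and y: "state_of P y = s \<and> load_equations P y"
      have "continuous_on {us j - e..us j + e} (\<lambda>u. bus_balance P s j u)"
        by (rule bus_balance_continuous_on[OF wf continuous_on_const _ continuous_on_id])
          (use s state in \<open>auto simp: S_def\<close>)
      then obtain u where u: "us j - e \<le> u" "u \<le> us j + e" "bus_balance P s j u = 0"
        using IVT'[of "bus_balance P s j" "us j - e" 0 "us j + e"] elim s e(1) by auto
      have "u = - (omega y $ j)"
        using elim(3) s y False u(3) by (intro load_root_unique) auto
      with u e(2) show "\<bar>- (omega y $ j) - us j\<bar> \<le> \<epsilon>" by auto
    qed
  qed
qed

lemma lines_secure: "\<forall>\<^sub>F s in nhds p. \<forall>(i, j)\<in>lines P. \<bar>eta s $ i $ j\<bar> < pi / 2"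
proof -
  have "\<forall>\<^sub>F s in nhds p. \<bar>eta s $ i $ j\<bar> < pi / 2" if "(i, j) \<in> lines P" for i j
  proof -
    have "\<forall>\<^sub>F s in nhds p. eta s $ i $ j \<in> ball 0 (pi / 2)"
      by (rule eventually_vimage_open)
        (use secure that in \<open>auto simp: angle_security_def p_components intro: bounded_linear_config\<close>)
    then show ?thesis by (simp add: dist_real_def)
  qed
  then show ?thesis by (intro eventually_ball_finite) auto
qed

lemma attracted_along_projection:
  fixes \<pi> :: "('n, 'a, 'b, 'c) config \<Rightarrow> 'x::euclidean_space"
  assumes "admissible_system \<Sigma>" "bounded_linear \<pi>" "\<pi> p = state_char \<Sigma> u"
  shows "\<forall>\<^sub>F s in nhds p. \<forall>x. constant_input_solution \<Sigma> u {0..} x \<and> x 0 = \<pi> s \<longrightarrow> (x \<longlongrightarrow> \<pi> p) at_top"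
proof -
  have "locally_asymptotically_stable \<Sigma> u (\<pi> p)"
    using assms(1,3) state_char_is_equilibrium_point[OF assms(1)] by (simp add: admissible_system_def)
  then obtain \<delta> where \<delta>: "\<delta> > 0"
    "\<And>x. constant_input_solution \<Sigma> u {0..} x \<Longrightarrow> dist (x 0) (\<pi> p) < \<delta> \<Longrightarrow> (x \<longlongrightarrow> \<pi> p) at_top"
    unfolding locally_asymptotically_stable_def by blast
  have "\<forall>\<^sub>F s in nhds p. \<pi> s \<in> ball (\<pi> p) \<delta>"
    using \<delta>(1) by (intro eventually_vimage_open assms) auto
  then show ?thesis
    by eventually_elim (use \<delta>(2) in \<open>auto simp: dist_commute\<close>)
qed

end

section \<open>The energy of the network as a Lyapunov function\<close>

text \<open>
  The Bregman distance of \<open>- cos\<close>, which is strictly convex where the sine is strictly increasing.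
\<close>

lemma cos_gap:
  assumes "\<bar>a\<bar> < pi / 2" "\<bar>b\<bar> < pi / 2"
  shows "0 \<le> cos a - cos b - (b - a) * sin a"
    and "cos a - cos b - (b - a) * sin a = 0 \<Longrightarrow> b = a"
proof -
  let ?f = "\<lambda>x. cos a - cos x - (x - a) * sin a"
  have D: "(?f has_real_derivative (sin x - sin a)) (at x)" for x
    by (auto intro!: derivative_eq_intros)
  have pos: "?f b > 0" if "b \<noteq> a"
  proof (cases "a < b")
    case True
    then obtain x where x: "a < x" "x < b" "?f b - ?f a = (b - a) * (sin x - sin a)"
      using MVT2[of a b ?f "\<lambda>x. sin x - sin a"] D by auto
    moreover have "sin a < sin x" using assms x by (intro sin_monotone_2pi) auto
    ultimately show ?thesis using True by simp
  next
    case False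
    with that have "b < a" by simp
    then obtain x where x: "b < x" "x < a" "?f a - ?f b = (a - b) * (sin x - sin a)"
      using MVT2[of b a ?f "\<lambda>x. sin x - sin a"] D by auto
    moreover have "sin x < sin a" using assms x by (intro sin_monotone_2pi) auto
    ultimately have "?f a - ?f b < 0" using \<open>b < a\<close> by (simp add: mult_less_0_iff)
    then show ?thesis by simp
  qed
  show "0 \<le> ?f b" using pos by (cases "b = a") auto
  show "?f b = 0 \<Longrightarrow> b = a" using pos by (cases "b = a") auto
qed

lemma sin_diff_mult_pos:
  assumes "\<bar>a\<bar> < pi / 2" "\<bar>b\<bar> < pi / 2" "a \<noteq> b"
  shows "(sin a - sin b) * (a - b) > 0"
proof (cases "a < b")
  case True
  then have "sin a < sin b" using assms by (intro sin_monotone_2pi) auto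
  with True show ?thesis by (simp add: mult_neg_neg)
next
  case False
  then have "sin b < sin a" using assms by (intro sin_monotone_2pi) auto
  with False assms(3) show ?thesis by simp
qed

text \<open>
  Flows are determined by injections: by summation by parts, equal inflows make the flow
  differences orthogonal to all differences of bus angles, whereas each product is nonnegative
  because the sine is increasing.
\<close>

lemma eta_determined_by_inflow:
  assumes wf: "wf_network P" and q: "q \<in> state_space P" "s \<in> state_space P"
    and secure: "\<forall>(i, j)\<in>lines P. \<bar>eta q $ i $ j\<bar> < pi / 2" "\<forall>(i, j)\<in>lines P. \<bar>eta s $ i $ j\<bar> < pi / 2"
    and inflow: "\<And>j. net_inflow P q j = net_inflow P s j"
  shows "eta q $ i $ j = eta s $ i $ j"
proof (cases "(i, j) \<in> lines P")
  case False
  then show ?thesis using state_space_components(1)[OF q(1)] state_space_components(1)[OF q(2)] by simp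
next
  case True
  obtain \<theta> \<theta>' where \<theta>: "\<forall>(i, j)\<in>lines P. eta q $ i $ j = \<theta> i - \<theta> j" "\<forall>(i, j)\<in>lines P. eta s $ i $ j = \<theta>' i - \<theta>' j"
    using q unfolding state_space_def by blast
  let ?c = "\<lambda>i. \<theta> i - \<theta>' i"
  let ?g = "\<lambda>(i, j). suscept P i j * ((sin (eta q $ i $ j) - sin (eta s $ i $ j)) * (eta q $ i $ j - eta s $ i $ j))"
  have nonneg: "?g e \<ge> 0" if "e \<in> lines P" for e
  proof -
    obtain a b where e: "e = (a, b)" by fastforce
    have "suscept P a b > 0" "\<bar>eta q $ a $ b\<bar> < pi / 2" "\<bar>eta s $ a $ b\<bar> < pi / 2"
      using wf secure that by (auto simp: wf_network_def e)
    then show ?thesis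
      using sin_diff_mult_pos[of "eta q $ a $ b" "eta s $ a $ b"]
      by (cases "eta q $ a $ b = eta s $ a $ b") (auto simp: e)
  qed
  have "(\<Sum>(i, j)\<in>lines P. flow P q i j * (?c i - ?c j)) = (\<Sum>(i, j)\<in>lines P. flow P s i j * (?c i - ?c j))"
    using net_inflow_weighted_sum[of ?c P q] net_inflow_weighted_sum[of ?c P s] inflow by simp
  then have "(\<Sum>(i, j)\<in>lines P. (flow P q i j - flow P s i j) * (?c i - ?c j)) = 0"
    by (simp add: sum_subtractf split_beta left_diff_distrib)
  also have "(\<Sum>(i, j)\<in>lines P. (flow P q i j - flow P s i j) * (?c i - ?c j)) = sum ?g (lines P)"
  proof (rule sum.cong)
    fix e assume "e \<in> lines P"
    moreover obtain a b where e: "e = (a, b)" by fastforce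
    ultimately have "eta q $ a $ b = \<theta> a - \<theta> b" "eta s $ a $ b = \<theta>' a - \<theta>' b" using \<theta> by auto
    then have "?c a - ?c b = eta q $ a $ b - eta s $ a $ b" by simp
    then show "(case e of (i, j) \<Rightarrow> (flow P q i j - flow P s i j) * (?c i - ?c j)) = ?g e"
      unfolding e prod.case by (simp only: flow_def) (simp add: algebra_simps)
  qed simp
  finally have "\<forall>e\<in>lines P. ?g e = 0"
    by (subst (asm) sum_nonneg_eq_0_iff) (use nonneg in auto)
  then have "?g (i, j) = 0" using True by (rule bspec)
  moreover have "suscept P i j > 0" using wf True by (auto simp: wf_network_def)
  ultimately show ?thesis
    using sin_diff_mult_pos[of "eta q $ i $ j" "eta s $ i $ j"] secure True by fastforce
qed

context passive_network_equilibrium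
begin

definition passive_bus :: "'n \<Rightarrow> real set \<Rightarrow> (('n, 'a, 'b, 'c) config \<Rightarrow> ('n, 'a, 'b, 'c) config \<Rightarrow> real)
    \<Rightarrow> (real \<Rightarrow> real) \<Rightarrow> ('n, 'a, 'b, 'c) config \<Rightarrow> bool" where
  "passive_bus j U D \<phi> s \<longleftrightarrow> (storage j has_derivative D s) (at s within S) \<and>
     (\<forall>u\<in>U. \<forall>v. device_rates j s u v \<longrightarrow>
        D s v \<le> (u - us j) * (bus_out P s j u - bus_out P p j (us j)) - \<phi> (u - us j))"

text \<open>
  The second bound confines the load frequencies to a fixed compact interval, as the closed-graph
  argument for their continuity requires.
\<close>

definition frequency_close :: "'n \<Rightarrow> real set \<Rightarrow> ('n, 'a, 'b, 'c) config \<Rightarrow> bool" where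
  "frequency_close j U s \<longleftrightarrow> (\<forall>y. state_of P y = s \<and> load_equations P y \<longrightarrow>
     - (omega y $ j) \<in> U \<and> \<bar>- (omega y $ j) - us j\<bar> \<le> 1)"

definition devices_attracted :: "'n \<Rightarrow> ('n, 'a, 'b, 'c) config \<Rightarrow> bool" where
  "devices_attracted j s \<longleftrightarrow>
     (j \<in> gens P \<longrightarrow> (\<forall>x. constant_input_solution (gen_sys P j) (us j) {0..} x \<and> x 0 = xM s $ j \<longrightarrow>
        (x \<longlongrightarrow> xM p $ j) at_top)) \<and>
     (\<forall>x. constant_input_solution (ctrl_sys P j) (us j) {0..} x \<and> x 0 = xc s $ j \<longrightarrow> (x \<longlongrightarrow> xc p $ j) at_top) \<and>
     (\<forall>x. constant_input_solution (unctrl_sys P j) (us j) {0..} x \<and> x 0 = xu s $ j \<longrightarrow> (x \<longlongrightarrow> xu p $ j) at_top)"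

definition regular_bus :: "'n \<Rightarrow> real set \<Rightarrow> (('n, 'a, 'b, 'c) config \<Rightarrow> ('n, 'a, 'b, 'c) config \<Rightarrow> real)
    \<Rightarrow> (real \<Rightarrow> real) \<Rightarrow> ('n, 'a, 'b, 'c) config \<Rightarrow> bool" where
  "regular_bus j U D \<phi> s \<longleftrightarrow> passive_bus j U D \<phi> s \<and> frequency_close j U s \<and> devices_attracted j s \<and>
     0 \<le> storage j s \<and> (storage j s = 0 \<longrightarrow> devices_at_rest j s)"

lemma regular_bus_eventually:
  "\<exists>U D \<phi>. (\<forall>z. z \<noteq> 0 \<longrightarrow> \<phi> z > (0::real)) \<and> \<phi> 0 = 0 \<and>
    (\<forall>\<^sub>F s in nhds p. s \<in> S \<longrightarrow> regular_bus j U D \<phi> s)"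
proof -
  obtain U D \<phi> where *: "open U" "us j \<in> U" "\<And>z. z \<noteq> 0 \<Longrightarrow> \<phi> z > (0::real)" "\<phi> 0 = 0"
    "\<forall>\<^sub>F s in nhds p. s \<in> S \<longrightarrow> (storage j has_derivative D s) (at s within S) \<and>
       (\<forall>u\<in>U. \<forall>v. device_rates j s u v \<longrightarrow>
          D s v \<le> (u - us j) * (bus_out P s j u - bus_out P p j (us j)) - \<phi> (u - us j))"
    by (rule bus_passivity[of j]) (rule that)
  have 1: "\<forall>\<^sub>F s in nhds p. s \<in> S \<longrightarrow> passive_bus j U D \<phi> s"
    using *(5) unfolding passive_bus_def .
  obtain \<epsilon> where \<epsilon>: "\<epsilon> > 0" "cball (us j) \<epsilon> \<subseteq> U"
    using *(1,2) open_contains_cball by blast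
  have "\<forall>\<^sub>F s in nhds p. s \<in> S \<longrightarrow>
    (\<forall>y. state_of P y = s \<and> load_equations P y \<longrightarrow> \<bar>- (omega y $ j) - us j\<bar> \<le> min \<epsilon> 1)"
    using \<epsilon>(1) by (intro frequencies_near) simp
  then have 2: "\<forall>\<^sub>F s in nhds p. s \<in> S \<longrightarrow> frequency_close j U s"
  proof eventually_elim
    case (elim s)
    show ?case
      unfolding frequency_close_def
    proof (intro impI allI)
      fix y assume "s \<in> S" "state_of P y = s \<and> load_equations P y"
      with elim have b: "\<bar>- (omega y $ j) - us j\<bar> \<le> min \<epsilon> 1" by blast
      then have "- (omega y $ j) \<in> cball (us j) \<epsilon>" by (simp add: dist_real_def abs_minus_commute)
      with b \<epsilon>(2) show "- (omega y $ j) \<in> U \<and> \<bar>- (omega y $ j) - us j\<bar> \<le> 1" by auto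
    qed
  qed
  have 3: "\<forall>\<^sub>F s in nhds p. devices_attracted j s"
  proof -
    have "\<forall>\<^sub>F s in nhds p. j \<in> gens P \<longrightarrow> (\<forall>x. constant_input_solution (gen_sys P j) (us j) {0..} x \<and> x 0 = xM s $ j \<longrightarrow>
        (x \<longlongrightarrow> xM p $ j) at_top)"
      by (cases "j \<in> gens P")
        (auto intro!: attracted_along_projection[of "gen_sys P j" "\<lambda>s. xM s $ j"] admissible bounded_linear_config p_components)
    moreover have "\<forall>\<^sub>F s in nhds p. \<forall>x. constant_input_solution (ctrl_sys P j) (us j) {0..} x \<and> x 0 = xc s $ j \<longrightarrow>
        (x \<longlongrightarrow> xc p $ j) at_top"
      by (intro attracted_along_projection[of "ctrl_sys P j" "\<lambda>s. xc s $ j"] admissible bounded_linear_config p_components)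
    moreover have "\<forall>\<^sub>F s in nhds p. \<forall>x. constant_input_solution (unctrl_sys P j) (us j) {0..} x \<and> x 0 = xu s $ j \<longrightarrow>
        (x \<longlongrightarrow> xu p $ j) at_top"
      by (intro attracted_along_projection[of "unctrl_sys P j" "\<lambda>s. xu s $ j"] admissible bounded_linear_config p_components)
    ultimately show ?thesis unfolding devices_attracted_def by eventually_elim simp
  qed
  have "\<forall>\<^sub>F s in nhds p. s \<in> S \<longrightarrow> regular_bus j U D \<phi> s"
    using 1 2 3 storage_positive[of j] by eventually_elim (simp add: regular_bus_def)
  with *(3,4) show ?thesis by blast
qed

text \<open>Off the region where the load frequencies are unique, this is an arbitrary configuration.\<close>

definition config_of :: "('n, 'a, 'b, 'c) config \<Rightarrow> ('n, 'a, 'b, 'c) config" where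
  "config_of s = (THE y. state_of P y = s \<and> load_equations P y)"

text \<open>
  Kinetic energy, the Bregman distance of the potential energy of the lines, and storage of the
  devices.
\<close>

definition line_energy :: "'n \<times> 'n \<Rightarrow> ('n, 'a, 'b, 'c) config \<Rightarrow> real" where
  "line_energy e s = (case e of (i, j) \<Rightarrow> suscept P i j *
     (cos (eta zs $ i $ j) - cos (eta s $ i $ j) - (eta s $ i $ j - eta zs $ i $ j) * sin (eta zs $ i $ j)))"

definition energy :: "('n, 'a, 'b, 'c) config \<Rightarrow> real" where
  "energy s = (\<Sum>j\<in>gens P. inertia P j / 2 * (omega s $ j - omega zs $ j)\<^sup>2)
     + (\<Sum>e\<in>lines P. line_energy e s) + (\<Sum>j\<in>UNIV. storage j s)"

end

text \<open>
  A ball on which all local hypotheses hold at once.  For each bus, \<open>U\<close> is the neighbourhood of inputs,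
  \<open>D\<close> the derivative of the storage function and \<open>\<phi>\<close> the dissipation from its passivity inequality.
\<close>

locale passive_network_region = passive_network_equilibrium P zs VG VL S p us
  for P :: "('n::finite, 'a::euclidean_space, 'b::euclidean_space, 'c::euclidean_space) power_network"
    and zs VG VL S p us +
  fixes U :: "'n \<Rightarrow> real set" and D :: "'n \<Rightarrow> ('n, 'a, 'b, 'c) config \<Rightarrow> ('n, 'a, 'b, 'c) config \<Rightarrow> real"
    and \<phi> :: "'n \<Rightarrow> real \<Rightarrow> real" and r :: real and K :: "('n, 'a, 'b, 'c) config set"
  defines "K \<equiv> cball p r \<inter> S"
  assumes r_pos: "r > 0" and phi_pos: "z \<noteq> 0 \<Longrightarrow> \<phi> j z > 0" and phi_0: "\<phi> j 0 = 0"
    and region_unique: "s \<in> K \<Longrightarrow> \<exists>!y. state_of P y = s \<and> load_equations P y"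
    and region_secure: "s \<in> K \<Longrightarrow> \<forall>(i, j)\<in>lines P. \<bar>eta s $ i $ j\<bar> < pi / 2"
    and region_bus: "s \<in> K \<Longrightarrow> regular_bus j (U j) (D j) (\<phi> j) s"
begin

lemma K_subset: "K \<subseteq> S" and p_in_K: "p \<in> K"
  using p_in_S r_pos by (auto simp: K_def)

lemma config_of:
  assumes "s \<in> K"
  shows "state_of P (config_of s) = s" "load_equations P (config_of s)"
    and "state_of P y = s \<Longrightarrow> load_equations P y \<Longrightarrow> y = config_of s"
proof -
  have ex1: "\<exists>!y. state_of P y = s \<and> load_equations P y" using assms by (rule region_unique)
  have "state_of P (config_of s) = s \<and> load_equations P (config_of s)"
    unfolding config_of_def by (rule theI'[OF ex1])
  with ex1 show "state_of P (config_of s) = s" "load_equations P (config_of s)"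
    "state_of P y = s \<Longrightarrow> load_equations P y \<Longrightarrow> y = config_of s" by blast+
qed

lemma config_of_components:
  assumes "s \<in> K"
  shows "eta (config_of s) = eta s" "j \<in> gens P \<Longrightarrow> omega (config_of s) $ j = omega s $ j"
    "xM (config_of s) = xM s" "xc (config_of s) = xc s" "xu (config_of s) = xu s"
    "bus_balance P (config_of s) j u = bus_balance P s j u"
proof -
  have st: "state_of P (config_of s) = s" using assms by (rule config_of)
  show "eta (config_of s) = eta s" "xM (config_of s) = xM s" "xc (config_of s) = xc s" "xu (config_of s) = xu s"
    using state_of_simps[of P "config_of s", unfolded st] by simp_all
  show "omega (config_of s) $ j = omega s $ j" if "j \<in> gens P"
    using state_of_simps(2)[of P "config_of s" j, unfolded st] that by simp
  show "bus_balance P (config_of s) j u = bus_balance P s j u"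
    using bus_balance_state_of[of P "config_of s" j u, unfolded st] by simp
qed

lemma state_of_in_K:
  assumes "s \<in> K"
  shows "state_of P s \<in> state_space P"
proof -
  have "state_of P (state_of P (config_of s)) = state_of P (config_of s)"
    by (simp add: state_of_def vec_eq_iff)
  then have "state_of P s = s" using config_of(1)[OF assms] by simp
  then show ?thesis using assms K_subset by (auto simp: S_def)
qed

lemma config_of_p: "config_of p = zs"
proof -
  have "load_equations P zs"
    unfolding load_equations_iff
    using bus_balance_p by (simp add: p_def us_def)
  then show ?thesis using config_of(3)[OF p_in_K, of zs] by (simp add: p_def)
qed

lemma config_of_frequency:
  assumes "s \<in> K"
  shows "- (omega (config_of s) $ j) \<in> U j" "\<bar>- (omega (config_of s) $ j) - us j\<bar> \<le> 1"
proof -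
  have "frequency_close j (U j) s"
    using region_bus[OF assms, of j] by (simp only: regular_bus_def)
  then have "- (omega (config_of s) $ j) \<in> U j \<and> \<bar>- (omega (config_of s) $ j) - us j\<bar> \<le> 1"
    unfolding frequency_close_def by (elim allE[of _ "config_of s"] impE) (intro conjI config_of[OF assms])
  then show "- (omega (config_of s) $ j) \<in> U j" "\<bar>- (omega (config_of s) $ j) - us j\<bar> \<le> 1" by simp_all
qed

lemma region_passive:
  assumes "s \<in> K"
  shows "(storage j has_derivative D j s) (at s within S)"
    and "u \<in> U j \<Longrightarrow> device_rates j s u v \<Longrightarrow>
      D j s v \<le> (u - us j) * (bus_out P s j u - bus_out P p j (us j)) - \<phi> j (u - us j)"
proof -
  have b: "passive_bus j (U j) (D j) (\<phi> j) s"
    using region_bus[OF assms, of j] by (simp only: regular_bus_def)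
  from b[unfolded passive_bus_def, THEN conjunct1]
  show "(storage j has_derivative D j s) (at s within S)" .
  from b[unfolded passive_bus_def, THEN conjunct2, rule_format]
  show "u \<in> U j \<Longrightarrow> device_rates j s u v \<Longrightarrow>
      D j s v \<le> (u - us j) * (bus_out P s j u - bus_out P p j (us j)) - \<phi> j (u - us j)" .
qed

text \<open>Only the load frequencies matter: they are unique roots of the bus balances.\<close>

lemma config_of_continuous: "continuous_on K config_of"
proof (rule config_continuous_onI)
  have eq: "continuous_on K f \<Longrightarrow> (\<And>s. s \<in> K \<Longrightarrow> g s = f s) \<Longrightarrow> continuous_on K g" for f g :: "_ \<Rightarrow> 'z::topological_space"
    by (simp cong: continuous_on_cong)
  show "continuous_on K (\<lambda>s. eta (config_of s) $ i $ j)" for i j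
    by (rule eq[OF continuous_on_config(1)[OF continuous_on_id, of K i j]]) (simp add: config_of_components)
  show "continuous_on K (\<lambda>s. xM (config_of s) $ j)" for j
    by (rule eq[OF continuous_on_config(3)[OF continuous_on_id, of K j]]) (simp add: config_of_components)
  show "continuous_on K (\<lambda>s. xc (config_of s) $ j)" for j
    by (rule eq[OF continuous_on_config(4)[OF continuous_on_id, of K j]]) (simp add: config_of_components)
  show "continuous_on K (\<lambda>s. xu (config_of s) $ j)" for j
    by (rule eq[OF continuous_on_config(5)[OF continuous_on_id, of K j]]) (simp add: config_of_components)
  show "continuous_on K (\<lambda>s. omega (config_of s) $ j)" for j
  proof (cases "j \<in> gens P")
    case True
    then show ?thesis
      by (intro eq[OF continuous_on_config(2)[OF continuous_on_id, of K j]]) (simp add: config_of_components)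
  next
    case False
    have "continuous_on K (\<lambda>s. - (omega (config_of s) $ j))"
    proof (rule unique_root_continuous_on[where g = "\<lambda>s u. bus_balance P s j u" and a = "us j - 1" and b = "us j + 1"])
      have "continuous_on (K \<times> {us j - 1..us j + 1}) (\<lambda>q. bus_balance P (fst q) j (snd q))"
        by (rule bus_balance_continuous_on[OF wf]) (use state_of_in_K in \<open>auto intro!: continuous_intros\<close>)
      then show "continuous_on (K \<times> {us j - 1..us j + 1}) (\<lambda>(s, u). bus_balance P s j u)"
        by (simp add: split_beta)
      show "- (omega (config_of s) $ j) \<in> {us j - 1..us j + 1} \<and> bus_balance P s j (- (omega (config_of s) $ j)) = 0"
        if "s \<in> K" for s
        using config_of_frequency(2)[OF that, of j] config_of(2)[OF that] False
        by (auto simp: load_equations_iff config_of_components(6)[OF that] abs_le_iff)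
      show "u = - (omega (config_of s) $ j)" if "s \<in> K" "bus_balance P s j u = 0" for s u
        using region_unique[OF that(1)] config_of(1,2)[OF that(1)] False that(2) by (rule load_root_unique)
    qed
    from continuous_on_minus[OF this] show ?thesis by simp
  qed
qed

definition energy_rate :: "('n, 'a, 'b, 'c) config \<Rightarrow> ('n, 'a, 'b, 'c) config \<Rightarrow> real" where
  "energy_rate s v = (\<Sum>j\<in>gens P. inertia P j * (omega s $ j - omega zs $ j) * omega v $ j)
     + (\<Sum>(i, j)\<in>lines P. suscept P i j * (sin (eta s $ i $ j) - sin (eta zs $ i $ j)) * eta v $ i $ j)
     + (\<Sum>j\<in>UNIV. D j s v)"

lemma energy_derivative:
  assumes "s \<in> K"
  shows "(energy has_derivative energy_rate s) (at s within S)"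
proof -
  have om: "((\<lambda>s. omega s $ j) has_derivative (\<lambda>v. omega v $ j)) (at s within S)" for j
    by (rule has_derivative_config)
  have et: "((\<lambda>s. eta s $ i $ j) has_derivative (\<lambda>v. eta v $ i $ j)) (at s within S)" for i j
    by (rule has_derivative_config)
  have 1: "((\<lambda>s. inertia P j / 2 * (omega s $ j - omega zs $ j)\<^sup>2) has_derivative
      (\<lambda>v. inertia P j * (omega s $ j - omega zs $ j) * omega v $ j)) (at s within S)" for j
    by (auto intro!: derivative_eq_intros om)
  have 2: "(line_energy e has_derivative (\<lambda>v. case e of (i, j) \<Rightarrow>
      suscept P i j * (sin (eta s $ i $ j) - sin (eta zs $ i $ j)) * eta v $ i $ j)) (at s within S)" for e
  proof -
    obtain i j where e: "e = (i, j)" by fastforce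
    show ?thesis unfolding e line_energy_def prod.case
      by (auto intro!: derivative_eq_intros et simp: algebra_simps)
  qed
  have 3: "(storage j has_derivative D j s) (at s within S)" for j
    using assms by (rule region_passive)
  show ?thesis
    unfolding energy_def[abs_def] energy_rate_def[abs_def]
    by (intro has_derivative_add has_derivative_sum 1 2 3)
qed

definition rate :: "('n, 'a, 'b, 'c) config \<Rightarrow> ('n, 'a, 'b, 'c) config" where
  "rate s = net_rate P (config_of s)"

definition dissipation :: "('n, 'a, 'b, 'c) config \<Rightarrow> real" where
  "dissipation s = (\<Sum>j\<in>UNIV. \<phi> j (- (omega (config_of s) $ j) - us j))"

text \<open>
  Kinetic and line energy exchange power through the network without loss (summation by parts), so
  only the strict passivity of the buses contributes to the decay.
\<close>

lemma energy_decay: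
  assumes s: "s \<in> K"
  shows "energy_rate s (rate s) \<le> - dissipation s"
proof -
  define y where "y = config_of s"
  note comp = config_of_components[OF s, folded y_def]
  define w where "w j = omega y $ j - omega zs $ j" for j
  define \<Delta> where "\<Delta> j = bus_out P s j (- (omega y $ j)) - bus_out P p j (us j)" for j
  have load: "bus_balance P y j (- (omega y $ j)) = 0" if "j \<notin> gens P" for j
    using config_of(2)[OF s] that by (simp add: load_equations_iff y_def)
  have "bus_balance P y j (- (omega y $ j)) = \<Delta> j + (net_inflow P s j - net_inflow P p j)" for j
    using bus_balance_p[of j] comp(6)[of j "- (omega y $ j)"] unfolding bus_balance_def \<Delta>_def by linarith
  then have split: "(\<Sum>j\<in>UNIV. w j * bus_balance P y j (- (omega y $ j))) = (\<Sum>j\<in>UNIV. w j * \<Delta> j)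
      + ((\<Sum>j\<in>UNIV. w j * net_inflow P s j) - (\<Sum>j\<in>UNIV. w j * net_inflow P p j))"
    by (simp only: distrib_left right_diff_distrib sum.distrib sum_subtractf)
  have kin: "(\<Sum>j\<in>gens P. inertia P j * (omega s $ j - omega zs $ j) * omega (rate s) $ j)
      = (\<Sum>j\<in>UNIV. w j * bus_balance P y j (- (omega y $ j)))"
  proof -
    have "inertia P j * (omega s $ j - omega zs $ j) * omega (rate s) $ j = w j * bus_balance P y j (- (omega y $ j))"
      if "j \<in> gens P" for j
    proof -
      have "inertia P j \<noteq> 0" using wf that by (auto simp: wf_network_def)
      then show ?thesis using that comp(2)[of j] by (simp add: rate_def net_rate_def w_def y_def[symmetric])
    qed
    then have "(\<Sum>j\<in>gens P. inertia P j * (omega s $ j - omega zs $ j) * omega (rate s) $ j)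
       = (\<Sum>j\<in>gens P. w j * bus_balance P y j (- (omega y $ j)))" by simp
    also have "\<dots> = (\<Sum>j\<in>UNIV. w j * bus_balance P y j (- (omega y $ j)))"
      by (rule sum.mono_neutral_left) (use load in auto)
    finally show ?thesis .
  qed
  have line: "(\<Sum>(i, j)\<in>lines P. suscept P i j * (sin (eta s $ i $ j) - sin (eta zs $ i $ j)) * eta (rate s) $ i $ j)
      = - ((\<Sum>j\<in>UNIV. w j * net_inflow P s j) - (\<Sum>j\<in>UNIV. w j * net_inflow P p j))"
  proof -
    have "- ((\<Sum>j\<in>UNIV. w j * net_inflow P s j) - (\<Sum>j\<in>UNIV. w j * net_inflow P p j))
       = (\<Sum>e\<in>lines P. (case e of (i, j) \<Rightarrow> flow P s i j * (w i - w j)) - (case e of (i, j) \<Rightarrow> flow P p i j * (w i - w j)))"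
      unfolding net_inflow_weighted_sum sum_subtractf by simp
    also have "\<dots> = (\<Sum>(i, j)\<in>lines P. suscept P i j * (sin (eta s $ i $ j) - sin (eta zs $ i $ j)) * eta (rate s) $ i $ j)"
    proof (rule sum.cong)
      fix e assume e: "e \<in> lines P"
      obtain i j where ij: "e = (i, j)" by fastforce
      have "omega zs $ i = omega zs $ j" using equilibrium_frequency_uniform[OF wf equilibrium] .
      then have "eta (rate s) $ i $ j = w i - w j"
        using e by (simp add: ij rate_def net_rate_def y_def[symmetric] w_def)
      then show "(case e of (i, j) \<Rightarrow> flow P s i j * (w i - w j)) - (case e of (i, j) \<Rightarrow> flow P p i j * (w i - w j))
         = (case e of (i, j) \<Rightarrow> suscept P i j * (sin (eta s $ i $ j) - sin (eta zs $ i $ j)) * eta (rate s) $ i $ j)"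
        unfolding ij prod.case \<open>eta (rate s) $ i $ j = w i - w j\<close>
        by (simp add: flow_def p_components left_diff_distrib right_diff_distrib)
    qed simp
    finally show ?thesis by simp
  qed
  have stor: "D j s (rate s) \<le> - (w j * \<Delta> j) - \<phi> j (- (omega y $ j) - us j)" for j
  proof -
    have "device_rates j s (- (omega y $ j)) (rate s)"
      by (simp add: device_rates_def rate_def net_rate_def y_def[symmetric] comp)
    moreover have "- (omega y $ j) \<in> U j" using config_of_frequency[OF s] by (simp add: y_def)
    ultimately have "D j s (rate s) \<le> (- (omega y $ j) - us j) * \<Delta> j - \<phi> j (- (omega y $ j) - us j)"
      unfolding \<Delta>_def by (intro region_passive(2)[OF s])
    moreover have "- (omega y $ j) - us j = - w j" by (simp add: w_def us_def)
    ultimately show ?thesis by simp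
  qed
  have "(\<Sum>j\<in>UNIV. D j s (rate s)) \<le> (\<Sum>j\<in>UNIV. - (w j * \<Delta> j) - \<phi> j (- (omega y $ j) - us j))"
    by (intro sum_mono stor)
  also have "\<dots> = - (\<Sum>j\<in>UNIV. w j * \<Delta> j) - dissipation s"
    by (simp add: dissipation_def y_def sum_subtractf sum_negf)
  finally show ?thesis unfolding energy_rate_def kin line split by simp
qed

lemma dissipation_nonneg: "0 \<le> dissipation s"
  and dissipation_zero: "dissipation s = 0 \<Longrightarrow> omega (config_of s) $ j = omega zs $ j"
proof -
  have nonneg: "0 \<le> \<phi> j z" for j z using phi_pos[of z j] phi_0[of j] by (cases "z = 0") auto
  show "0 \<le> dissipation s" unfolding dissipation_def by (intro sum_nonneg nonneg)
  assume "dissipation s = 0"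
  then have "\<phi> j (- (omega (config_of s) $ j) - us j) = 0"
    unfolding dissipation_def using nonneg by (simp add: sum_nonneg_eq_0_iff)
  then have "- (omega (config_of s) $ j) - us j = 0"
    using phi_pos[of "- (omega (config_of s) $ j) - us j" j] by (metis less_irrefl)
  then show "omega (config_of s) $ j = omega zs $ j" by (simp add: us_def)
qed

lemma line_energy_nonneg:
  assumes "s \<in> K" "(i, j) \<in> lines P"
  shows "0 \<le> line_energy (i, j) s" and "line_energy (i, j) s = 0 \<Longrightarrow> eta s $ i $ j = eta zs $ i $ j"
proof -
  have "suscept P i j > 0" "\<bar>eta zs $ i $ j\<bar> < pi / 2" "\<bar>eta s $ i $ j\<bar> < pi / 2"
    using wf secure region_secure[OF assms(1)] assms(2) by (auto simp: wf_network_def angle_security_def)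
  then show "0 \<le> line_energy (i, j) s" "line_energy (i, j) s = 0 \<Longrightarrow> eta s $ i $ j = eta zs $ i $ j"
    using cos_gap[of "eta zs $ i $ j" "eta s $ i $ j"] by (auto simp: line_energy_def)
qed

lemma energy_p: "energy p = 0"
  by (simp add: energy_def line_energy_def storage_p p_components split_beta)

lemma energy_positive:
  assumes s: "s \<in> K" and "s \<noteq> p"
  shows "energy s > 0"
proof -
  have M: "inertia P j > 0" if "j \<in> gens P" for j using wf that by (simp add: wf_network_def)
  have kin: "0 \<le> inertia P j / 2 * (omega s $ j - omega zs $ j)\<^sup>2" if "j \<in> gens P" for j
    using M[OF that] by simp
  have line: "0 \<le> line_energy e s" if "e \<in> lines P" for e
    using line_energy_nonneg(1)[OF s] that by (cases e) simp
  have stor: "0 \<le> storage j s" "storage j s = 0 \<Longrightarrow> devices_at_rest j s" for j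
    using region_bus[OF s, of j] by (auto simp: regular_bus_def)
  note sums = sum_nonneg[of "gens P" "\<lambda>j. inertia P j / 2 * (omega s $ j - omega zs $ j)\<^sup>2", OF kin]
    sum_nonneg[of "lines P" "\<lambda>e. line_energy e s", OF line]
    sum_nonneg[of UNIV "\<lambda>j. storage j s", OF stor(1)]
  have "energy s \<noteq> 0"
  proof
    assume "energy s = 0"
    then have z: "(\<Sum>j\<in>gens P. inertia P j / 2 * (omega s $ j - omega zs $ j)\<^sup>2) = 0"
        "(\<Sum>e\<in>lines P. line_energy e s) = 0" "(\<Sum>j\<in>UNIV. storage j s) = 0"
      using sums unfolding energy_def by linarith+
    have "inertia P j / 2 * (omega s $ j - omega zs $ j)\<^sup>2 = 0" if "j \<in> gens P" for j
      using z(1) kin that by (subst (asm) sum_nonneg_eq_0_iff) auto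
    then have om: "omega s $ j = omega p $ j" if "j \<in> gens P" for j
      using M[OF that] that p_components(5)[OF that] by force
    have "line_energy e s = 0" if "e \<in> lines P" for e
      using z(2) line that by (subst (asm) sum_nonneg_eq_0_iff) auto
    then have et: "eta s $ i $ j = eta p $ i $ j" if "(i, j) \<in> lines P" for i j
      using line_energy_nonneg(2)[OF s that] that by (simp add: p_components)
    have rest: "devices_at_rest j s" for j
      using z(3) stor by (subst (asm) sum_nonneg_eq_0_iff) auto
    have sS: "s \<in> state_space P" "p \<in> state_space P" using s p_in_S K_subset by (auto simp: S_def)
    note zero = state_space_components[OF sS(1)] state_space_components[OF sS(2)]
    have "s = p"
    proof (rule config_eqI)
      show "eta s $ i $ j = eta p $ i $ j" for i j using et zero(1,7) by (cases "(i, j) \<in> lines P") auto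
      show "omega s $ j = omega p $ j" for j using om zero(2,8) by (cases "j \<in> gens P") auto
      show "xM s $ j = xM p $ j" for j using rest[of j] zero(4,10) by (cases "j \<in> gens P") (auto simp: devices_at_rest_def)
      show "xc s $ j = xc p $ j" "xu s $ j = xu p $ j" for j using rest[of j] by (auto simp: devices_at_rest_def)
    qed
    with \<open>s \<noteq> p\<close> show False by simp
  qed
  with sums show ?thesis unfolding energy_def by linarith
qed

text \<open>
  Without dissipation all frequencies have their equilibrium values, so the angles are constant and
  the devices, driven by a constant input, converge to their equilibrium states.  In the limit the
  injections, hence the angles, agree with those of the equilibrium.
\<close>

lemma lossless_solution_converges:
  assumes mem: "\<And>t. t \<ge> 0 \<Longrightarrow> y t \<in> K" and lossless: "\<And>t. t \<ge> 0 \<Longrightarrow> dissipation (y t) = 0"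
    and der: "\<And>t. t \<ge> 0 \<Longrightarrow> (y has_vector_derivative rate (y t)) (at t within {0..})"
  shows "(y \<longlongrightarrow> p) at_top"
proof -
  have freq: "omega (config_of (y t)) $ j = omega zs $ j" if "t \<ge> 0" for t j
    using dissipation_zero lossless[OF that] .
  have input: "- (omega (config_of (y t)) $ j) = us j" if "t \<ge> 0" for t j
    using freq[OF that] by (simp add: us_def)
  have yS: "y t \<in> state_space P" if "t \<ge> 0" for t using mem[OF that] K_subset by (auto simp: S_def)
  have eta_const: "eta (y t) $ i $ j = eta (y 0) $ i $ j" if "t \<ge> 0" for t i j
  proof -
    have "((\<lambda>t. eta (y t) $ i $ j) has_vector_derivative 0) (at t within {0..})" if "t \<in> {0..}" for t
    proof -
      have "eta (rate (y t)) $ i $ j = 0"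
        using equilibrium_frequency_uniform[OF wf equilibrium, of i j] that by (simp add: rate_def net_rate_def freq)
      then show ?thesis using has_vector_derivative_config(1)[OF der[of t], of i j] that by simp
    qed
    then obtain c where "\<And>t. t \<in> {0..} \<Longrightarrow> eta (y t) $ i $ j = c"
      using has_vector_derivative_zero_constant[of "{0..}" "\<lambda>t. eta (y t) $ i $ j"] by auto
    with that show ?thesis by simp
  qed
  have omega_const: "omega (y t) $ j = omega p $ j" if "t \<ge> 0" for t j
  proof (cases "j \<in> gens P")
    case True
    then show ?thesis using freq[OF that, of j] config_of_components(2)[OF mem[OF that]] by (simp add: p_components)
  next
    case False
    then show ?thesis using state_space_components(2)[OF yS[OF that]] state_space_components(2)[of p P] p_in_S
      by (simp add: S_def)
  qed
  have balance: "bus_balance P (y t) j (us j) = 0" if t: "t \<ge> 0" for t j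
  proof (cases "j \<in> gens P")
    case True
    have "((\<lambda>t. omega (y t) $ j) has_vector_derivative omega (rate (y t)) $ j) (at t within {0..})"
      by (rule has_vector_derivative_config) (rule der[OF t])
    moreover have "((\<lambda>t. omega (y t) $ j) has_vector_derivative 0) (at t within {0..})"
      by (rule has_vector_derivative_transform[of t _ _ "\<lambda>t. omega p $ j"]) (use t omega_const in auto)
    moreover have "at t within {0..} \<noteq> bot"
    proof
      assume "at t within {0..} = bot"
      moreover have "at_right t \<le> at t within {0..}" by (rule at_le) (use t in auto)
      ultimately show False using trivial_limit_at_right_real[of t] by (simp add: bot_unique)
    qed
    ultimately have "omega (rate (y t)) $ j = 0" by (rule vector_derivative_unique_within[rotated])
    moreover have "inertia P j \<noteq> 0" using wf True by (auto simp: wf_network_def)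
    ultimately show ?thesis
      using True by (simp add: rate_def net_rate_def input[OF t] config_of_components(6)[OF mem[OF t]])
  next
    case False
    then have "bus_balance P (config_of (y t)) j (- (omega (config_of (y t)) $ j)) = 0"
      using config_of(2)[OF mem[OF t]] by (simp add: load_equations_iff)
    then show ?thesis by (simp only: input[OF t] config_of_components(6)[OF mem[OF t]])
  qed
  have lim_dev: "((\<lambda>t. xM (y t) $ j) \<longlongrightarrow> xM p $ j) at_top" "((\<lambda>t. xc (y t) $ j) \<longlongrightarrow> xc p $ j) at_top"
      "((\<lambda>t. xu (y t) $ j) \<longlongrightarrow> xu p $ j) at_top" for j
  proof -
    have attr: "devices_attracted j (y 0)" using region_bus[OF mem[of 0], of j] by (simp add: regular_bus_def)
    show "((\<lambda>t. xc (y t) $ j) \<longlongrightarrow> xc p $ j) at_top"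
    proof -
      have "constant_input_solution (ctrl_sys P j) (us j) {0..} (\<lambda>t. xc (y t) $ j)"
        unfolding constant_input_solution_def
        using has_vector_derivative_config(4)[OF der, of _ j] state_space_components(5)[OF yS]
        by (simp add: rate_def net_rate_def input config_of_components mem)
      then show ?thesis using attr by (simp add: devices_attracted_def)
    qed
    show "((\<lambda>t. xu (y t) $ j) \<longlongrightarrow> xu p $ j) at_top"
    proof -
      have "constant_input_solution (unctrl_sys P j) (us j) {0..} (\<lambda>t. xu (y t) $ j)"
        unfolding constant_input_solution_def
        using has_vector_derivative_config(5)[OF der, of _ j] state_space_components(6)[OF yS]
        by (simp add: rate_def net_rate_def input config_of_components mem)
      then show ?thesis using attr by (simp add: devices_attracted_def)
    qed
    show "((\<lambda>t. xM (y t) $ j) \<longlongrightarrow> xM p $ j) at_top"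
    proof (cases "j \<in> gens P")
      case True
      then have "constant_input_solution (gen_sys P j) (us j) {0..} (\<lambda>t. xM (y t) $ j)"
        unfolding constant_input_solution_def
        using has_vector_derivative_config(3)[OF der, of _ j] state_space_components(3)[OF yS]
        by (simp add: rate_def net_rate_def input config_of_components(3) mem)
      then show ?thesis using attr True by (simp add: devices_attracted_def)
    next
      case False
      have "xM p $ j = 0" using state_space_components(4)[of p P j] p_in_S False by (simp add: S_def)
      moreover have "\<forall>\<^sub>F t in at_top. 0 = xM (y t) $ j"
        using eventually_ge_at_top[of 0] by eventually_elim (simp add: state_space_components(4)[OF yS False])
      ultimately show ?thesis using tendsto_cong[of "\<lambda>_. 0" "\<lambda>t. xM (y t) $ j"] by fastforce
    qed
  qed
  have nonneg_times: "\<forall>\<^sub>F t in at_top. Q t" if "\<And>t::real. t \<ge> 0 \<Longrightarrow> Q t" for Q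
    using eventually_ge_at_top[of 0] by eventually_elim (rule that)
  define q where "q = (eta (y 0), omega p, xM p, xc p, xu p)"
  have y_lim: "(y \<longlongrightarrow> q) at_top"
  proof (rule config_tendstoI)
    have ev: "(f \<longlongrightarrow> c) at_top" if "\<And>t. t \<ge> 0 \<Longrightarrow> f t = c" for f :: "real \<Rightarrow> real" and c
      using that by (intro tendsto_eventually nonneg_times)
    show "((\<lambda>t. eta (y t) $ i $ j) \<longlongrightarrow> eta q $ i $ j) at_top" for i j
      unfolding q_def config_simps by (rule ev, rule eta_const)
    show "((\<lambda>t. omega (y t) $ j) \<longlongrightarrow> omega q $ j) at_top" for j
      unfolding q_def config_simps by (rule ev, rule omega_const)
  qed (use lim_dev in \<open>simp_all add: q_def\<close>)
  have closed_K: "closed K" unfolding K_def using subspace_S by (intro closed_Int) (auto simp: closed_subspace)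
  have "q \<in> K"
    by (rule Lim_in_closed_set[OF closed_K nonneg_times[OF mem] trivial_limit_at_top_linorder y_lim])
  have inflow: "net_inflow P q j = net_inflow P p j" for j
  proof -
    have "continuous_on K (\<lambda>s. bus_balance P s j (us j))"
      by (rule bus_balance_continuous_on[OF wf continuous_on_id _ continuous_on_const])
        (use state_of_in_K in auto)
    then have "((\<lambda>t. bus_balance P (y t) j (us j)) \<longlongrightarrow> bus_balance P q j (us j)) at_top"
      by (rule continuous_on_tendsto_compose[OF _ y_lim \<open>q \<in> K\<close> nonneg_times[OF mem]])
    moreover have "((\<lambda>t. bus_balance P (y t) j (us j)) \<longlongrightarrow> 0) at_top"
      by (rule tendsto_eventually[OF nonneg_times[OF balance]])
    ultimately have "bus_balance P q j (us j) = 0" by (rule tendsto_unique[OF trivial_limit_at_top_linorder])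
    moreover have "bus_out P q j (us j) = bus_out P p j (us j)" by (simp add: bus_out_def q_def)
    ultimately show ?thesis using bus_balance_p[of j] by (simp add: bus_balance_def)
  qed
  have "eta q $ i $ j = eta p $ i $ j" for i j
  proof (rule eta_determined_by_inflow[OF wf])
    show "q \<in> state_space P" "p \<in> state_space P" using \<open>q \<in> K\<close> p_in_K K_subset by (auto simp: S_def)
  qed (use region_secure \<open>q \<in> K\<close> p_in_K inflow in auto)
  then have "q = p" by (intro config_eqI) (simp_all add: q_def)
  with y_lim show ?thesis by simp
qed

lemma rate_continuous: "continuous_on K rate"
  unfolding rate_def[abs_def]
  by (rule net_rate_continuous_on[OF wf config_of_continuous]) (use config_of(1) K_subset in \<open>auto simp: S_def\<close>)

lemma rate_tangent: "s \<in> K \<Longrightarrow> rate s \<in> S"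
  unfolding rate_def S_def
  by (rule net_rate_in_state_space[OF wf]) (use config_of(1)[of s] K_subset in \<open>auto simp: S_def\<close>)

sublocale weak_lyapunov_region S p r rate energy energy_rate dissipation K
  by (unfold_locales, fold K_def)
    (rule dissipation_nonneg |
     fact subspace_S p_in_S r_pos rate_continuous rate_tangent energy_derivative energy_decay
      energy_p energy_positive lossless_solution_converges)+

end

section \<open>Convergence of the network\<close>

lemma (in passive_network_equilibrium) region_exists:
  obtains U D \<phi> r where "passive_network_region P zs VG VL U D \<phi> r"
proof -
  let ?Q = "\<lambda>j x. (\<forall>z. z \<noteq> 0 \<longrightarrow> snd (snd x) z > (0::real)) \<and> snd (snd x) 0 = 0 \<and>
    (\<forall>\<^sub>F s in nhds p. s \<in> S \<longrightarrow> regular_bus j (fst x) (fst (snd x)) (snd (snd x)) s)"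
  have "\<exists>x. ?Q j x" for j
  proof -
    obtain U D \<phi> where "(\<forall>z. z \<noteq> 0 \<longrightarrow> \<phi> z > (0::real)) \<and> \<phi> 0 = 0 \<and>
      (\<forall>\<^sub>F s in nhds p. s \<in> S \<longrightarrow> regular_bus j U D \<phi> s)"
      using regular_bus_eventually[of j] by (elim exE) (rule that)
    then have "?Q j (U, D, \<phi>)" unfolding fst_conv snd_conv .
    then show ?thesis by (rule exI)
  qed
  then obtain f where f: "\<And>j. ?Q j (f j)" using choice[of ?Q] by auto
  define U D \<phi> where "U j = fst (f j)" and "D j = fst (snd (f j))" and "\<phi> j = snd (snd (f j))" for j
  have "\<forall>\<^sub>F s in nhds p. s \<in> S \<longrightarrow> regular_bus j (U j) (D j) (\<phi> j) s" for j
    using f[of j] by (simp only: U_def D_def \<phi>_def)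
  then have "\<forall>\<^sub>F s in nhds p. \<forall>j. s \<in> S \<longrightarrow> regular_bus j (U j) (D j) (\<phi> j) s"
    by (rule eventually_all_finite)
  then have "\<forall>\<^sub>F s in nhds p. s \<in> S \<longrightarrow> (\<exists>!y. state_of P y = s \<and> load_equations P y) \<and>
      (\<forall>(i, j)\<in>lines P. \<bar>eta s $ i $ j\<bar> < pi / 2) \<and> (\<forall>j. regular_bus j (U j) (D j) (\<phi> j) s)"
    using load_frequencies_exist lines_secure by eventually_elim blast
  then obtain d where d: "d > 0" "\<And>s. dist s p < d \<Longrightarrow> s \<in> S \<longrightarrow> (\<exists>!y. state_of P y = s \<and> load_equations P y) \<and>
      (\<forall>(i, j)\<in>lines P. \<bar>eta s $ i $ j\<bar> < pi / 2) \<and> (\<forall>j. regular_bus j (U j) (D j) (\<phi> j) s)"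
    unfolding eventually_nhds_metric by blast
  have near: "(\<exists>!y. state_of P y = s \<and> load_equations P y) \<and>
      (\<forall>(i, j)\<in>lines P. \<bar>eta s $ i $ j\<bar> < pi / 2) \<and> (\<forall>j. regular_bus j (U j) (D j) (\<phi> j) s)"
    if "s \<in> cball p (d / 2) \<inter> S" for s
  proof -
    have "dist s p < d" "s \<in> S" using that d(1) by (auto simp: dist_commute)
    then show ?thesis using d(2) by blast
  qed
  have "passive_network_region P zs VG VL U D \<phi> (d / 2)"
  proof (unfold_locales, fold S_def p_def us_def)
    show "d / 2 > 0" using d(1) by simp
    show "\<phi> j z > 0" if "z \<noteq> 0" for j z using f[of j] that by (simp add: \<phi>_def)
    show "\<phi> j 0 = 0" for j using f[of j] by (simp add: \<phi>_def)
  qed (use near in blast)+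
  then show thesis by (rule that)
qed

context passive_network_region
begin

lemma solution_of_rate:
  assumes "\<And>t. t \<in> I \<Longrightarrow> x t \<in> K" "\<And>t. t \<in> I \<Longrightarrow> (x has_vector_derivative rate (x t)) (at t within I)"
  shows "solution_on P I (\<lambda>t. config_of (x t))"
  unfolding solution_on_iff
proof (intro ballI conjI)
  fix t assume t: "t \<in> I"
  show "state_of P (config_of (x t)) \<in> state_space P"
    using config_of(1)[OF assms(1)[OF t]] assms(1)[OF t] K_subset by (auto simp: S_def)
  show "load_equations P (config_of (x t))" using config_of(2)[OF assms(1)[OF t]] .
  have "(x has_vector_derivative net_rate P (config_of (x t))) (at t within I)"
    using assms(2)[OF t] by (simp only: rate_def)
  then show "((\<lambda>s. state_of P (config_of (x s))) has_vector_derivative net_rate P (config_of (x t))) (at t within I)"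
    by (rule has_vector_derivative_transform[OF t, rotated]) (rule config_of(1)[OF assms(1)])
qed

lemma time_domain_simps: "time_domain \<infinity> = {0..}" "time_domain (ereal T) = {0..<T}"
  by (auto simp: time_domain_def)

text \<open>
  In the region every solution of the network equations is a solution of the vector field and
  conversely, since the load frequencies are functions of the state.  A maximal solution on a finite
  time interval would contradict the extension property.
\<close>

theorem network_converges:
  obtains \<delta> where "\<delta> > 0"
    "\<And>s. s \<in> ball p \<delta> \<inter> S \<Longrightarrow> \<exists>z. solution_on P (time_domain \<infinity>) z \<and> state_of P (z 0) = s"
    "\<And>\<tau> z. maximal_solution P \<tau> z \<Longrightarrow> state_of P (z 0) \<in> ball p \<delta> \<Longrightarrow> \<tau> = \<infinity> \<and> (z \<longlongrightarrow> zs) at_top"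
proof (rule local_convergence)
  fix \<delta> :: real
  assume \<delta>: "\<delta> > 0"
    and exists: "\<And>s. s \<in> ball p \<delta> \<inter> S \<Longrightarrow> \<exists>x. x 0 = s \<and>
       (\<forall>t\<ge>0. x t \<in> K \<and> (x has_vector_derivative rate (x t)) (at t within {0..}))"
    and stays: "\<And>J x x' t. is_interval J \<Longrightarrow> 0 \<in> J \<Longrightarrow> J \<subseteq> {0..} \<Longrightarrow> (\<And>t. t \<in> J \<Longrightarrow> x t \<in> S) \<Longrightarrow>
       (\<And>t. t \<in> J \<Longrightarrow> (x has_vector_derivative x' t) (at t within J)) \<Longrightarrow>
       (\<And>t. t \<in> J \<Longrightarrow> x t \<in> K \<Longrightarrow> x' t = rate (x t)) \<Longrightarrow> x 0 \<in> ball p \<delta> \<Longrightarrow> t \<in> J \<Longrightarrow> x t \<in> K"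
    and extends: "\<And>\<tau> x. \<tau> > 0 \<Longrightarrow> x 0 \<in> ball p \<delta> \<Longrightarrow> (\<And>t. t \<in> {0..<\<tau>} \<Longrightarrow> x t \<in> K) \<Longrightarrow>
       (\<And>t. t \<in> {0..<\<tau>} \<Longrightarrow> (x has_vector_derivative rate (x t)) (at t within {0..<\<tau>})) \<Longrightarrow>
       \<exists>y. (\<forall>t\<in>{0..<\<tau>}. y t = x t) \<and>
         (\<forall>t\<ge>0. y t \<in> K \<and> (y has_vector_derivative rate (y t)) (at t within {0..}))"
  have ex: "\<exists>z. solution_on P (time_domain \<infinity>) z \<and> state_of P (z 0) = s" if s: "s \<in> ball p \<delta> \<inter> S" for s
  proof -
    obtain x where x: "x 0 = s" "\<And>t. t \<ge> 0 \<Longrightarrow> x t \<in> K"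
      "\<And>t. t \<ge> 0 \<Longrightarrow> (x has_vector_derivative rate (x t)) (at t within {0..})"
      using exists[OF s] by blast
    have "solution_on P {0..} (\<lambda>t. config_of (x t))"
      by (rule solution_of_rate) (use x in auto)
    then show ?thesis
      unfolding time_domain_simps using config_of(1)[OF x(2)[of 0]] x(1)
      by (intro exI[of _ "\<lambda>t. config_of (x t)"] conjI) simp_all
  qed
  have conv: "\<tau> = \<infinity> \<and> (z \<longlongrightarrow> zs) at_top"
    if max: "maximal_solution P \<tau> z" and start: "state_of P (z 0) \<in> ball p \<delta>" for \<tau> z
  proof -
    define J where "J = time_domain \<tau>"
    have "\<tau> > 0" and sol: "solution_on P J z"
      and maximal: "\<And>\<tau>' z'. \<tau> < \<tau>' \<Longrightarrow> solution_on P (time_domain \<tau>') z' \<Longrightarrow> (\<forall>t\<in>J. z' t = z t) \<Longrightarrow> False"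
      using max unfolding maximal_solution_def J_def by blast+
    define x where "x = (\<lambda>t. state_of P (z t))"
    have z_sol: "x t \<in> S" "load_equations P (z t)" "(x has_vector_derivative net_rate P (z t)) (at t within J)"
      if "t \<in> J" for t
      using sol that unfolding solution_on_iff x_def S_def by blast+
    have z_eq: "z t = config_of (x t)" if "t \<in> J" "x t \<in> K" for t
      by (rule config_of(3)[OF that(2)]) (use z_sol(2)[OF that(1)] in \<open>simp_all add: x_def\<close>)
    have J: "is_interval J" "0 \<in> J" "J \<subseteq> {0..}"
      using \<open>\<tau> > 0\<close> unfolding is_interval_1 J_def time_domain_def
      by (auto simp: zero_ereal_def intro: order_le_less_trans[OF ereal_less_eq(3)[THEN iffD2]])
    have inK: "x t \<in> K" if "t \<in> J" for t
    proof (rule stays[OF J z_sol(1,3) _ _ that])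
      show "net_rate P (z t) = rate (x t)" if "t \<in> J" "x t \<in> K" for t
        using z_eq[OF that] by (simp add: rate_def)
      show "x 0 \<in> ball p \<delta>" using start by (simp add: x_def)
    qed
    have der: "(x has_vector_derivative rate (x t)) (at t within J)" if "t \<in> J" for t
      using z_sol(3)[OF that] z_eq[OF that inK[OF that]] by (simp add: rate_def)
    have "\<tau> = \<infinity>"
    proof (rule ccontr)
      assume "\<tau> \<noteq> \<infinity>"
      then obtain T where T: "\<tau> = ereal T" "T > 0" using \<open>\<tau> > 0\<close> by (cases \<tau>) auto
      then have J_eq: "J = {0..<T}" by (simp add: J_def time_domain_simps)
      obtain y where y: "\<And>t. t \<in> {0..<T} \<Longrightarrow> y t = x t" "\<And>t. t \<ge> 0 \<Longrightarrow> y t \<in> K"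
        "\<And>t. t \<ge> 0 \<Longrightarrow> (y has_vector_derivative rate (y t)) (at t within {0..})"
        using extends[OF T(2), of x] start inK der unfolding J_eq x_def by blast
      have "solution_on P {0..} (\<lambda>t. config_of (y t))"
        by (rule solution_of_rate) (use y in auto)
      moreover have "config_of (y t) = z t" if "t \<in> J" for t
        using y(1)[of t] that z_eq[OF that inK[OF that]] by (simp add: J_eq)
      ultimately show False
        using maximal[of \<infinity> "\<lambda>t. config_of (y t)"] T(1) by (simp add: time_domain_simps)
    qed
    then have J_eq: "J = {0..}" by (simp add: J_def time_domain_simps)
    have x_lim: "(x \<longlongrightarrow> p) at_top"
      by (rule solution_converges) (use inK der in \<open>auto simp: J_eq\<close>)
    have ev: "\<forall>\<^sub>F t in at_top. t \<in> J" using eventually_ge_at_top[of 0] by (simp add: J_eq)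
    have "((\<lambda>t. config_of (x t)) \<longlongrightarrow> config_of p) at_top"
      by (rule continuous_on_tendsto_compose[OF config_of_continuous x_lim p_in_K])
        (rule eventually_mono[OF ev inK])
    moreover have "\<forall>\<^sub>F t in at_top. config_of (x t) = z t"
      by (rule eventually_mono[OF ev]) (simp only: z_eq inK)
    ultimately have "(z \<longlongrightarrow> zs) at_top"
      unfolding config_of_p by (rule Lim_transform_eventually)
    with \<open>\<tau> = \<infinity>\<close> show ?thesis by simp
  qed
  show thesis by (rule that[OF \<delta>]) (fact ex, fact conv)
qed

end

theorem theorem3:
  fixes P :: "('n::finite, 'a::euclidean_space, 'b::euclidean_space, 'c::euclidean_space) power_network"
    and Q :: "'n oslc"
    and zs :: "('n, 'a, 'b, 'c) config"
    and VG :: "'n \<Rightarrow> 'a \<times> 'b \<times> 'c \<Rightarrow> real"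
    and VL :: "'n \<Rightarrow> 'b \<times> 'c \<Rightarrow> real"
  assumes "wf_network P"
    and "wf_oslc P Q"
    and "is_equilibrium P zs"
    and "angle_security P zs"
    and "passive_buses P zs VG VL"
    and "strict_storage_minima P zs VG VL"
    and "unique_load_frequencies P zs"
    and "cost_regularity P Q"
    and "optimal_droop P Q"
  shows "\<exists>U. open U \<and> state_of P zs \<in> U \<and>
    (\<forall>s\<in>U \<inter> state_space P. \<exists>\<tau>>0. \<exists>z. solution_on P (time_domain \<tau>) z \<and> state_of P (z 0) = s) \<and>
    (\<forall>\<tau> z. maximal_solution P \<tau> z \<and> state_of P (z 0) \<in> U \<longrightarrow>
      \<tau> = \<infinity> \<and> (\<exists>ze. optimal_equilibrium P Q ze \<and> (z \<longlongrightarrow> ze) at_top))"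
proof -
  interpret passive_network_equilibrium P zs VG VL "state_space P" "state_of P zs" "\<lambda>j. - (omega zs $ j)"
    by unfold_locales (fact assms)+
  obtain U D \<phi> r where "passive_network_region P zs VG VL U D \<phi> r"
    by (rule region_exists)
  then interpret passive_network_region P zs VG VL "state_space P" "state_of P zs" "\<lambda>j. - (omega zs $ j)"
      U D \<phi> r "cball (state_of P zs) r \<inter> state_space P"
    by simp
  have optimal: "optimal_equilibrium P Q zs"
    by (rule equilibrium_optimal) (fact assms)+
  show ?thesis
  proof (rule network_converges)
    fix \<delta> :: real
    assume \<delta>: "\<delta> > 0"
      and exists: "\<And>s. s \<in> ball (state_of P zs) \<delta> \<inter> state_space P \<Longrightarrow>
        \<exists>z. solution_on P (time_domain \<infinity>) z \<and> state_of P (z 0) = s"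
      and conv: "\<And>\<tau> z. maximal_solution P \<tau> z \<Longrightarrow> state_of P (z 0) \<in> ball (state_of P zs) \<delta> \<Longrightarrow>
        \<tau> = \<infinity> \<and> (z \<longlongrightarrow> zs) at_top"
    show ?thesis
    proof (intro exI[of _ "ball (state_of P zs) \<delta>"] conjI ballI allI impI)
      fix s assume "s \<in> ball (state_of P zs) \<delta> \<inter> state_space P"
      from exists[OF this]
      show "\<exists>\<tau>>0. \<exists>z. solution_on P (time_domain \<tau>) z \<and> state_of P (z 0) = s"
        by (intro exI[of _ \<infinity>] conjI) simp_all
    next
      fix \<tau> z assume z: "maximal_solution P \<tau> z \<and> state_of P (z 0) \<in> ball (state_of P zs) \<delta>"
      show "\<tau> = \<infinity>" using conv z by blast
      show "\<exists>ze. optimal_equilibrium P Q ze \<and> (z \<longlongrightarrow> ze) at_top"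
        using conv z optimal by blast
    qed (use \<delta> in auto)
  qed
qed

end
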